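(* Let $k\geq r\geq 2$ be integers and let $p\geq r$ be real. Then there is $n_0$ such that for every $H_{k+1}^{(r)}$-free $r$-graph $H$ on $n>n_0$ vertices, \[ \lambda^{(p)}(H)\leq \lambda^{(p)}(T_r(n,k)), \] with equality if and only if $H\cong T_r(n,k)$.
   Context: An $r$-graph is an $r$-uniform hypergraph. For an $r$-graph $H$ on vertex set $[n]$ and a real $p\geq 1$, the $p$-spectral radius is $\lambda^{(p)}(H)=\max_{\bm{x}\in\mathbb{R}^n,\ \|\bm{x}\|_p=1} r!\sum_{e\in E(H)}\prod_{v\in e}x_v$, where $\|\bm{x}\|_p=(\sum_i|x_i|^p)^{1/p}$. $H$ is $F$-free if it contains no subgraph isomorphic to $F$. $T_r(n,k)$ is the complete $k$-partite $r$-graph on $n$ vertices: the vertex set is partitioned into $k$ parts whose sizes differ by at most one, and the edges are all $r$-sets containing at most one vertex from each part. $H_{k+1}^{(r)}$ is the $r$-graph obtained from the complete graph $K_{k+1}$ by enlarging each of its edges with a new set of $r-2$ vertices, these new sets being pairwise disjoint and disjoint from $V(K_{k+1})$. *)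

theory Defs
  imports "HOL-Analysis.Analysis"
begin

datatype 'a hypergraph = Hypergraph (verts: "'a set") (edges: "'a set set")

definition r_graph :: "nat \<Rightarrow> 'a hypergraph \<Rightarrow> bool" where
  "r_graph r H \<longleftrightarrow> finite (verts H) \<and> (\<forall>e\<in>edges H. e \<subseteq> verts H \<and> card e = r)"

definition isomorphic :: "'a hypergraph \<Rightarrow> 'b hypergraph \<Rightarrow> bool" where
  "isomorphic G H \<longleftrightarrow>
     (\<exists>f. bij_betw f (verts G) (verts H) \<and> (`) f ` edges G = edges H)"

definition subhypergraph :: "'a hypergraph \<Rightarrow> 'a hypergraph \<Rightarrow> bool" where
  "subhypergraph G H \<longleftrightarrow> verts G \<subseteq> verts H \<and> edges G \<subseteq> edges H"

definition free_of :: "'b hypergraph \<Rightarrow> 'a hypergraph \<Rightarrow> bool" where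
  "free_of F H \<longleftrightarrow> \<not> (\<exists>G. subhypergraph G H \<and> isomorphic F G)"

definition lp_norm :: "real \<Rightarrow> 'a set \<Rightarrow> ('a \<Rightarrow> real) \<Rightarrow> real" where
  "lp_norm p V x = (\<Sum>v\<in>V. \<bar>x v\<bar> powr p) powr (1 / p)"

definition poly_form :: "nat \<Rightarrow> 'a hypergraph \<Rightarrow> ('a \<Rightarrow> real) \<Rightarrow> real" where
  "poly_form r H x = fact r * (\<Sum>e\<in>edges H. \<Prod>v\<in>e. x v)"

text \<open>A vector is a function on the whole vertex type; its values outside
  \<open>verts H\<close> are irrelevant. The supremum is a maximum, see \<open>spectral_radius_is_max\<close>.\<close>

definition spectral_radius :: "nat \<Rightarrow> real \<Rightarrow> 'a hypergraph \<Rightarrow> real" where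
  "spectral_radius r p H = (SUP x\<in>{x. lp_norm p (verts H) x = 1}. poly_form r H x)"

definition complete_partite :: "nat \<Rightarrow> 'a set \<Rightarrow> ('a \<Rightarrow> 'i) \<Rightarrow> 'a hypergraph" where
  "complete_partite r V c =
     Hypergraph V {e. e \<subseteq> V \<and> card e = r \<and> (\<forall>i. card {v\<in>e. c v = i} \<le> 1)}"

text \<open>The balanced partition is the one into residue classes modulo \<open>k\<close>.\<close>

definition turan :: "nat \<Rightarrow> nat \<Rightarrow> nat \<Rightarrow> nat hypergraph" where
  "turan r n k = complete_partite r {..<n} (\<lambda>v. v mod k)"

definition complete_graph :: "nat \<Rightarrow> nat hypergraph" where
  "complete_graph m = Hypergraph {..<m} {e. e \<subseteq> {..<m} \<and> card e = 2}"

text \<open>\<open>New e j\<close> is the \<open>j\<close>-th of the \<open>r - 2\<close> vertices added to the edge \<open>e\<close>.\<close>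

datatype 'a exp_vertex = Core 'a | New "'a set" nat

definition expansion :: "nat \<Rightarrow> 'a hypergraph \<Rightarrow> 'a exp_vertex hypergraph" where
  "expansion r G =
     Hypergraph (Core ` verts G \<union> {New e j |e j. e \<in> edges G \<and> j < r - 2})
                ((\<lambda>e. Core ` e \<union> New e ` {..<r - 2}) ` edges G)"

definition expanded_clique :: "nat \<Rightarrow> nat \<Rightarrow> nat exp_vertex hypergraph" where
  "expanded_clique r m = expansion r (complete_graph m)"


lemma r_graph_complete_partite: "finite V \<Longrightarrow> r_graph r (complete_partite r V c)"
  by (auto simp: r_graph_def complete_partite_def)

lemma r_graph_expansion:
  assumes "r_graph 2 G" "r \<ge> 2"
  shows "r_graph r (expansion r G)"
proof -
  have fin: "finite (verts G)" and E: "\<And>e. e \<in> edges G \<Longrightarrow> e \<subseteq> verts G \<and> card e = 2"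
    using assms(1) by (auto simp: r_graph_def)
  have "edges G \<subseteq> Pow (verts G)" using E by auto
  then have fE: "finite (edges G)" using fin by (meson finite_Pow_iff finite_subset)
  have "{New e j |e j. e \<in> edges G \<and> j < r - 2} = (\<lambda>(e, j). New e j) ` (edges G \<times> {..<r - 2})"
    by auto
  then have "finite {New e j |e j. e \<in> edges G \<and> j < r - 2}" using fE by simp
  moreover have "card (Core ` e \<union> New e ` {..<r - 2}) = r" if "e \<in> edges G" for e
  proof -
    have "finite e" using E[OF that] fin finite_subset by blast
    then have "card (Core ` e \<union> New e ` {..<r - 2}) = card (Core ` e) + card (New e ` {..<r - 2})"
      by (intro card_Un_disjoint) auto
    also have "\<dots> = 2 + (r - 2)"
      using E[OF that] by (simp add: card_image inj_on_def)
    finally show ?thesis using assms(2) by simp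
  qed
  ultimately show ?thesis
    using fin E by (force simp: r_graph_def expansion_def)
qed

lemma r_graph_expanded_clique: "r \<ge> 2 \<Longrightarrow> r_graph r (expanded_clique r m)"
  unfolding expanded_clique_def
  by (rule r_graph_expansion) (auto simp: r_graph_def complete_graph_def)

lemma turan_parts_balanced:
  fixes i j k n :: nat
  assumes "i < k" "j < k"
  shows "card {v\<in>{..<n}. v mod k = i} \<le> card {v\<in>{..<n}. v mod k = j} + 1"
proof -
  have "(\<lambda>v. v - k + j - i) ` ({v\<in>{..<n}. v mod k = i} - {i}) \<subseteq> {v\<in>{..<n}. v mod k = j}"
  proof clarsimp
    fix v assume v: "v < n" "v \<noteq> v mod k" "i = v mod k"
    then obtain q where q: "v = Suc q * k + i"
      by (metis add_0 div_mult_mod_eq mult_0 not0_implies_Suc)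
    have "v - k + j - v mod k = q * k + j" using q v(3) by simp
    moreover have "q * k + j < n" using q v(1) assms by simp
    ultimately show "v - k + j - v mod k < n \<and> (v - k + j - v mod k) mod k = j"
      using assms by simp
  qed
  moreover have "inj_on (\<lambda>v. v - k + j - i) ({v\<in>{..<n}. v mod k = i} - {i})"
  proof (rule inj_onI, clarsimp)
    fix v w assume vw: "v \<noteq> v mod k" "i = v mod k" "w mod k = v mod k" "w \<noteq> v mod k"
      "v - k + j - v mod k = w - k + j - v mod k"
    obtain q where q: "v = Suc q * k + i"
      using vw(1,2) by (metis add_0 div_mult_mod_eq mult_0 not0_implies_Suc)
    obtain q' where q': "w = Suc q' * k + i"
      using vw(2,3,4) by (metis add_0 div_mult_mod_eq mult_0 not0_implies_Suc)
    have "v - k + j - i = w - k + j - i" using vw(5) vw(2) by simp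
    then show "v = w" unfolding q q' by simp
  qed
  ultimately have "card ({v\<in>{..<n}. v mod k = i} - {i}) \<le> card {v\<in>{..<n}. v mod k = j}"
    by (intro card_inj_on_le) auto
  then show ?thesis
    using diff_card_le_card_Diff[of "{i}" "{v\<in>{..<n}. v mod k = i}"] by simp
qed

lemma lp_norm_eq_1_iff:
  assumes "p \<ge> 1"
  shows "lp_norm p V x = 1 \<longleftrightarrow> (\<Sum>v\<in>V. \<bar>x v\<bar> powr p) = 1"
proof -
  have "(\<Sum>v\<in>V. \<bar>x v\<bar> powr p) \<ge> 0" by (simp add: sum_nonneg)
  then have "lp_norm p V x powr p = (\<Sum>v\<in>V. \<bar>x v\<bar> powr p)"
    using assms by (simp add: lp_norm_def powr_powr)
  then show ?thesis by (metis lp_norm_def powr_one_eq_one)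
qed

lemma spectral_radius_is_max:
  assumes H: "r_graph r H" and ne: "verts H \<noteq> {}" and p: "p \<ge> 1"
  shows "\<exists>x. lp_norm p (verts H) x = 1 \<and> poly_form r H x = spectral_radius r p H"
    and "\<And>x. lp_norm p (verts H) x = 1 \<Longrightarrow> poly_form r H x \<le> spectral_radius r p H"
proof -
  define V where "V = verts H"
  define S where "S x = (\<Sum>v\<in>V. \<bar>x v\<bar> powr p)" for x :: "'a \<Rightarrow> real"
  have fin: "finite V" and E: "\<And>e. e \<in> edges H \<Longrightarrow> e \<subseteq> V"
    using H by (auto simp: r_graph_def V_def)
  have norm: "lp_norm p (verts H) x = 1 \<longleftrightarrow> S x = 1" for x
    using lp_norm_eq_1_iff[OF p] by (simp add: S_def V_def)
  have cproj: "continuous_on UNIV (\<lambda>x :: 'a \<Rightarrow> real. x v)" for v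
    by simp
  define B where "B = (\<Pi>\<^sub>E v\<in>UNIV. if v \<in> V then {-1..1::real} else {0})"
  have "compact B"
    using compactin_PiE[of "\<lambda>_. euclidean :: real topology" UNIV "\<lambda>v. if v \<in> V then {-1..1::real} else {0}"]
    unfolding B_def euclidean_product_topology by simp
  have cS: "continuous_on UNIV S"
    unfolding S_def using p by (intro continuous_intros continuous_on_powr' cproj) auto
  have cP: "continuous_on UNIV (poly_form r H)"
    unfolding poly_form_def[abs_def] by (intro continuous_intros cproj)
  define K where "K = B \<inter> {x. S x = 1}"
  have "closed {x. S x = 1}"
    by (intro closed_Collect_eq cS continuous_on_const)
  with \<open>compact B\<close> have "compact K" unfolding K_def by (rule compact_Int_closed)
  have restr: "\<exists>y\<in>K. poly_form r H y = poly_form r H x" if "S x = 1" for x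
  proof
    let ?y = "\<lambda>v. if v \<in> V then x v else 0"
    have "\<bar>x v\<bar> \<le> 1" if "v \<in> V" for v
    proof (rule ccontr)
      assume "\<not> \<bar>x v\<bar> \<le> 1"
      then have "1 < \<bar>x v\<bar> powr p" using p by (intro gr_one_powr) auto
      also have "\<dots> \<le> S x"
        unfolding S_def using that fin by (intro member_le_sum) auto
      finally show False using \<open>S x = 1\<close> by simp
    qed
    moreover have "S ?y = 1" using that by (simp add: S_def)
    ultimately show "?y \<in> K" by (auto simp: K_def B_def PiE_def abs_le_iff minus_le_iff)
    show "poly_form r H ?y = poly_form r H x"
      unfolding poly_form_def using E by (intro arg_cong2[of _ _ _ _ "(*)"] sum.cong prod.cong) auto
  qed
  obtain u where "u \<in> V" using ne V_def by auto
  have "(\<lambda>v. if v = u then 1 else 0) \<in> {x. S x = 1}"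
    using \<open>u \<in> V\<close> fin p by (simp add: S_def if_distrib[of "\<lambda>z. z powr p"] cong: if_cong)
  then have "K \<noteq> {}" using restr by blast
  then obtain z where z: "z \<in> K" "\<And>y. y \<in> K \<Longrightarrow> poly_form r H y \<le> poly_form r H z"
    using continuous_attains_sup[OF \<open>compact K\<close>, of "poly_form r H"] cP continuous_on_subset by blast
  have Sz: "S z = 1" using z(1) by (simp add: K_def)
  have le: "poly_form r H x \<le> poly_form r H z" if "S x = 1" for x
    using restr[OF that] z(2) by force
  have eq: "spectral_radius r p H = poly_form r H z"
    unfolding spectral_radius_def norm using Sz le by (intro cSup_eq_maximum) auto
  show "\<exists>x. lp_norm p (verts H) x = 1 \<and> poly_form r H x = spectral_radius r p H"
    using norm Sz eq by auto
  show "\<And>x. lp_norm p (verts H) x = 1 \<Longrightarrow> poly_form r H x \<le> spectral_radius r p H"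
    using norm le eq by simp
qed

end

theory Submission
  imports Defs
begin

text \<open>
  Let \<open>x\<close> be a nonnegative maximizer of an \<open>H\<close> that does at least as well as the Turan graph \<open>T\<close>. Call
  a pair of vertices good if it lies in an edge avoiding any prescribed bounded set. Good pairs form a
  \<open>K\<^sub>k\<^sub>+\<^sub>1\<close>-free graph, and all but \<open>O(n\<^sup>r\<^sup>-\<^sup>1)\<close> edges of \<open>H\<close> are cliques of this graph, so the
  weighted Moon-Moser inequality determines \<open>\<lambda>\<close> up to a relative error \<open>O(1/n)\<close>. By stability of the
  power mean inequality all but \<open>O(1)\<close> vertices have \<open>x\<^sub>v\<close> close to \<open>n\<close> to the power \<open>-1/p\<close>; by the
  eigenvector equation they have nearly maximal weighted degree. A \<open>K\<^sub>k\<^sub>+\<^sub>1\<close>-free graph of such minimum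
  degree splits into \<open>k\<close> parts around any of its \<open>k\<close>-cliques, and every vertex of large weighted degree
  misses essentially one part. An edge with two vertices of the same part would complete an expanded
  clique, so \<open>H\<close> is \<open>k\<close>-partite on the vertices of large degree. The remaining vertices do not exist,
  since moving them into one part of the complete \<open>k\<close>-partite graph would beat \<open>T\<close>. Finally,
  balancing two parts of a complete \<open>k\<close>-partite graph increases its spectral radius.
\<close>


section \<open>Weighted clique counts\<close>

text \<open>The hypothesis \<open>p \<ge> r\<close> enters through concavity of
  \<open>t powr (r / p)\<close>: changing a test vector costs at most a term linear in the change of
  its p-th power sum. The eigenvector equation and the removal of light vertices both weigh this
  linear cost against a linear gain. From \<open>p \<ge> 2\<close> comes a quadratic term in the
  power mean inequality, hence a total deviation bounded independently of \<open>n\<close>. The main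
  obstacle is that bad edges are few in total but may concentrate at single vertices. Hence there
  are two thresholds. The class \<open>W\<close> is defined by weight and by few bad edges; its
  vertices have controlled neighbourhoods and determine the parts. The larger class \<open>U\<close>
  is defined by weight alone, so that every vertex outside it is light enough to be moved with
  profit. For a vertex of \<open>U\<close> only the bad pairs containing it are bounded; its
  remaining edges are counted through the parts already found inside \<open>W\<close>. The error
  left by \<open>W\<close> must be small against the threshold of \<open>U\<close>, since the gain
  from moving light vertices has to survive it.\<close>

definition cliques :: "('a \<Rightarrow> 'a \<Rightarrow> bool) \<Rightarrow> 'a set \<Rightarrow> nat \<Rightarrow> 'a set set" where
  "cliques G Y s = {B. B \<subseteq> Y \<and> card B = s \<and> pairwise G B}"

text \<open>An elementary symmetric polynomial restricted to cliques. As \<open>pairwise\<close>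
  ignores the diagonal, \<open>G\<close> may be reflexive: the constantly true relation gives the
  full symmetric polynomial, and \<open>c u \<noteq> c v\<close> gives, up to \<open>fact s\<close>,
  the form of a complete multipartite hypergraph.\<close>

definition clique_weight :: "('a \<Rightarrow> 'a \<Rightarrow> bool) \<Rightarrow> 'a set \<Rightarrow> ('a \<Rightarrow> real) \<Rightarrow> nat \<Rightarrow> real" where
  "clique_weight G Y w s = (\<Sum>B\<in>cliques G Y s. \<Prod>v\<in>B. w v)"

definition common_nbrs :: "('a \<Rightarrow> 'a \<Rightarrow> bool) \<Rightarrow> 'a set \<Rightarrow> 'a set \<Rightarrow> 'a set" where
  "common_nbrs G Y B = {v\<in>Y. v \<notin> B \<and> (\<forall>u\<in>B. G u v)}"

lemma finite_cliques: "finite Y \<Longrightarrow> finite (cliques G Y s)"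
  unfolding cliques_def by (rule finite_subset[of _ "Pow Y"]) auto

lemma finite_common_nbrs: "finite Y \<Longrightarrow> finite (common_nbrs G Y B)"
  unfolding common_nbrs_def by simp

lemma finite_clique: "finite Y \<Longrightarrow> B \<in> cliques G Y s \<Longrightarrow> finite B"
  unfolding cliques_def using finite_subset by blast

lemma cliques_0: "finite Y \<Longrightarrow> cliques G Y 0 = {{}}"
  unfolding cliques_def using finite_subset[of _ Y] by (force simp: card_eq_0_iff)

lemma clique_weight_0: "finite Y \<Longrightarrow> clique_weight G Y w 0 = 1"
  by (simp add: clique_weight_def cliques_0)

lemma clique_prod_nonneg:
  assumes "\<And>v. v \<in> Y \<Longrightarrow> (w v :: real) \<ge> 0" "B \<in> cliques G Y s"
  shows "(\<Prod>v\<in>B. w v) \<ge> 0"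
  using assms by (intro prod_nonneg) (auto simp: cliques_def)

lemma clique_weight_nonneg:
  assumes "\<And>v. v \<in> Y \<Longrightarrow> w v \<ge> 0"
  shows "clique_weight G Y w s \<ge> 0"
  unfolding clique_weight_def by (intro sum_nonneg clique_prod_nonneg[OF assms])

lemma clique_in_common_nbrs:
  assumes "finite Y" "symp G" "B \<in> cliques G Y s" "a \<in> common_nbrs G Y B"
  shows "insert a B \<in> cliques G Y (Suc s)"
proof -
  have "finite B" using assms(1,3) by (rule finite_clique)
  then show ?thesis
    using assms unfolding cliques_def common_nbrs_def
    by (auto simp: pairwise_insert dest: sympD)
qed

text \<open>Double counting of cliques with a marked vertex: deleting the mark is a bijection onto
  pairs of a smaller clique and one of its common neighbours. Symmetry matters because
  \<open>common_nbrs\<close> tests only one direction.\<close>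

lemma sum_clique_extensions:
  assumes "finite Y" "symp G"
  shows "(\<Sum>A\<in>cliques G Y (Suc s). \<Sum>a\<in>A. g (A - {a}) a) =
         (\<Sum>B\<in>cliques G Y s. \<Sum>a\<in>common_nbrs G Y B. (g B a :: real))"
proof -
  have fA: "finite A" if "A \<in> cliques G Y t" for A t
    using finite_clique[OF assms(1) that] .
  have "(\<Sum>A\<in>cliques G Y (Suc s). \<Sum>a\<in>A. g (A - {a}) a) =
        (\<Sum>(A, a)\<in>(SIGMA A:cliques G Y (Suc s). A). g (A - {a}) a)"
    by (rule sum.Sigma) (use assms fA in \<open>auto intro: finite_cliques\<close>)
  also have "... = (\<Sum>(B, a)\<in>(SIGMA B:cliques G Y s. common_nbrs G Y B). g B a)"
  proof (rule sum.reindex_bij_witness[where j = "\<lambda>(A, a). (A - {a}, a)" and i = "\<lambda>(B, a). (insert a B, a)"], goal_cases)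
    case (1 x) then show ?case by auto
  next
    case (2 x)
    then obtain A a where [simp]: "x = (A, a)" and A: "A \<in> cliques G Y (Suc s)" "a \<in> A" by auto
    have "A - {a} \<in> cliques G Y s"
      using A fA[OF A(1)] unfolding cliques_def by (auto simp: pairwise_def)
    moreover have "a \<in> common_nbrs G Y (A - {a})"
      using A unfolding cliques_def common_nbrs_def by (auto simp: pairwise_def)
    ultimately show ?case by simp
  next
    case (3 x) then show ?case by (auto simp: common_nbrs_def)
  next
    case (4 x) then show ?case using clique_in_common_nbrs[OF assms] by auto
  next
    case (5 x) then show ?case by auto
  qed
  also have "... = (\<Sum>B\<in>cliques G Y s. \<Sum>a\<in>common_nbrs G Y B. g B a)"
    by (rule sum.Sigma[symmetric]) (use assms in \<open>auto intro: finite_cliques finite_common_nbrs\<close>)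
  finally show ?thesis .
qed

lemma clique_weight_Suc:
  assumes "finite Y" "symp G"
  shows "real (Suc s) * clique_weight G Y w (Suc s) =
         (\<Sum>B\<in>cliques G Y s. (\<Prod>v\<in>B. w v) * sum w (common_nbrs G Y B))"
proof -
  have "(\<Sum>B\<in>cliques G Y s. (\<Prod>v\<in>B. w v) * sum w (common_nbrs G Y B)) =
        (\<Sum>B\<in>cliques G Y s. \<Sum>a\<in>common_nbrs G Y B. (\<Prod>v\<in>B. w v) * w a)"
    by (simp add: sum_distrib_left)
  also have "... = (\<Sum>A\<in>cliques G Y (Suc s). \<Sum>a\<in>A. (\<Prod>v\<in>A - {a}. w v) * w a)"
    by (rule sum_clique_extensions[OF assms, symmetric])
  also have "... = (\<Sum>A\<in>cliques G Y (Suc s). \<Sum>a\<in>A. (\<Prod>v\<in>A. w v))"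
  proof (intro sum.cong refl)
    fix A a assume "A \<in> cliques G Y (Suc s)" "a \<in> A"
    moreover then have "finite A" using finite_clique[OF assms(1)] by blast
    ultimately show "(\<Prod>v\<in>A - {a}. w v) * w a = (\<Prod>v\<in>A. w v)"
      by (simp add: prod.remove mult.commute)
  qed
  also have "... = real (Suc s) * clique_weight G Y w (Suc s)"
    unfolding clique_weight_def sum_distrib_left by (intro sum.cong) (auto simp: cliques_def)
  finally show ?thesis by simp
qed

lemma clique_weight_Suc_le:
  assumes "finite Y" "symp G" "\<And>v. v \<in> Y \<Longrightarrow> w v \<ge> 0"
  shows "real (Suc s) * clique_weight G Y w (Suc s) \<le> sum w Y * clique_weight G Y w s"
proof -
  have "(\<Prod>v\<in>B. w v) * sum w (common_nbrs G Y B) \<le> sum w Y * (\<Prod>v\<in>B. w v)" if "B \<in> cliques G Y s" for B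
  proof -
    have "(\<Prod>v\<in>B. w v) \<ge> 0" by (rule clique_prod_nonneg[OF assms(3) that])
    moreover have "sum w (common_nbrs G Y B) \<le> sum w Y"
      by (rule sum_mono2) (use assms in \<open>auto simp: common_nbrs_def\<close>)
    ultimately show ?thesis by (metis mult.commute mult_left_mono)
  qed
  then have "(\<Sum>B\<in>cliques G Y s. (\<Prod>v\<in>B. w v) * sum w (common_nbrs G Y B)) \<le>
      (\<Sum>B\<in>cliques G Y s. sum w Y * (\<Prod>v\<in>B. w v))"
    by (rule sum_mono)
  then show ?thesis
    by (simp only: clique_weight_Suc[OF assms(1,2)]) (simp add: clique_weight_def sum_distrib_left)
qed

text \<open>Choosing \<open>s\<close> vertices in order counts every clique \<open>fact s\<close>
  times. This crude bound serves where adjacency is ignored altogether.\<close>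

lemma fact_clique_weight_le:
  assumes "finite Y" "symp G" "\<And>v. v \<in> Y \<Longrightarrow> w v \<ge> 0"
  shows "fact s * clique_weight G Y w s \<le> sum w Y ^ s"
proof (induction s)
  case 0 show ?case using assms(1) by (simp add: clique_weight_0)
next
  case (Suc s)
  have "fact (Suc s) * clique_weight G Y w (Suc s) = fact s * (real (Suc s) * clique_weight G Y w (Suc s))"
    by (simp add: algebra_simps)
  also have "... \<le> fact s * (sum w Y * clique_weight G Y w s)"
    by (rule mult_left_mono[OF clique_weight_Suc_le[OF assms]]) auto
  also have "... = sum w Y * (fact s * clique_weight G Y w s)" by simp
  also have "... \<le> sum w Y * sum w Y ^ s"
    by (rule mult_left_mono[OF Suc.IH]) (simp add: sum_nonneg assms)
  finally show ?case by simp
qed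

lemma sum_mult_affine:
  fixes f g :: "'a \<Rightarrow> real"
  shows "(\<Sum>A\<in>S. f A * (t + u * g A)) = sum f S * t + u * (\<Sum>A\<in>S. f A * g A)"
  by (simp add: distrib_left sum.distrib sum_distrib_left sum_distrib_right mult.left_commute)

text \<open>For an \<open>(s + 1)\<close>-clique \<open>A\<close>, a vertex not adjacent to all of \<open>A\<close> is a common neighbour of at most
  one \<open>A - {a}\<close>; summing over all pairs \<open>(A, v)\<close> and applying Cauchy-Schwarz gives the inequality.\<close>

lemma moon_moser:
  assumes "finite Y" "symp G" and w: "\<And>v. v \<in> Y \<Longrightarrow> w v \<ge> 0"
  defines "P \<equiv> clique_weight G Y w"
  shows "(real (Suc s))\<^sup>2 * (P (Suc s))\<^sup>2 \<le>
         P s * (P (Suc s) * sum w Y + real s * real (s + 2) * P (s + 2))"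
proof -
  let ?N = "\<lambda>B. sum w (common_nbrs G Y B)"
  let ?w = "\<lambda>B. \<Prod>v\<in>B. w v"
  have wB: "?w B \<ge> 0" if "B \<in> cliques G Y t" for B t
    by (rule clique_prod_nonneg[OF w that])
  have count: "(\<Sum>a\<in>A. if v \<in> common_nbrs G Y (A - {a}) then 1 else 0) \<le>
      1 + real s * (if v \<in> common_nbrs G Y A then 1 else 0)"
    if A: "A \<in> cliques G Y (Suc s)" and v: "v \<in> Y" for A v
  proof (cases "v \<in> common_nbrs G Y A")
    case True
    have "(\<Sum>a\<in>A. if v \<in> common_nbrs G Y (A - {a}) then 1 else 0) \<le> (\<Sum>a\<in>A. 1 :: real)"
      by (rule sum_mono) auto
    then show ?thesis using A True by (simp add: cliques_def)
  next
    case False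
    have fA: "finite A" using finite_clique[OF assms(1) A] .
    have "\<exists>u. \<forall>a\<in>A. v \<in> common_nbrs G Y (A - {a}) \<longrightarrow> a = u"
    proof (cases "v \<in> A")
      case True
      then show ?thesis by (auto simp: common_nbrs_def)
    next
      case False2: False
      then obtain u where "u \<in> A" "\<not> G u v" using False v by (auto simp: common_nbrs_def)
      then show ?thesis by (auto simp: common_nbrs_def)
    qed
    then obtain u where u: "\<And>a. a \<in> A \<Longrightarrow> v \<in> common_nbrs G Y (A - {a}) \<Longrightarrow> a = u" by blast
    have "(\<Sum>a\<in>A. if v \<in> common_nbrs G Y (A - {a}) then 1 else 0) \<le> (\<Sum>a\<in>A. if a = u then 1 else (0::real))"
    proof (rule sum_mono)
      fix a assume "a \<in> A"
      then show "(if v \<in> common_nbrs G Y (A - {a}) then 1 else 0) \<le> (if a = u then 1 else (0::real))"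
        using u[of a] by (cases "a = u") auto
    qed
    also have "... \<le> 1" using fA by simp
    finally show ?thesis using False by simp
  qed
  have N_eq: "?N B = (\<Sum>v\<in>Y. w v * (if v \<in> common_nbrs G Y B then 1 else 0))" for B
    using assms(1) by (simp add: sum.If_cases if_distrib common_nbrs_def Int_def cong: if_cong)
  have NA: "(\<Sum>a\<in>A. ?N (A - {a})) \<le> sum w Y + real s * ?N A" if A: "A \<in> cliques G Y (Suc s)" for A
  proof -
    have "(\<Sum>a\<in>A. ?N (A - {a})) =
        (\<Sum>v\<in>Y. w v * (\<Sum>a\<in>A. if v \<in> common_nbrs G Y (A - {a}) then 1 else 0))"
      unfolding N_eq sum_distrib_left by (rule sum.swap)
    also have "... \<le> (\<Sum>v\<in>Y. w v * (1 + real s * (if v \<in> common_nbrs G Y A then 1 else 0)))"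
      by (intro sum_mono mult_left_mono count A w)
    also have "... = sum w Y + real s * ?N A"
      unfolding N_eq sum_mult_affine by (rule arg_cong2[where f = "(+)"]) simp_all
    finally show ?thesis .
  qed
  have "(\<Sum>B\<in>cliques G Y s. ?w B * (?N B)\<^sup>2) =
      (\<Sum>B\<in>cliques G Y s. \<Sum>a\<in>common_nbrs G Y B. ?w B * w a * ?N B)"
    by (simp add: power2_eq_square sum_distrib_left[symmetric] sum_distrib_right[symmetric] mult.assoc)
  also have "... = (\<Sum>A\<in>cliques G Y (Suc s). \<Sum>a\<in>A. ?w (A - {a}) * w a * ?N (A - {a}))"
    by (rule sum_clique_extensions[OF assms(1,2), symmetric])
  also have "... = (\<Sum>A\<in>cliques G Y (Suc s). ?w A * (\<Sum>a\<in>A. ?N (A - {a})))"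
  proof (rule sum.cong[OF refl])
    fix A assume A: "A \<in> cliques G Y (Suc s)"
    have "?w (A - {a}) * w a * ?N (A - {a}) = ?w A * ?N (A - {a})" if "a \<in> A" for a
      using that finite_clique[OF assms(1) A] by (simp add: prod.remove mult.commute)
    then have "(\<Sum>a\<in>A. ?w (A - {a}) * w a * ?N (A - {a})) = (\<Sum>a\<in>A. ?w A * ?N (A - {a}))"
      by (rule sum.cong[OF refl])
    also have "... = ?w A * (\<Sum>a\<in>A. ?N (A - {a}))"
      by (rule sum_distrib_left[symmetric])
    finally show "(\<Sum>a\<in>A. ?w (A - {a}) * w a * ?N (A - {a})) = ?w A * (\<Sum>a\<in>A. ?N (A - {a}))" .
  qed
  also have "... \<le> (\<Sum>A\<in>cliques G Y (Suc s). ?w A * (sum w Y + real s * ?N A))"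
    by (intro sum_mono mult_left_mono NA wB)
  also have "... = P (Suc s) * sum w Y + real s * (\<Sum>A\<in>cliques G Y (Suc s). ?w A * ?N A)"
    unfolding sum_mult_affine by (simp add: P_def clique_weight_def)
  also have "... = P (Suc s) * sum w Y + real s * real (s + 2) * P (s + 2)"
    unfolding clique_weight_Suc[OF assms(1,2), symmetric] P_def by simp
  finally have upper: "(\<Sum>B\<in>cliques G Y s. ?w B * (?N B)\<^sup>2) \<le> ..." .
  \<comment> \<open>Splitting each weight into two square roots lets Cauchy-Schwarz produce
    \<open>P s\<close> times the weighted second moment of the extension weights.\<close>
  have "(real (Suc s) * P (Suc s))\<^sup>2 = (\<Sum>B\<in>cliques G Y s. sqrt (?w B) * (sqrt (?w B) * ?N B))\<^sup>2"
    unfolding P_def clique_weight_Suc[OF assms(1,2)]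
    by (intro arg_cong[where f = "\<lambda>x. x\<^sup>2"] sum.cong) (auto simp: wB mult.assoc[symmetric])
  also have "... \<le> (\<Sum>B\<in>cliques G Y s. (sqrt (?w B))\<^sup>2) * (\<Sum>B\<in>cliques G Y s. (sqrt (?w B) * ?N B)\<^sup>2)"
    by (rule Cauchy_Schwarz_ineq_sum)
  also have "... = P s * (\<Sum>B\<in>cliques G Y s. ?w B * (?N B)\<^sup>2)"
    unfolding P_def clique_weight_def
    by (intro arg_cong2[where f = "(*)"] sum.cong) (auto simp: wB power_mult_distrib)
  also have "... \<le> P s * (P (Suc s) * sum w Y + real s * real (s + 2) * P (s + 2))"
    by (intro mult_left_mono upper) (simp add: P_def clique_weight_nonneg w)
  finally show ?thesis by (simp add: power_mult_distrib)
qed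

text \<open>Downward induction starting at \<open>s = q - 1\<close>, where the weight of
  \<open>(q + 1)\<close>-cliques vanishes: Moon-Moser turns an upper bound on the ratio of levels
  \<open>s + 2\<close> and \<open>s + 1\<close> into one for levels \<open>s + 1\<close> and
  \<open>s\<close>. The complete \<open>q\<close>-partite graph with equal part weights attains
  equality throughout.\<close>

lemma clique_weight_ratio:
  assumes "finite Y" "symp G" and w: "\<And>v. v \<in> Y \<Longrightarrow> w v \<ge> 0"
    and free: "cliques G Y (Suc q) = {}" and "s < q"
  shows "real (Suc s) * real q * clique_weight G Y w (Suc s) \<le>
         (real q - real s) * sum w Y * clique_weight G Y w s"
  using \<open>s < q\<close>
proof (induction "q - Suc s" arbitrary: s rule: less_induct)
  case less
  let ?P = "clique_weight G Y w"
  let ?W = "sum w Y"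
  have W0: "?W \<ge> 0" using w by (rule sum_nonneg)
  have P0: "?P t \<ge> 0" for t using w by (rule clique_weight_nonneg)
  have next_ratio: "real (s + 2) * real q * ?P (s + 2) \<le> (real q - real (Suc s)) * ?W * ?P (Suc s)"
  proof (cases "Suc s < q")
    case True
    then show ?thesis using less(1)[of "Suc s"] by (simp add: add.commute)
  next
    case False
    then have "Suc s = q" using less by simp
    then have "?P (s + 2) = 0" using free by (simp add: clique_weight_def)
    then show ?thesis using \<open>Suc s = q\<close> by simp
  qed
  show ?case
  proof (cases "?P (Suc s) = 0")
    case True
    then show ?thesis using W0 P0[of s] less(2) by (simp)
  next
    case False
    then have pos: "?P (Suc s) > 0" using P0[of "Suc s"] by simp
    have q: "real q > 0" using less by simp
    have "real q * (real (Suc s) ^ 2 * ?P (Suc s) ^ 2) \<le>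
        real q * (?P s * (?P (Suc s) * ?W + real s * real (s + 2) * ?P (s + 2)))"
      by (rule mult_left_mono[OF moon_moser[OF assms(1-3)]]) (use q in auto)
    also have "... = ?P s * (real q * ?P (Suc s) * ?W + real s * (real (s + 2) * real q * ?P (s + 2)))"
      by (simp add: algebra_simps)
    also have "... \<le> ?P s * (real q * ?P (Suc s) * ?W + real s * ((real q - real (Suc s)) * ?W * ?P (Suc s)))"
      by (intro mult_left_mono add_left_mono next_ratio P0) auto
    also have "... = (real (Suc s) * ?P (Suc s)) * ((real q - real s) * ?W * ?P s)"
      by (simp add: algebra_simps)
    finally have "(real (Suc s) * ?P (Suc s)) * (real (Suc s) * real q * ?P (Suc s)) \<le>
        (real (Suc s) * ?P (Suc s)) * ((real q - real s) * ?W * ?P s)"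
      by (simp add: power2_eq_square mult_ac)
    then show ?thesis using pos by (simp del: of_nat_Suc)
  qed
qed

lemma binomial_Suc_ratio:
  assumes "s < q"
  shows "real (Suc s) * real (q choose Suc s) = (real q - real s) * real (q choose s)"
proof -
  have "Suc s * (q choose Suc s) = (q - s) * (q choose s)"
    using assms by (metis binomial_absorb_comp binomial_absorption mult.commute)
  then show ?thesis using assms by (metis less_imp_le of_nat_diff of_nat_mult)
qed

theorem clique_weight_bound:
  assumes "finite Y" "symp G" and w: "\<And>v. v \<in> Y \<Longrightarrow> w v \<ge> 0"
    and free: "cliques G Y (Suc q) = {}" and "q > 0" "s \<le> q"
  shows "clique_weight G Y w s \<le> real (q choose s) * (sum w Y / real q) ^ s"
  using \<open>s \<le> q\<close>
proof (induction s)
  case 0 show ?case using assms(1) by (simp add: clique_weight_0)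
next
  case (Suc s)
  let ?P = "clique_weight G Y w"
  let ?W = "sum w Y"
  have W0: "?W \<ge> 0" using w by (rule sum_nonneg)
  have "real (Suc s) * real q * ?P (Suc s) \<le> (real q - real s) * ?W * ?P s"
    by (rule clique_weight_ratio) (use assms Suc in auto)
  also have "... \<le> (real q - real s) * ?W * (real (q choose s) * (?W / real q) ^ s)"
    by (intro mult_left_mono Suc.IH) (use Suc W0 in auto)
  also have "... = (real (Suc s) * real (q choose Suc s)) * ?W * (?W / real q) ^ s"
    using binomial_Suc_ratio[of s q] Suc by simp
  also have "... = real (Suc s) * real q * (real (q choose Suc s) * (?W / real q) ^ Suc s)"
    using \<open>q > 0\<close> by simp
  finally have "(real (Suc s) * real q) * ?P (Suc s) \<le>
      (real (Suc s) * real q) * (real (q choose Suc s) * (?W / real q) ^ Suc s)" .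
  then show ?case
    by (rule mult_left_le_imp_le) (use \<open>q > 0\<close> in simp)
qed

text \<open>Cliques are extended one vertex at a time: the factors \<open>(q - t) * a\<close> for
  \<open>t < s\<close>, divided by \<open>fact s\<close>, multiply to the binomial
  expression.\<close>

lemma clique_weight_lower:
  assumes "finite Y" "symp G" and w: "\<And>v. v \<in> Y \<Longrightarrow> w v \<ge> 0" and "a \<ge> 0" "s \<le> q"
    and step: "\<And>B t. B \<in> cliques G Y t \<Longrightarrow> t < q \<Longrightarrow> (real q - real t) * a \<le> sum w (common_nbrs G Y B)"
  shows "real (q choose s) * a ^ s \<le> clique_weight G Y w s"
  using \<open>s \<le> q\<close>
proof (induction s)
  case 0 show ?case using assms(1) by (simp add: clique_weight_0)
next
  case (Suc s)
  let ?P = "clique_weight G Y w"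
  have "real (Suc s) * (real (q choose Suc s) * a ^ Suc s) = (real q - real s) * a * (real (q choose s) * a ^ s)"
    using binomial_Suc_ratio[of s q] Suc by simp
  also have "... \<le> (real q - real s) * a * ?P s"
    by (intro mult_left_mono Suc.IH) (use Suc \<open>a \<ge> 0\<close> in auto)
  also have "... = (\<Sum>B\<in>cliques G Y s. (real q - real s) * a * (\<Prod>v\<in>B. w v))"
    by (simp add: clique_weight_def sum_distrib_left)
  also have "... \<le> (\<Sum>B\<in>cliques G Y s. (\<Prod>v\<in>B. w v) * sum w (common_nbrs G Y B))"
  proof (rule sum_mono)
    fix B assume B: "B \<in> cliques G Y s"
    have "(\<Prod>v\<in>B. w v) \<ge> 0" by (rule clique_prod_nonneg[OF w B])
    moreover have "(real q - real s) * a \<le> sum w (common_nbrs G Y B)" using step[OF B] Suc.prems by simp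
    ultimately show "(real q - real s) * a * (\<Prod>v\<in>B. w v) \<le> (\<Prod>v\<in>B. w v) * sum w (common_nbrs G Y B)"
      by (metis mult.commute mult_left_mono)
  qed
  also have "... = real (Suc s) * ?P (Suc s)" by (rule clique_weight_Suc[OF assms(1,2), symmetric])
  finally show ?case by (simp del: of_nat_Suc)
qed

text \<open>A \<open>t\<close>-clique meets exactly \<open>t\<close> classes, and every vertex of
  the other \<open>card J - t\<close> classes is a common neighbour of it.\<close>

lemma multipartite_weight_lower:
  assumes "finite Y" "finite J" "c ` Y \<subseteq> J" and w: "\<And>v. v \<in> Y \<Longrightarrow> w v \<ge> 0" and "a \<ge> 0" "s \<le> card J"
    and parts: "\<And>j. j \<in> J \<Longrightarrow> a \<le> sum w {v\<in>Y. c v = j}"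
  shows "real (card J choose s) * a ^ s \<le> clique_weight (\<lambda>u v. c u \<noteq> c v) Y w s"
proof (rule clique_weight_lower)
  fix B t assume B: "B \<in> cliques (\<lambda>u v. c u \<noteq> c v) Y t" and "t < card J"
  have inj: "inj_on c B" using B by (auto simp: cliques_def pairwise_def inj_on_def)
  then have cB: "card (c ` B) = t" "c ` B \<subseteq> J" using B assms(3) by (auto simp: cliques_def card_image)
  have "common_nbrs (\<lambda>u v. c u \<noteq> c v) Y B = (\<Union>j\<in>J - c ` B. {v\<in>Y. c v = j})"
    using assms(3) unfolding common_nbrs_def by (fastforce simp: image_iff)
  then have "sum w (common_nbrs (\<lambda>u v. c u \<noteq> c v) Y B) = (\<Sum>j\<in>J - c ` B. sum w {v\<in>Y. c v = j})"
    using assms(1,2) by (simp only:) (rule sum.UNION_disjoint, auto)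
  also have "... \<ge> (\<Sum>j\<in>J - c ` B. a)" by (rule sum_mono) (use parts in auto)
  also have "(\<Sum>j\<in>J - c ` B. a) = (real (card J) - real t) * a"
    using cB assms(2) \<open>t < card J\<close> by (simp add: card_Diff_subset finite_subset of_nat_diff)
  finally show "(real (card J) - real t) * a \<le> sum w (common_nbrs (\<lambda>u v. c u \<noteq> c v) Y B)" .
qed (use assms in \<open>auto simp: symp_def\<close>)


section \<open>Good pairs and expanded cliques\<close>

text \<open>Every non-good pair lies in \<open>O(n\<^sup>r\<^sup>-\<^sup>3)\<close> edges, while a clique of good pairs can be expanded
  greedily; so the edges containing a non-good pair number only \<open>O(n\<^sup>r\<^sup>-\<^sup>1)\<close>, and no removal lemma
  is needed.\<close>

definition good_pair :: "nat \<Rightarrow> 'a set set \<Rightarrow> 'a \<Rightarrow> 'a \<Rightarrow> bool" where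
  "good_pair M E u v \<longleftrightarrow> u \<noteq> v \<and>
     (\<forall>Q. finite Q \<and> card Q \<le> M \<and> u \<notin> Q \<and> v \<notin> Q \<longrightarrow> (\<exists>e\<in>E. u \<in> e \<and> v \<in> e \<and> e \<inter> Q = {}))"

lemma good_pairD:
  assumes "good_pair M E u v" "finite Q" "card Q \<le> M" "u \<notin> Q" "v \<notin> Q"
  obtains e where "e \<in> E" "u \<in> e" "v \<in> e" "e \<inter> Q = {}"
  using assms unfolding good_pair_def by blast

lemma symp_good_pair: "symp (good_pair M E)"
  unfolding symp_def good_pair_def by blast

text \<open>The sets \<open>g e - K\<close> have \<open>r - 2\<close> elements each and are disjoint
  for distinct pairs, so they can receive the \<open>New\<close> vertices, while \<open>h\<close>
  places the core.\<close>

lemma expanded_clique_embedding: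
  assumes r: "r \<ge> 2" and H: "r_graph r H" and K: "K \<subseteq> verts H" "card K = m"
    and h: "bij_betw h {..<m} K"
    and g: "\<And>e. e \<subseteq> {..<m} \<Longrightarrow> card e = 2 \<Longrightarrow> g e \<in> edges H \<and> g e \<inter> K = h ` e"
    and disj: "\<And>e e'. \<lbrakk>e \<subseteq> {..<m}; card e = 2; e' \<subseteq> {..<m}; card e' = 2; e \<noteq> e'\<rbrakk> \<Longrightarrow> g e \<inter> g e' \<subseteq> K"
  shows "\<not> free_of (expanded_clique r m) H"
proof -
  define PP where "PP = {e. e \<subseteq> {..<m} \<and> card e = 2}"
  have inj_h: "inj_on h {..<m}" and im_h: "h ` {..<m} = K" using h by (auto simp: bij_betw_def)
  have gE: "g e \<in> edges H" "g e \<inter> K = h ` e" if "e \<in> PP" for e using g that by (auto simp: PP_def)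
  have finV: "finite (verts H)" using H by (simp add: r_graph_def)
  have gV: "g e \<subseteq> verts H" "card (g e) = r" "finite (g e)" if "e \<in> PP" for e
    using gE(1)[OF that] H finite_subset[OF _ finV] by (simp_all add: r_graph_def)
  have "card (g e - K) = r - 2" if e: "e \<in> PP" for e
  proof -
    have "card (h ` e) = 2" using e inj_h by (auto simp: PP_def card_image inj_on_subset)
    moreover have "g e - K = g e - h ` e" using gE(2)[OF e] by auto
    moreover have "h ` e \<subseteq> g e" using gE(2)[OF e] by auto
    ultimately show ?thesis
      using gV[OF e] by (simp add: card_Diff_subset finite_subset)
  qed
  then have "\<exists>\<beta>. bij_betw \<beta> {..<r - 2} (g e - K)" if "e \<in> PP" for e
    using that gV(3)[OF that] by (metis ex_bij_betw_nat_finite finite_Diff lessThan_atLeast0)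
  then obtain \<beta> where \<beta>: "\<And>e. e \<in> PP \<Longrightarrow> bij_betw (\<beta> e) {..<r - 2} (g e - K)" by metis
  define f where "f = case_exp_vertex h \<beta>"
  let ?F = "expanded_clique r m"
  have vF: "verts ?F = Core ` {..<m} \<union> {New e j |e j. e \<in> PP \<and> j < r - 2}"
    and eF: "edges ?F = (\<lambda>e. Core ` e \<union> New e ` {..<r - 2}) ` PP"
    by (auto simp: expanded_clique_def expansion_def complete_graph_def PP_def)
  have fNew: "f (New e j) \<in> g e - K" if "e \<in> PP" "j < r - 2" for e j
    using \<beta>[OF that(1)] that(2) by (auto simp: f_def bij_betw_def)
  have fCore: "f (Core i) \<in> K" if "i < m" for i using im_h that by (auto simp: f_def)
  have inj: "inj_on f (verts ?F)"
  proof (rule inj_onI)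
    fix x y assume xy: "x \<in> verts ?F" "y \<in> verts ?F" "f x = f y"
    consider i i' where "x = Core i" "y = Core i'" "i < m" "i' < m"
      | i e j where "x = Core i" "y = New e j" "i < m" "e \<in> PP" "j < r - 2"
      | i e j where "y = Core i" "x = New e j" "i < m" "e \<in> PP" "j < r - 2"
      | e j e' j' where "x = New e j" "y = New e' j'" "e \<in> PP" "j < r - 2" "e' \<in> PP" "j' < r - 2"
      using xy(1,2) unfolding vF by blast
    then show "x = y"
    proof cases
      case 1
      then show ?thesis using xy(3) inj_h by (auto simp: f_def inj_on_def)
    next
      case 2 then show ?thesis using xy(3) fCore fNew by (metis DiffD2)
    next
      case 3 then show ?thesis using xy(3) fCore fNew by (metis DiffD2)
    next
      case 4
      have "e = e'"
      proof (rule ccontr)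
        assume "e \<noteq> e'"
        then have "g e \<inter> g e' \<subseteq> K" using disj 4 by (simp add: PP_def)
        then show False using fNew[OF 4(3,4)] fNew[OF 4(5,6)] xy(3) 4(1,2) by auto
      qed
      then show ?thesis using xy(3) 4 \<beta>[OF 4(3)] by (auto simp: f_def bij_betw_def inj_on_def)
    qed
  qed
  have f_edge: "f ` (Core ` e \<union> New e ` {..<r - 2}) = g e" if e: "e \<in> PP" for e
  proof -
    have "f ` (Core ` e \<union> New e ` {..<r - 2}) = h ` e \<union> \<beta> e ` {..<r - 2}"
      by (simp add: image_Un image_image f_def)
    also have "\<beta> e ` {..<r - 2} = g e - K" using \<beta>[OF e] by (simp add: bij_betw_def)
    finally show ?thesis using gE(2)[OF e] by auto
  qed
  let ?G = "Hypergraph (f ` verts ?F) ((`) f ` edges ?F)"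
  have "isomorphic ?F ?G"
    unfolding isomorphic_def using inj by (intro exI[of _ f]) (auto simp: bij_betw_def)
  moreover have "f ` verts ?F \<subseteq> verts H"
  proof (rule image_subsetI)
    fix x assume "x \<in> verts ?F"
    then consider i where "x = Core i" "i < m" | e j where "x = New e j" "e \<in> PP" "j < r - 2"
      unfolding vF by auto
    then show "f x \<in> verts H"
    proof cases
      case 1 then show ?thesis using fCore K by auto
    next
      case 2 then show ?thesis using fNew[OF 2(2,3)] gV(1)[OF 2(2)] by auto
    qed
  qed
  moreover have "(`) f ` edges ?F \<subseteq> edges H"
    unfolding eF using f_edge gE(1) by auto
  ultimately have "subhypergraph ?G H \<and> isomorphic ?F ?G" by (simp add: subhypergraph_def)
  then show ?thesis unfolding free_of_def by blast
qed

text \<open>Edges are chosen greedily, one for each pair of the core. Goodness lets each new edge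
  avoid the core and all earlier edges, apart from its own two core vertices; these are at most
  \<open>m + r * m\<^sup>2\<close> vertices. The pair \<open>{a, b}\<close> need not be good because
  \<open>e0\<close> serves it, which is how a single edge inside a part will later be
  excluded.\<close>

lemma expanded_clique_of_good_pairs:
  assumes r: "r \<ge> 2" and H: "r_graph r H" and K: "K \<subseteq> verts H" "card K = m"
    and ab: "a \<in> K" "b \<in> K" "a \<noteq> b" and e0: "e0 \<in> edges H" "e0 \<inter> K = {a, b}"
    and good: "\<And>u v. \<lbrakk>u \<in> K; v \<in> K; u \<noteq> v; {u, v} \<noteq> {a, b}\<rbrakk> \<Longrightarrow> good_pair M (edges H) u v"
    and M: "m + r * m\<^sup>2 \<le> M"
  shows "\<not> free_of (expanded_clique r m) H"
proof -
  define PP where "PP = {e. e \<subseteq> {..<m} \<and> card e = 2}"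
  have finV: "finite (verts H)" and E: "\<And>e. e \<in> edges H \<Longrightarrow> finite e \<and> card e = r"
    using H finite_subset by (auto simp: r_graph_def)
  have finK: "finite K" using K finV finite_subset by blast
  obtain h where h: "bij_betw h {..<m} K"
    using ex_bij_betw_nat_finite[OF finK] K(2) by (auto simp: lessThan_atLeast0)
  then have inj_h: "inj_on h {..<m}" and im_h: "h ` {..<m} = K" by (auto simp: bij_betw_def)
  have finP: "finite PP" unfolding PP_def by (rule finite_subset[of _ "Pow {..<m}"]) auto
  have "card PP = m choose 2" unfolding PP_def by (subst n_subsets) auto
  also have "... \<le> m\<^sup>2" by (simp add: choose_two power2_eq_square le_trans[OF div_le_dividend])
  finally have cardP: "card PP \<le> m\<^sup>2" .
  obtain i j where ij: "i < m" "h i = a" "j < m" "h j = b" using ab im_h by blast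
  define e1 where "e1 = {i, j}"
  have e1: "e1 \<in> PP" "h ` e1 = {a, b}" using ij ab by (auto simp: e1_def PP_def card_insert_if)
  \<comment> \<open>The pair \<open>e1\<close> always counts as treated: its edge \<open>e0\<close>
    is prescribed from the start, so all later choices must avoid it.\<close>
  have "\<exists>g. \<forall>e\<in>insert e1 S. g e \<in> edges H \<and> g e \<inter> K = h ` e \<and>
          (\<forall>e'\<in>insert e1 S. e \<noteq> e' \<longrightarrow> g e \<inter> g e' \<subseteq> K)" if "finite S" "S \<subseteq> PP" for S
    using that
  proof (induction S rule: finite_induct)
    case empty
    show ?case by (rule exI[of _ "\<lambda>_. e0"]) (use e0 e1 in auto)
  next
    case (insert e S)
    then have "S \<subseteq> PP" by simp
    from insert.IH[OF this] obtain g where "\<forall>e\<in>insert e1 S. g e \<in> edges H \<and> g e \<inter> K = h ` e \<and>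
          (\<forall>e'\<in>insert e1 S. e \<noteq> e' \<longrightarrow> g e \<inter> g e' \<subseteq> K)" by (rule exE)
    then have g: "g e \<in> edges H \<and> g e \<inter> K = h ` e \<and>
          (\<forall>e'\<in>insert e1 S. e \<noteq> e' \<longrightarrow> g e \<inter> g e' \<subseteq> K)" if "e \<in> insert e1 S" for e
      using that by (rule bspec)
    show ?case
    proof (cases "e = e1")
      case True
      then show ?thesis using g by (intro exI[of _ g]) auto
    next
      case False
      obtain s t where st: "e = {s, t}" "s \<noteq> t" "s < m" "t < m"
        using insert.prems by (auto simp: PP_def card_2_iff)
      let ?u = "h s" and ?v = "h t"
      have uv: "?u \<in> K" "?v \<in> K" "?u \<noteq> ?v"
        using st im_h inj_h by (auto simp: inj_on_def)
      have "h ` e \<noteq> h ` e1"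
        using False insert.prems e1(1) inj_h by (auto simp: PP_def inj_on_image_eq_iff)
      then have guv: "good_pair M (edges H) ?u ?v"
        by (intro good uv) (use st e1 in auto)
      define Q where "Q = (K \<union> \<Union> (g ` insert e1 S)) - {?u, ?v}"
      have finS: "finite (insert e1 S)" using insert.hyps by simp
      have g1: "g e' \<in> edges H" if "e' \<in> insert e1 S" for e' using g[OF that] by (rule conjunct1)
      have finQ': "finite (\<Union> (g ` insert e1 S))"
        by (rule finite_UN_I[OF finS]) (use E g1 in simp)
      have finQ: "finite Q" unfolding Q_def using finK finQ' by blast
      have cardQ: "card Q \<le> M"
      proof -
        have "card Q \<le> card (K \<union> \<Union> (g ` insert e1 S))"
          unfolding Q_def using finK finQ' by (intro card_mono) auto
        also have "... \<le> m + card (\<Union> (g ` insert e1 S))" using card_Un_le K(2) by metis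
        also have "card (\<Union> (g ` insert e1 S)) \<le> (\<Sum>e\<in>insert e1 S. card (g e))"
          by (rule card_UN_le[OF finS])
        also have "... = (\<Sum>e\<in>insert e1 S. r)" by (rule sum.cong) (use g1 E in simp_all)
        also have "... = r * card (insert e1 S)" by simp
        also have "... \<le> r * m\<^sup>2"
          using card_mono[OF finP, of "insert e1 S"] e1 insert.prems cardP by simp
        finally show ?thesis using M by simp
      qed
      have "?u \<notin> Q" "?v \<notin> Q" by (simp_all add: Q_def)
      from good_pairD[OF guv finQ cardQ this] obtain d
        where d: "d \<in> edges H" "?u \<in> d" "?v \<in> d" "d \<inter> Q = {}" .
      have dK: "d \<inter> K = h ` e" using d uv st by (auto simp: Q_def)
      have dg: "d \<inter> g e' \<subseteq> K" if "e' \<in> insert e1 S" for e' using d(4) that uv by (auto simp: Q_def)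
      show ?thesis
      proof (intro exI[of _ "g(e := d)"] ballI)
        fix e2 assume e2: "e2 \<in> insert e1 (insert e S)"
        show "(g(e := d)) e2 \<in> edges H \<and> (g(e := d)) e2 \<inter> K = h ` e2 \<and>
          (\<forall>e'\<in>insert e1 (insert e S). e2 \<noteq> e' \<longrightarrow> (g(e := d)) e2 \<inter> (g(e := d)) e' \<subseteq> K)"
        proof (cases "e2 = e")
          case True
          then show ?thesis using d(1) dK dg by simp
        next
          case False
          then have "e2 \<in> insert e1 S" using e2 by auto
          then show ?thesis using g[of e2] dg[of e2] False by (simp add: Int_commute)
        qed
      qed
    qed
  qed
  from this[OF finP subset_refl] obtain g where
    "\<forall>e\<in>insert e1 PP. g e \<in> edges H \<and> g e \<inter> K = h ` e \<and>
          (\<forall>e'\<in>insert e1 PP. e \<noteq> e' \<longrightarrow> g e \<inter> g e' \<subseteq> K)" by (rule exE)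
  then show ?thesis
    by (intro expanded_clique_embedding[OF r H K h, of g]) (auto simp: PP_def)
qed

text \<open>Goodness of one pair of a hypothetical clique already provides the edge that meets the
  clique in this pair only.\<close>

lemma good_pair_clique_free:
  assumes r: "r \<ge> 2" and H: "r_graph r H" and free: "free_of (expanded_clique r (Suc k)) H" and "k \<ge> 1"
    and M: "Suc k + r * (Suc k)\<^sup>2 \<le> M"
  shows "cliques (good_pair M (edges H)) (verts H) (Suc k) = {}"
proof (rule ccontr)
  assume "\<not> ?thesis"
  then obtain K where K: "K \<subseteq> verts H" "card K = Suc k" "pairwise (good_pair M (edges H)) K"
    by (auto simp: cliques_def)
  have finK: "finite K" using K by (intro card_ge_0_finite) simp
  obtain a b where ab: "a \<in> K" "b \<in> K" "a \<noteq> b"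
    using K(2) \<open>k \<ge> 1\<close> card_le_Suc0_iff_eq[OF finK] by fastforce
  have gab: "good_pair M (edges H) a b" using K(3) ab by (auto simp: pairwise_def)
  have cM: "card (K - {a, b}) \<le> M"
    using card_mono[OF finK, of "K - {a, b}"] K(2) M by simp
  from good_pairD[OF gab _ cM] finK obtain e
    where e: "e \<in> edges H" "a \<in> e" "b \<in> e" "e \<inter> (K - {a, b}) = {}" by simp blast
  have "\<not> free_of (expanded_clique r (Suc k)) H"
    by (rule expanded_clique_of_good_pairs[OF r H K(1,2) ab e(1), of M])
       (use e ab K M in \<open>auto simp: pairwise_def\<close>)
  then show False using free by simp
qed

text \<open>The product form keeps its strength when \<open>r < card T\<close>, as happens for
  \<open>r = 2\<close> and three prescribed vertices; truncated subtraction in an exponent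
  \<open>r - card T\<close> would weaken it there.\<close>

lemma card_supersets_le:
  assumes "finite V" "T \<subseteq> V"
  shows "card {e. e \<subseteq> V \<and> card e = r \<and> T \<subseteq> e} * card V ^ card T \<le> card V ^ r"
proof (cases "card T \<le> r")
  case False
  have "{e. e \<subseteq> V \<and> card e = r \<and> T \<subseteq> e} = {}"
    using False assms(1) card_mono finite_subset by blast
  then show ?thesis by (metis card.empty mult_0 zero_le)
next
  case True
  have finT: "finite T" using assms finite_subset by blast
  have "card {e. e \<subseteq> V \<and> card e = r \<and> T \<subseteq> e} \<le> card {B. B \<subseteq> V - T \<and> card B = r - card T}"
  proof (rule card_inj_on_le[where f = "\<lambda>e. e - T"])
    show "inj_on (\<lambda>e. e - T) {e. e \<subseteq> V \<and> card e = r \<and> T \<subseteq> e}" by (rule inj_onI) blast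
    show "(\<lambda>e. e - T) ` {e. e \<subseteq> V \<and> card e = r \<and> T \<subseteq> e} \<subseteq> {B. B \<subseteq> V - T \<and> card B = r - card T}"
      using finT by (auto simp: card_Diff_subset)
    show "finite {B. B \<subseteq> V - T \<and> card B = r - card T}"
      by (rule finite_subset[of _ "Pow V"]) (use assms(1) in auto)
  qed
  also have "... = card (V - T) choose (r - card T)" using assms(1) by (simp add: n_subsets)
  also have "... \<le> card (V - T) ^ (r - card T)"
    by (cases "r - card T \<le> card (V - T)") (simp_all add: binomial_le_pow binomial_eq_0)
  also have "... \<le> card V ^ (r - card T)" using assms(1) by (intro power_mono card_mono) auto
  finally have "card {e. e \<subseteq> V \<and> card e = r \<and> T \<subseteq> e} * card V ^ card T \<le> card V ^ (r - card T) * card V ^ card T"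
    by simp
  also have "... = card V ^ r" using True by (simp flip: power_add)
  finally show ?thesis .
qed

text \<open>A set \<open>Q\<close> witnessing that the pair is not good meets every edge through
  \<open>u\<close> and \<open>v\<close>. Such an edge therefore contains a third vertex from at most
  \<open>M\<close> candidates.\<close>

lemma card_edges_not_good_pair:
  assumes H: "r_graph r H" and uv: "u \<in> verts H" "v \<in> verts H" "u \<noteq> v"
    and bad: "\<not> good_pair M (edges H) u v"
  shows "card {e\<in>edges H. u \<in> e \<and> v \<in> e} * card (verts H) ^ 3 \<le> M * card (verts H) ^ r"
proof -
  let ?V = "verts H"
  have finV: "finite ?V" and E: "\<And>e. e \<in> edges H \<Longrightarrow> e \<subseteq> ?V \<and> card e = r"
    using H by (auto simp: r_graph_def)
  obtain Q where Q: "finite Q" "card Q \<le> M" "u \<notin> Q" "v \<notin> Q"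
    "\<And>e. e \<in> edges H \<Longrightarrow> u \<in> e \<Longrightarrow> v \<in> e \<Longrightarrow> e \<inter> Q \<noteq> {}"
    using bad uv unfolding good_pair_def by blast
  let ?S = "\<lambda>q. {e. e \<subseteq> ?V \<and> card e = r \<and> {u, v, q} \<subseteq> e}"
  have finS: "finite (?S q)" for q by (rule finite_subset[of _ "Pow ?V"]) (use finV in auto)
  have "card {e\<in>edges H. u \<in> e \<and> v \<in> e} \<le> card (\<Union>q\<in>Q \<inter> ?V. ?S q)"
  proof (rule card_mono)
    show "finite (\<Union>q\<in>Q \<inter> ?V. ?S q)" using Q(1) finS by blast
    show "{e\<in>edges H. u \<in> e \<and> v \<in> e} \<subseteq> (\<Union>q\<in>Q \<inter> ?V. ?S q)"
    proof
      fix e assume "e \<in> {e\<in>edges H. u \<in> e \<and> v \<in> e}"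
      then have e: "e \<in> edges H" "u \<in> e" "v \<in> e" by auto
      with Q(5) obtain q where "q \<in> e" "q \<in> Q" by blast
      then show "e \<in> (\<Union>q\<in>Q \<inter> ?V. ?S q)" using E[OF e(1)] e by auto
    qed
  qed
  also have "... \<le> (\<Sum>q\<in>Q \<inter> ?V. card (?S q))" using Q(1) by (intro card_UN_le) auto
  finally have "card {e\<in>edges H. u \<in> e \<and> v \<in> e} * card ?V ^ 3 \<le> (\<Sum>q\<in>Q \<inter> ?V. card (?S q)) * card ?V ^ 3"
    by (rule mult_right_mono) simp
  also have "... = (\<Sum>q\<in>Q \<inter> ?V. card (?S q) * card ?V ^ 3)" by (rule sum_distrib_right)
  also have "... \<le> (\<Sum>q\<in>Q \<inter> ?V. card ?V ^ r)"
  proof (rule sum_mono)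
    fix q assume q: "q \<in> Q \<inter> ?V"
    then have "card {u, v, q} = 3" using Q uv by (auto simp: card_insert_if)
    then show "card (?S q) * card ?V ^ 3 \<le> card ?V ^ r"
      using card_supersets_le[OF finV, of "{u, v, q}" r] uv q by simp
  qed
  also have "... = card (Q \<inter> ?V) * card ?V ^ r" by simp
  also have "... \<le> M * card ?V ^ r"
    using Q(1,2) card_mono[of Q "Q \<inter> ?V"] by (intro mult_right_mono) auto
  finally show ?thesis .
qed

text \<open>Only bad pairs containing \<open>v\<close> itself count, so a bound of order
  \<open>n ^ (r - 2)\<close> holds at every single vertex. The larger family
  \<open>bad_edges\<close> is bounded only in total.\<close>

definition bad_link :: "nat \<Rightarrow> 'a hypergraph \<Rightarrow> 'a \<Rightarrow> 'a set set" where
  "bad_link M H v = {e\<in>edges H. v \<in> e \<and> (\<exists>u\<in>e. u \<noteq> v \<and> \<not> good_pair M (edges H) v u)}"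

definition bad_edges :: "nat \<Rightarrow> 'a hypergraph \<Rightarrow> 'a set set" where
  "bad_edges M H = {e\<in>edges H. \<not> pairwise (good_pair M (edges H)) e}"

lemma finite_edges: "r_graph r H \<Longrightarrow> finite (edges H)"
  by (rule finite_subset[of _ "Pow (verts H)"]) (auto simp: r_graph_def)

lemma card_bad_link:
  assumes H: "r_graph r H" and v: "v \<in> verts H"
  shows "card (bad_link M H v) * card (verts H) ^ 2 \<le> M * card (verts H) ^ r"
proof -
  let ?V = "verts H"
  let ?B = "{u\<in>?V. u \<noteq> v \<and> \<not> good_pair M (edges H) v u}"
  have finV: "finite ?V" and E: "\<And>e. e \<in> edges H \<Longrightarrow> e \<subseteq> ?V"
    using H by (auto simp: r_graph_def)
  have fE: "finite (edges H)" using H by (rule finite_edges)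
  have V0: "card ?V > 0" using v finV card_gt_0_iff by blast
  have "card (bad_link M H v) \<le> card (\<Union>u\<in>?B. {e\<in>edges H. v \<in> e \<and> u \<in> e})"
    by (rule card_mono) (use finV fE E in \<open>auto simp: bad_link_def\<close>)
  also have "... \<le> (\<Sum>u\<in>?B. card {e\<in>edges H. v \<in> e \<and> u \<in> e})" using finV by (intro card_UN_le) auto
  finally have "card (bad_link M H v) * card ?V ^ 3 \<le> (\<Sum>u\<in>?B. card {e\<in>edges H. v \<in> e \<and> u \<in> e}) * card ?V ^ 3"
    by (rule mult_right_mono) simp
  also have "... = (\<Sum>u\<in>?B. card {e\<in>edges H. v \<in> e \<and> u \<in> e} * card ?V ^ 3)" by (rule sum_distrib_right)
  also have "... \<le> (\<Sum>u\<in>?B. M * card ?V ^ r)"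
    by (rule sum_mono) (use card_edges_not_good_pair[OF H v] in auto)
  also have "... = card ?B * (M * card ?V ^ r)" by simp
  also have "... \<le> card ?V * (M * card ?V ^ r)"
    using finV by (intro mult_right_mono card_mono) auto
  finally have "card ?V * (card (bad_link M H v) * card ?V ^ 2) \<le> card ?V * (M * card ?V ^ r)"
    by (simp add: power3_eq_cube power2_eq_square mult_ac)
  then show ?thesis using V0 by simp
qed

lemma card_bad_edges:
  assumes H: "r_graph r H" and ne: "verts H \<noteq> {}"
  shows "card (bad_edges M H) * card (verts H) \<le> M * card (verts H) ^ r"
proof -
  let ?V = "verts H"
  have finV: "finite ?V" and E: "\<And>e. e \<in> edges H \<Longrightarrow> e \<subseteq> ?V"
    using H by (auto simp: r_graph_def)
  have fE: "finite (edges H)" using H by (rule finite_edges)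
  have V0: "card ?V > 0" using ne finV card_gt_0_iff by blast
  have "card (bad_edges M H) \<le> card (\<Union>v\<in>?V. bad_link M H v)"
  proof (rule card_mono)
    show "finite (\<Union>v\<in>?V. bad_link M H v)" using finV fE by (auto simp: bad_link_def)
    show "bad_edges M H \<subseteq> (\<Union>v\<in>?V. bad_link M H v)"
    proof
      fix e assume e: "e \<in> bad_edges M H"
      then obtain v u where "v \<in> e" "u \<in> e" "u \<noteq> v" "\<not> good_pair M (edges H) v u"
        by (auto simp: bad_edges_def pairwise_def)
      moreover have "e \<in> edges H" using e by (simp add: bad_edges_def)
      ultimately have "e \<in> bad_link M H v \<and> v \<in> ?V" using E unfolding bad_link_def by blast
      then show "e \<in> (\<Union>v\<in>?V. bad_link M H v)" by blast
    qed
  qed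
  also have "... \<le> (\<Sum>v\<in>?V. card (bad_link M H v))" using finV by (rule card_UN_le)
  finally have "card (bad_edges M H) * card ?V ^ 2 \<le> (\<Sum>v\<in>?V. card (bad_link M H v)) * card ?V ^ 2"
    by (rule mult_right_mono) simp
  also have "... = (\<Sum>v\<in>?V. card (bad_link M H v) * card ?V ^ 2)" by (rule sum_distrib_right)
  also have "... \<le> (\<Sum>v\<in>?V. M * card ?V ^ r)"
    by (rule sum_mono) (use card_bad_link[OF H] in auto)
  finally have "card ?V * (card (bad_edges M H) * card ?V) \<le> card ?V * (M * card ?V ^ r)"
    by (simp add: power2_eq_square mult_ac)
  then show ?thesis using V0 by simp
qed


section \<open>The \<open>p\<close>-spectral radius\<close>

lemma bernoulli_powr_le:
  fixes s a :: real
  assumes "0 \<le> a" "a \<le> 1" "s \<ge> -1"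
  shows "(1 + s) powr a \<le> 1 + a * s"
proof (cases "s = -1")
  case True
  then show ?thesis using assms by simp
next
  case False
  then show ?thesis
    using Youngs_inequality_0[of a "1 - a" "1 + s" 1] assms by (simp add: algebra_simps)
qed

lemma bernoulli_powr_ge:
  fixes y p :: real
  assumes "p \<ge> 1" "y \<ge> 0"
  shows "1 + p * (y - 1) \<le> y powr p"
proof -
  have "(1 + (y powr p - 1)) powr (1 / p) \<le> 1 + 1 / p * (y powr p - 1)"
    by (rule bernoulli_powr_le) (use assms in auto)
  then have "y \<le> 1 + 1 / p * (y powr p - 1)" using assms by (simp add: powr_powr)
  then have "p * y \<le> p * (1 + 1 / p * (y powr p - 1))" using assms by (intro mult_left_mono) auto
  then show ?thesis using assms by (simp add: algebra_simps)
qed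

text \<open>This is Bernoulli for the square of \<open>y\<close> with exponent \<open>p / 2\<close>.
  The quadratic term is the source of stability of the power mean inequality.\<close>

lemma powr_ge_quadratic:
  fixes y p :: real
  assumes "p \<ge> 2" "y \<ge> 0"
  shows "1 + p * (y - 1) + p / 2 * (y - 1)\<^sup>2 \<le> y powr p"
proof -
  have "1 + p / 2 * (y\<^sup>2 - 1) \<le> (y\<^sup>2) powr (p / 2)"
    by (rule bernoulli_powr_ge) (use assms in auto)
  also have "(y\<^sup>2) powr (p / 2) = y powr p"
    using assms by (cases "y = 0") (simp_all add: powr_powr flip: powr_numeral)
  also have "1 + p / 2 * (y\<^sup>2 - 1) = 1 + p * (y - 1) + p / 2 * (y - 1)\<^sup>2"
    by (simp add: power2_eq_square field_simps)
  finally show ?thesis .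
qed

text \<open>Tangent line argument at the p-mean \<open>c\<close>: Bernoulli is applied to every
  \<open>x v / c\<close>, and the p-th powers of these quotients sum to
  \<open>card A\<close>.\<close>

lemma power_mean:
  fixes x :: "'a \<Rightarrow> real"
  assumes A: "finite A" "A \<noteq> {}" and p: "p \<ge> 1" and x: "\<And>v. v \<in> A \<Longrightarrow> x v \<ge> 0"
  shows "sum x A \<le> real (card A) * ((\<Sum>v\<in>A. x v powr p) / real (card A)) powr (1 / p)"
proof -
  define T where "T = (\<Sum>v\<in>A. x v powr p)"
  define m where "m = real (card A)"
  have m: "m > 0" using A by (simp add: m_def card_gt_0_iff)
  have T0: "T \<ge> 0" by (simp add: T_def sum_nonneg)
  show ?thesis
  proof (cases "T = 0")
    case True
    then have "\<And>v. v \<in> A \<Longrightarrow> x v = 0" using A(1) by (simp add: T_def sum_nonneg_eq_0_iff)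
    then show ?thesis by simp
  next
    case False
    define c where "c = (T / m) powr (1 / p)"
    have c: "c > 0" using False m by (simp add: c_def)
    have cp: "c powr p = T / m" using False T0 m p by (simp add: c_def powr_powr)
    have "(\<Sum>v\<in>A. 1 + p * (x v / c - 1)) \<le> (\<Sum>v\<in>A. (x v / c) powr p)"
      by (intro sum_mono bernoulli_powr_ge) (use p x c in auto)
    also have "... = T / c powr p"
      unfolding T_def sum_divide_distrib using x c by (intro sum.cong) (auto simp: powr_divide)
    also have "... = m" using cp False m by simp
    also have "(\<Sum>v\<in>A. 1 + p * (x v / c - 1)) = m + p * (sum x A / c - m)"
      by (simp add: sum.distrib sum_subtractf m_def flip: sum_distrib_left sum_divide_distrib)
    finally have "sum x A / c \<le> m" using p by (simp add: mult_le_0_iff)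
    then show ?thesis using c by (simp add: c_def m_def T_def divide_le_eq)
  qed
qed

section \<open>Homogeneity and maximizers\<close>

lemma poly_form_cong:
  assumes "r_graph r H" "\<And>v. v \<in> verts H \<Longrightarrow> x v = y v"
  shows "poly_form r H x = poly_form r H y"
  unfolding poly_form_def
  by (intro arg_cong2[of _ _ _ _ "(*)"] sum.cong prod.cong refl) (use assms in \<open>auto simp: r_graph_def\<close>)

lemma poly_form_scale:
  assumes "r_graph r H"
  shows "poly_form r H (\<lambda>v. t * x v) = t ^ r * poly_form r H x"
proof -
  have "(\<Prod>v\<in>e. t * x v) = t ^ r * (\<Prod>v\<in>e. x v)" if "e \<in> edges H" for e
    using assms that by (auto simp: r_graph_def prod.distrib)
  then show ?thesis unfolding poly_form_def by (simp add: sum_distrib_left mult.left_commute)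
qed

lemma spectral_radius_nonneg_maximizer:
  assumes H: "r_graph r H" and ne: "verts H \<noteq> {}" and p: "p \<ge> 1"
  obtains x where "\<And>v. x v \<ge> 0" "(\<Sum>v\<in>verts H. x v powr p) = 1" "poly_form r H x = spectral_radius r p H"
proof -
  obtain x where x: "lp_norm p (verts H) x = 1" "poly_form r H x = spectral_radius r p H"
    using spectral_radius_is_max(1)[OF H ne p] by blast
  let ?y = "\<lambda>v. \<bar>x v\<bar>"
  have y: "lp_norm p (verts H) ?y = 1" using x(1) by (simp add: lp_norm_def)
  have "(\<Prod>v\<in>e. x v) \<le> (\<Prod>v\<in>e. ?y v)" for e by (metis abs_prod abs_ge_self)
  then have "poly_form r H x \<le> poly_form r H ?y"
    unfolding poly_form_def by (intro mult_left_mono sum_mono) auto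
  moreover have "poly_form r H ?y \<le> spectral_radius r p H" by (rule spectral_radius_is_max(2)[OF H ne p y])
  ultimately have "poly_form r H ?y = spectral_radius r p H" using x(2) by simp
  moreover have "(\<Sum>v\<in>verts H. ?y v powr p) = 1" using y lp_norm_eq_1_iff[OF p, of "verts H" ?y] by simp
  ultimately show ?thesis using that[of ?y] by simp
qed

lemma poly_form_le_spectral_radius:
  assumes H: "r_graph r H" and ne: "verts H \<noteq> {}" and p: "p \<ge> 1" and r: "r \<ge> 1"
    and x: "\<And>v. v \<in> verts H \<Longrightarrow> x v \<ge> 0"
  shows "poly_form r H x \<le> spectral_radius r p H * (\<Sum>v\<in>verts H. x v powr p) powr (real r / p)"
proof -
  define T where "T = (\<Sum>v\<in>verts H. x v powr p)"
  have finV: "finite (verts H)" using H by (simp add: r_graph_def)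
  have T0: "T \<ge> 0" by (simp add: T_def sum_nonneg)
  show ?thesis
  proof (cases "T = 0")
    case True
    then have x0: "\<And>v. v \<in> verts H \<Longrightarrow> x v = 0" using finV by (simp add: T_def sum_nonneg_eq_0_iff)
    have "poly_form r H x = poly_form r H (\<lambda>v. 0 * x v)"
      by (rule poly_form_cong[OF H]) (simp add: x0)
    also have "... = 0" using poly_form_scale[OF H, of 0 x] r by simp
    finally show ?thesis using True by (simp add: T_def)
  next
    case False
    define t where "t = T powr (- 1 / p)"
    have t: "t > 0" using False by (simp add: t_def)
    have "t powr p = T powr (- 1)" unfolding t_def powr_powr using p by simp
    then have tp: "t powr p = 1 / T" using False T0 by (simp add: powr_minus_divide)
    have "(\<Sum>v\<in>verts H. \<bar>t * x v\<bar> powr p) = t powr p * T"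
      unfolding T_def sum_distrib_left using t x by (intro sum.cong) (auto simp: powr_mult)
    also have "... = 1" using tp False by simp
    finally have "lp_norm p (verts H) (\<lambda>v. t * x v) = 1"
      by (simp only: lp_norm_eq_1_iff[OF p])
    then have "poly_form r H (\<lambda>v. t * x v) \<le> spectral_radius r p H" by (rule spectral_radius_is_max(2)[OF H ne p])
    then have "t ^ r * poly_form r H x \<le> spectral_radius r p H" by (simp add: poly_form_scale[OF H])
    moreover have "t ^ r * T powr (real r / p) = 1"
      using t False by (simp add: t_def powr_powr flip: powr_realpow powr_add)
    then have "poly_form r H x = (t ^ r * poly_form r H x) * T powr (real r / p)" by (simp add: mult.commute mult.left_commute)
    ultimately show ?thesis unfolding T_def[symmetric] by (metis mult_right_mono powr_ge_zero)
  qed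
qed

section \<open>Invariance under isomorphism\<close>

lemma isomorphic_sym:
  assumes "isomorphic G H" "r_graph r G"
  shows "isomorphic H G"
proof -
  obtain f where f: "bij_betw f (verts G) (verts H)" "(`) f ` edges G = edges H"
    using assms(1) by (auto simp: isomorphic_def)
  let ?g = "inv_into (verts G) f"
  have "bij_betw ?g (verts H) (verts G)" using f(1) by (rule bij_betw_inv_into)
  moreover have "?g ` f ` e = e" if "e \<in> edges G" for e
    using assms(2) that f(1) by (intro inv_into_image_cancel) (auto simp: r_graph_def bij_betw_def)
  then have "(`) ?g ` (`) f ` edges G = edges G" by (simp add: image_image)
  then have "(`) ?g ` edges H = edges G" using f(2) by simp
  ultimately show ?thesis unfolding isomorphic_def by blast
qed

lemma spectral_radius_isomorphic_le:
  assumes iso: "isomorphic G H" and G: "r_graph r G" and H: "r_graph r H" and ne: "verts G \<noteq> {}" and p: "p \<ge> 1"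
  shows "spectral_radius r p H \<le> spectral_radius r p G"
proof -
  obtain f where f: "bij_betw f (verts G) (verts H)" "(`) f ` edges G = edges H"
    using iso by (auto simp: isomorphic_def)
  have inj: "inj_on f (verts G)" using f(1) by (simp add: bij_betw_def)
  have EG: "e \<subseteq> verts G" if "e \<in> edges G" for e using G that by (auto simp: r_graph_def)
  have neH: "verts H \<noteq> {}" using f(1) ne by (auto simp: bij_betw_def)
  obtain x where x: "lp_norm p (verts H) x = 1" "poly_form r H x = spectral_radius r p H"
    using spectral_radius_is_max(1)[OF H neH p] by blast
  have "lp_norm p (verts G) (x \<circ> f) = 1"
    using x(1) sum.reindex_bij_betw[OF f(1), of "\<lambda>v. \<bar>x v\<bar> powr p"] by (simp add: lp_norm_def)
  then have "poly_form r G (x \<circ> f) \<le> spectral_radius r p G" by (rule spectral_radius_is_max(2)[OF G ne p])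
  moreover have "poly_form r G (x \<circ> f) = poly_form r H x"
  proof -
    have "inj_on ((`) f) (edges G)"
      using inj EG by (intro inj_onI) (simp add: inj_on_image_eq_iff)
    then have "(\<Sum>e\<in>edges H. \<Prod>v\<in>e. x v) = (\<Sum>e\<in>edges G. \<Prod>v\<in>f ` e. x v)"
      unfolding f(2)[symmetric] by (simp add: sum.reindex)
    also have "... = (\<Sum>e\<in>edges G. \<Prod>v\<in>e. x (f v))"
      by (intro sum.cong refl) (simp add: prod.reindex inj_on_subset[OF inj EG])
    finally show ?thesis by (simp add: poly_form_def)
  qed
  ultimately show ?thesis using x(2) by simp
qed

lemma spectral_radius_isomorphic:
  assumes "isomorphic G H" "r_graph r G" "r_graph r H" "verts G \<noteq> {}" "p \<ge> 1"
  shows "spectral_radius r p G = spectral_radius r p H"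
proof -
  have "verts H \<noteq> {}" using assms(1,4) by (auto simp: isomorphic_def bij_betw_def)
  then show ?thesis
    using spectral_radius_isomorphic_le[OF assms(1-5)]
      spectral_radius_isomorphic_le[OF isomorphic_sym[OF assms(1,2)] assms(3,2) _ assms(5)] by simp
qed

text \<open>Up to the factor \<open>r\<close> this is the partial derivative of
  \<open>poly_form\<close> in the coordinate \<open>v\<close>. It does not involve
  \<open>x v\<close>, as the form is affine in each coordinate.\<close>

definition link_form :: "nat \<Rightarrow> 'a hypergraph \<Rightarrow> ('a \<Rightarrow> real) \<Rightarrow> 'a \<Rightarrow> real" where
  "link_form r H x v = fact (r - 1) * (\<Sum>e\<in>{e\<in>edges H. v \<in> e}. \<Prod>u\<in>e - {v}. x u)"

lemma sum_edges_at:
  assumes H: "r_graph r H" and r: "r \<ge> 1"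
  shows "fact r * (\<Sum>e\<in>{e\<in>edges H. v \<in> e}. \<Prod>u\<in>e. x u) = real r * x v * link_form r H x v"
proof -
  have "(\<Prod>u\<in>e. x u) = x v * (\<Prod>u\<in>e - {v}. x u)" if "e \<in> edges H" "v \<in> e" for e
  proof -
    have "finite e" using H that finite_subset by (auto simp: r_graph_def)
    then show ?thesis using that by (simp add: prod.remove)
  qed
  then have "(\<Sum>e\<in>{e\<in>edges H. v \<in> e}. \<Prod>u\<in>e. x u) = x v * (\<Sum>e\<in>{e\<in>edges H. v \<in> e}. \<Prod>u\<in>e - {v}. x u)"
    unfolding sum_distrib_left by (intro sum.cong) auto
  moreover have "fact r = real r * fact (r - 1)" using r fact_reduce[of r] by simp
  ultimately show ?thesis unfolding link_form_def by simp
qed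

lemma poly_form_split:
  assumes H: "r_graph r H" and r: "r \<ge> 1"
  shows "poly_form r H x = fact r * (\<Sum>e\<in>{e\<in>edges H. v \<notin> e}. \<Prod>u\<in>e. x u) + real r * x v * link_form r H x v"
proof -
  have "(\<Sum>e\<in>edges H. \<Prod>u\<in>e. x u) =
      (\<Sum>e\<in>{e\<in>edges H. v \<notin> e}. \<Prod>u\<in>e. x u) + (\<Sum>e\<in>{e\<in>edges H. v \<in> e}. \<Prod>u\<in>e. x u)"
    by (subst sum.union_disjoint[symmetric]) (use finite_edges[OF H] in \<open>auto intro!: sum.cong\<close>)
  then show ?thesis unfolding poly_form_def sum_edges_at[OF assms, symmetric] by (simp add: distrib_left)
qed

lemma poly_form_update:
  assumes H: "r_graph r H" and r: "r \<ge> 1"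
  shows "poly_form r H (x(v := t)) = poly_form r H x + real r * (t - x v) * link_form r H x v"
proof -
  have "(\<Sum>e\<in>{e\<in>edges H. v \<notin> e}. \<Prod>u\<in>e. (x(v := t)) u) = (\<Sum>e\<in>{e\<in>edges H. v \<notin> e}. \<Prod>u\<in>e. x u)"
    by (intro sum.cong prod.cong refl) auto
  moreover have "link_form r H (x(v := t)) v = link_form r H x v"
    unfolding link_form_def by (intro arg_cong2[of _ _ _ _ "(*)"] sum.cong prod.cong refl) auto
  ultimately show ?thesis
    using poly_form_split[OF assms, of "x(v := t)" v] poly_form_split[OF assms, of x v]
    by (simp add: algebra_simps)
qed

text \<open>A single coordinate is varied, so no Lagrange multipliers are needed. As
  \<open>r / p \<le> 1\<close>, Bernoulli linearizes the norm factor; the resulting \<open>h\<close>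
  is nonpositive and vanishes at \<open>z v\<close>, so its derivative there is zero. Positivity of
  \<open>z v\<close> makes it an interior point. The power sum is \<open>n\<close> because the lemma
  is applied to a rescaled maximizer.\<close>

lemma eigenvector_equation:
  assumes H: "r_graph r H" and r: "r \<ge> 1" and p: "p \<ge> real r" "p > 1"
    and z: "\<And>v. z v \<ge> 0" and n: "(\<Sum>v\<in>verts H. z v powr p) = n" "n > 0"
    and max: "\<And>y. (\<And>v. y v \<ge> 0) \<Longrightarrow>
      poly_form r H y \<le> poly_form r H z * ((\<Sum>v\<in>verts H. y v powr p) / n) powr (real r / p)"
    and v: "v \<in> verts H" "z v > 0" and nonneg: "poly_form r H z \<ge> 0"
  shows "link_form r H z v = poly_form r H z / n * z v powr (p - 1)"
proof -
  define \<Lambda> where "\<Lambda> = poly_form r H z"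
  define D where "D = link_form r H z v"
  define h where "h t = real r * (t - z v) * D - \<Lambda> * (real r / p) * ((t powr p - z v powr p) / n)" for t
  have finV: "finite (verts H)" using H by (simp add: r_graph_def)
  have le: "h t \<le> 0" if t: "t \<ge> 0" for t
  proof -
    define s where "s = (t powr p - z v powr p) / n"
    have "(\<Sum>u\<in>verts H. (z(v := t)) u powr p) = t powr p + (\<Sum>u\<in>verts H - {v}. z u powr p)"
      using finV v by (simp add: sum.remove)
    also have "... = n + (t powr p - z v powr p)"
      using n(1) finV v by (simp add: sum.remove)
    finally have S: "(\<Sum>u\<in>verts H. (z(v := t)) u powr p) = n + (t powr p - z v powr p)" .
    then have s1: "(\<Sum>u\<in>verts H. (z(v := t)) u powr p) / n = 1 + s" using n(2) by (simp add: s_def field_simps)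
    have "z v powr p \<le> n" unfolding n(1)[symmetric] using finV v by (intro member_le_sum) auto
    then have "s \<ge> -1" using n(2) by (simp add: s_def field_simps add_increasing2)
    have "\<Lambda> + real r * (t - z v) * D = poly_form r H (z(v := t))"
      by (simp add: \<Lambda>_def D_def poly_form_update[OF H r])
    also have "... \<le> \<Lambda> * (1 + s) powr (real r / p)"
      using max[of "z(v := t)"] z t unfolding s1 \<Lambda>_def by simp
    also have "... \<le> \<Lambda> * (1 + real r / p * s)"
      using p nonneg \<open>s \<ge> -1\<close> by (intro mult_left_mono bernoulli_powr_le) (auto simp: \<Lambda>_def)
    finally show ?thesis by (simp add: h_def s_def algebra_simps)
  qed
  have "(h has_real_derivative (real r * D - \<Lambda> * (real r / p) * (p * z v powr (p - 1) / n))) (at (z v))"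
    unfolding h_def using v(2) n(2) by (auto intro!: derivative_eq_intros simp: field_simps)
  moreover have "\<forall>t. \<bar>z v - t\<bar> < z v \<longrightarrow> h t \<le> h (z v)"
    using le by (auto simp: h_def[of "z v"])
  ultimately have "real r * D - \<Lambda> * (real r / p) * (p * z v powr (p - 1) / n) = 0"
    using v(2) DERIV_local_max by blast
  then show ?thesis using r p n(2) by (simp add: D_def \<Lambda>_def field_simps)
qed

lemma link_sum_le_clique_weight:
  assumes "finite Y" and z: "\<And>u. u \<in> Y \<Longrightarrow> z u \<ge> 0"
    and S: "\<And>e. e \<in> S \<Longrightarrow> v \<in> e \<and> e - {v} \<in> cliques G Y s"
  shows "(\<Sum>e\<in>S. \<Prod>u\<in>e - {v}. z u) \<le> clique_weight G Y z s"
proof -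
  have inj: "inj_on (\<lambda>e. e - {v}) S" using S by (intro inj_onI) (metis insert_Diff)
  have "(\<Sum>e\<in>S. \<Prod>u\<in>e - {v}. z u) = (\<Sum>B\<in>(\<lambda>e. e - {v}) ` S. \<Prod>u\<in>B. z u)"
    using inj by (simp add: sum.reindex)
  also have "... \<le> clique_weight G Y z s"
    unfolding clique_weight_def
    by (rule sum_mono2) (use S assms finite_cliques clique_prod_nonneg[OF z] in auto)
  finally show ?thesis .
qed


section \<open>Complete multipartite \<open>r\<close>-graphs\<close>

lemma edges_complete_partite:
  assumes "finite V"
  shows "edges (complete_partite r V c) = cliques (\<lambda>u v. c u \<noteq> c v) V r"
proof -
  have "(\<forall>i. card {v\<in>e. c v = i} \<le> 1) \<longleftrightarrow> pairwise (\<lambda>u v. c u \<noteq> c v) e" if "e \<subseteq> V" for e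
  proof -
    have "finite e" using that assms finite_subset by blast
    then have "card {v\<in>e. c v = i} \<le> 1 \<longleftrightarrow> (\<forall>u\<in>e. \<forall>v\<in>e. c u = i \<longrightarrow> c v = i \<longrightarrow> u = v)" for i
      using card_le_Suc0_iff_eq[of "{v\<in>e. c v = i}"] by auto
    then show ?thesis by (auto simp: pairwise_def)
  qed
  then show ?thesis unfolding complete_partite_def cliques_def by auto
qed

lemma verts_complete_partite [simp]: "verts (complete_partite r V c) = V"
  by (simp add: complete_partite_def)

lemma poly_form_complete_partite:
  assumes "finite V"
  shows "poly_form r (complete_partite r V c) x = fact r * clique_weight (\<lambda>u v. c u \<noteq> c v) V x r"
  unfolding poly_form_def edges_complete_partite[OF assms] clique_weight_def ..

lemma complete_partite_cong:
  assumes "\<And>v. v \<in> V \<Longrightarrow> c v = c' v"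
  shows "complete_partite r V c = complete_partite r V c'"
proof -
  have "{v\<in>e. c v = i} = {v\<in>e. c' v = i}" if "e \<subseteq> V" for e i using that assms by auto
  then show ?thesis unfolding complete_partite_def by auto
qed

lemma clique_weight_cong:
  assumes "\<And>u v. u \<in> Y \<Longrightarrow> v \<in> Y \<Longrightarrow> G u v = G' u v" "\<And>v. v \<in> Y \<Longrightarrow> w v = w' v"
  shows "clique_weight G Y w s = clique_weight G' Y w' s"
proof -
  have "cliques G Y s = cliques G' Y s"
    unfolding cliques_def pairwise_def using assms(1) by (auto simp: subset_iff)
  then show ?thesis unfolding clique_weight_def using assms(2)
    by (intro sum.cong prod.cong) (auto simp: cliques_def)
qed

text \<open>A clique has at most one vertex in a colour class. Hence the clique weight is affine in
  the total weight of the class and does not depend on how this total is distributed.\<close>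

lemma clique_weight_split_part:
  fixes c :: "'a \<Rightarrow> 'i" and i j :: 'i
  assumes V: "finite V"
  defines "G \<equiv> \<lambda>u v. c u \<noteq> c v"
  defines "A \<equiv> {v\<in>V. c v = i}"
  shows "clique_weight G V x (Suc s) = clique_weight G (V - A) x (Suc s) + sum x A * clique_weight G (V - A) x s"
proof -
  let ?C = "\<lambda>t. cliques G (V - A) t"
  let ?J = "(\<lambda>(a, B). insert a B) ` (A \<times> ?C s)"
  have finA: "finite A" using V by (simp add: A_def)
  have finC: "finite (?C t)" for t using V by (intro finite_cliques) auto
  have BA: "a \<notin> B" "finite B" if "a \<in> A" "B \<in> ?C t" for a B t
    using that finite_clique[of "V - A" B G t] V by (auto simp: cliques_def)
  have inj: "inj_on (\<lambda>(a, B). insert a B) (A \<times> ?C s)"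
  proof (rule inj_onI, clarsimp)
    fix a B a' B' assume h: "a \<in> A" "B \<in> ?C s" "a' \<in> A" "B' \<in> ?C s" "insert a B = insert a' B'"
    have sub: "B \<subseteq> V - A" "B' \<subseteq> V - A" using h by (auto simp: cliques_def)
    have "a = a'" using h sub by blast
    moreover have "a \<notin> B" "a' \<notin> B'" using h sub by auto
    then have "B = B'" using h(5) \<open>a = a'\<close> by (metis insert_ident)
    ultimately show "a = a' \<and> B = B'" by simp
  qed
  have split: "cliques G V (Suc s) = ?C (Suc s) \<union> ?J"
  proof (intro equalityI subsetI)
    fix B assume B: "B \<in> cliques G V (Suc s)"
    show "B \<in> ?C (Suc s) \<union> ?J"
    proof (cases "B \<inter> A = {}")
      case True
      then show ?thesis using B by (auto simp: cliques_def)
    next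
      case False
      then obtain a where a: "a \<in> B" "a \<in> A" by blast
      have fB: "finite B" using V B by (rule finite_clique)
      have "B - {a} \<in> ?C s"
        using a B fB by (auto simp: cliques_def pairwise_def A_def G_def)
      moreover have "B = insert a (B - {a})" using a by auto
      ultimately show ?thesis using a by (intro UnI2 image_eqI[where x = "(a, B - {a})"]) auto
    qed
  next
    fix B assume "B \<in> ?C (Suc s) \<union> ?J"
    then show "B \<in> cliques G V (Suc s)"
    proof
      assume "B \<in> ?C (Suc s)" then show ?thesis by (auto simp: cliques_def)
    next
      assume "B \<in> ?J"
      then obtain a B' where h: "a \<in> A" "B' \<in> ?C s" "B = insert a B'" by auto
      have "card B = Suc s" using BA[OF h(1,2)] h by (auto simp: cliques_def)
      moreover have "B \<subseteq> V" "pairwise G B"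
        using h by (auto simp: cliques_def A_def G_def pairwise_insert)
      ultimately show ?thesis by (simp add: cliques_def)
    qed
  qed
  have "?C (Suc s) \<inter> ?J = {}" by (auto simp: cliques_def)
  then have "clique_weight G V x (Suc s) = clique_weight G (V - A) x (Suc s) + (\<Sum>B\<in>?J. \<Prod>v\<in>B. x v)"
    unfolding clique_weight_def split using finC finA by (intro sum.union_disjoint) auto
  also have "(\<Sum>B\<in>?J. \<Prod>v\<in>B. x v) = (\<Sum>(a, B)\<in>A \<times> ?C s. x a * (\<Prod>v\<in>B. x v))"
    unfolding sum.reindex[OF inj] by (rule sum.cong) (use BA in auto)
  also have "... = sum x A * clique_weight G (V - A) x s"
    unfolding clique_weight_def by (simp add: sum_product sum.cartesian_product)
  finally show ?thesis .
qed

lemma clique_weight_split_two_parts: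
  fixes c :: "'a \<Rightarrow> 'i" and i j :: 'i
  assumes V: "finite V" and ij: "i \<noteq> j" and s: "s \<ge> 2"
  defines "G \<equiv> \<lambda>u v. c u \<noteq> c v"
  defines "A \<equiv> {v\<in>V. c v = i}" and "B \<equiv> {v\<in>V. c v = j}"
  defines "R \<equiv> V - (A \<union> B)"
  shows "clique_weight G V x s = clique_weight G R x s + (sum x A + sum x B) * clique_weight G R x (s - 1) +
    sum x A * sum x B * clique_weight G R x (s - 2)"
proof -
  define t where "t = s - 2"
  have t: "s = Suc (Suc t)" using s by (simp add: t_def)
  have B: "{v \<in> V - A. c v = j} = B" using ij by (auto simp: A_def B_def)
  have "V - A - B = R" by (auto simp: R_def)
  then have "clique_weight G (V - A) x (Suc u) = clique_weight G R x (Suc u) + sum x B * clique_weight G R x u" for u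
    using clique_weight_split_part[of "V - A" c x u j] V unfolding G_def B by simp
  moreover have "clique_weight G V x (Suc (Suc t)) =
      clique_weight G (V - A) x (Suc (Suc t)) + sum x A * clique_weight G (V - A) x (Suc t)"
    using clique_weight_split_part[OF V, of c x "Suc t" i] unfolding G_def A_def .
  ultimately show ?thesis by (simp add: t algebra_simps)
qed

section \<open>Balanced partitions determine the hypergraph up to isomorphism\<close>

lemma isomorphic_complete_partite:
  assumes f: "bij_betw f V V'" and V: "finite V"
    and c: "\<And>u v. u \<in> V \<Longrightarrow> v \<in> V \<Longrightarrow> c u = c v \<longleftrightarrow> c' (f u) = c' (f v)"
  shows "isomorphic (complete_partite r V c) (complete_partite r V' c')"
proof -
  have inj: "inj_on f V" and im: "f ` V = V'" using f by (auto simp: bij_betw_def)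
  have V': "finite V'" using im V by auto
  have "(`) f ` cliques (\<lambda>u v. c u \<noteq> c v) V r = cliques (\<lambda>u v. c' u \<noteq> c' v) V' r"
  proof (intro equalityI subsetI)
    fix e' assume "e' \<in> (`) f ` cliques (\<lambda>u v. c u \<noteq> c v) V r"
    then obtain e where e: "e' = f ` e" "e \<subseteq> V" "card e = r" "pairwise (\<lambda>u v. c u \<noteq> c v) e"
      by (auto simp: cliques_def)
    have "card e' = r" using e inj by (simp add: card_image inj_on_subset)
    moreover have "pairwise (\<lambda>u v. c' u \<noteq> c' v) e'"
      unfolding e(1) using e(2,4) c by (fastforce simp: pairwise_def)
    ultimately show "e' \<in> cliques (\<lambda>u v. c' u \<noteq> c' v) V' r" using e im by (auto simp: cliques_def)
  next
    fix e' assume "e' \<in> cliques (\<lambda>u v. c' u \<noteq> c' v) V' r"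
    then have e': "e' \<subseteq> V'" "card e' = r" "pairwise (\<lambda>u v. c' u \<noteq> c' v) e'" by (auto simp: cliques_def)
    obtain e where e: "e \<subseteq> V" "e' = f ` e" using e'(1) im by (metis subset_image_iff)
    have "card e = r" using e e'(2) inj by (simp add: card_image inj_on_subset)
    moreover have "pairwise (\<lambda>u v. c u \<noteq> c v) e"
    proof (rule pairwiseI)
      fix u v assume uv: "u \<in> e" "v \<in> e" "u \<noteq> v"
      then have "f u \<noteq> f v" using e(1) inj by (auto simp: inj_on_def)
      then have "c' (f u) \<noteq> c' (f v)" using e'(3) uv e(2) by (auto simp: pairwise_def)
      then show "c u \<noteq> c v" using c uv e(1) by auto
    qed
    ultimately have "e \<in> cliques (\<lambda>u v. c u \<noteq> c v) V r" using e by (auto simp: cliques_def)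
    then show "e' \<in> (`) f ` cliques (\<lambda>u v. c u \<noteq> c v) V r" using e(2) by auto
  qed
  then show ?thesis unfolding isomorphic_def
    using f by (intro exI[of _ f]) (simp add: edges_complete_partite V V')
qed

definition balanced :: "nat \<Rightarrow> 'a set \<Rightarrow> ('a \<Rightarrow> nat) \<Rightarrow> bool" where
  "balanced k V c \<longleftrightarrow> c ` V \<subseteq> {..<k} \<and>
     (\<forall>i<k. \<forall>j<k. card {v\<in>V. c v = i} \<le> card {v\<in>V. c v = j} + 1)"

lemma sum_card_parts:
  fixes c :: "'a \<Rightarrow> nat"
  assumes "finite V" "c ` V \<subseteq> {..<k}"
  shows "(\<Sum>i<k. card {v\<in>V. c v = i}) = card V"
proof -
  have "card (\<Union>i<k. {v\<in>V. c v = i}) = (\<Sum>i<k. card {v\<in>V. c v = i})"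
    using assms(1) by (intro card_UN_disjoint) auto
  moreover have "(\<Union>i<k. {v\<in>V. c v = i}) = V" using assms(2) by auto
  ultimately show ?thesis by simp
qed

text \<open>With smallest size \<open>m\<close> and \<open>q\<close> parts of size
  \<open>m + 1\<close> one gets \<open>card V = k * m + q\<close>, and \<open>q < k\<close>
  identifies this as division with remainder.\<close>

lemma balanced_part_sizes:
  assumes V: "finite V" and k: "k > 0" and bal: "balanced k V c"
  defines "s \<equiv> \<lambda>i. card {v\<in>V. c v = i}"
  shows "\<And>i. i < k \<Longrightarrow> s i = card V div k \<or> s i = Suc (card V div k)"
    and "card {i\<in>{..<k}. s i = Suc (card V div k)} = card V mod k"
proof -
  define m where "m = Min (s ` {..<k})"
  define q where "q = card {i\<in>{..<k}. s i = Suc m}"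
  have im: "finite (s ` {..<k})" "s ` {..<k} \<noteq> {}" using k by auto
  obtain i0 where i0: "i0 < k" "s i0 = m" using Min_in[OF im] by (auto simp: m_def)
  have sm: "s i = m \<or> s i = Suc m" if "i < k" for i
  proof -
    have "m \<le> s i" using that by (simp add: m_def)
    moreover have "s i \<le> s i0 + 1" using bal that i0(1) unfolding balanced_def s_def by blast
    ultimately show ?thesis using i0 by auto
  qed
  have "card V = (\<Sum>i<k. s i)" using sum_card_parts[OF V] bal by (simp add: balanced_def s_def)
  also have "... = (\<Sum>i<k. m + (if s i = Suc m then 1 else 0))"
    by (rule sum.cong) (use sm in auto)
  also have "... = k * m + (\<Sum>i<k. if s i = Suc m then 1 else 0)" by (simp only: sum.distrib) simp
  also have "(\<Sum>i<k. if s i = Suc m then 1 else 0) = q"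
    by (simp only: q_def card_eq_sum sum.inter_filter[OF finite_lessThan])
  finally have cV: "card V = k * m + q" .
  \<comment> \<open>The minimum is attained, so at least one part is not of the larger size; this
    makes \<open>q\<close> a proper remainder.\<close>
  have "s i0 \<noteq> Suc m" using i0(2) by (simp only: n_not_Suc_n not_False_eq_True)
  then have "{i\<in>{..<k}. s i = Suc m} \<subset> {..<k}" using i0(1) by blast
  then have "q < card {..<k}" unfolding q_def by (rule psubset_card_mono[OF finite_lessThan])
  then have qk: "q < k" by simp
  have m: "m = card V div k" "q = card V mod k" using cV qk by auto
  show "s i = card V div k \<or> s i = Suc (card V div k)" if "i < k" for i using sm[OF that] m by simp
  show "card {i\<in>{..<k}. s i = Suc (card V div k)} = card V mod k"
    using q_def unfolding m(2)[symmetric] m(1)[symmetric] by simp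
qed

text \<open>Both partitions have equally many large parts, so a permutation \<open>\<pi>\<close> of
  the colours matches large parts with large and small with small; bijections between matched parts
  are then glued.\<close>

lemma isomorphic_balanced:
  assumes V: "finite V" "finite V'" "card V = card V'" and k: "k > 0"
    and bal: "balanced k V c" "balanced k V' c'"
  shows "isomorphic (complete_partite r V c) (complete_partite r V' c')"
proof -
  define s where "s i = card {v\<in>V. c v = i}" for i
  define s' where "s' i = card {v\<in>V'. c' v = i}" for i
  define m where "m = card V div k"
  define I where "I = {i\<in>{..<k}. s i = Suc m}"
  define I' where "I' = {i\<in>{..<k}. s' i = Suc m}"
  have sz: "s i = m \<or> s i = Suc m" if "i < k" for i
    using balanced_part_sizes(1)[OF V(1) k bal(1) that] by (simp add: s_def m_def)
  have sz': "s' i = m \<or> s' i = Suc m" if "i < k" for i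
    using balanced_part_sizes(1)[OF V(2) k bal(2) that] V(3) by (simp add: s'_def m_def)
  have "card I = card I'"
    using balanced_part_sizes(2)[OF V(1) k bal(1)] balanced_part_sizes(2)[OF V(2) k bal(2)] V(3)
    by (simp add: I_def I'_def s_def s'_def m_def)
  moreover have fin: "finite I" "finite I'" by (auto simp: I_def I'_def)
  ultimately obtain \<pi>1 where \<pi>1: "bij_betw \<pi>1 I I'" using finite_same_card_bij by blast
  have "card ({..<k} - I) = card ({..<k} - I')"
    using \<open>card I = card I'\<close> fin by (simp add: card_Diff_subset I_def I'_def subset_iff)
  then obtain \<pi>2 where \<pi>2: "bij_betw \<pi>2 ({..<k} - I) ({..<k} - I')"
    using finite_same_card_bij[of "{..<k} - I" "{..<k} - I'"] by auto
  define \<pi> where "\<pi> i = (if i \<in> I then \<pi>1 i else \<pi>2 i)" for i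
  have b1: "bij_betw \<pi> I I'" using \<pi>1 by (rule bij_betw_cong[THEN iffD1, rotated]) (simp add: \<pi>_def)
  have b2: "bij_betw \<pi> ({..<k} - I) ({..<k} - I')"
    using \<pi>2 by (rule bij_betw_cong[THEN iffD1, rotated]) (simp add: \<pi>_def)
  have "bij_betw \<pi> (I \<union> ({..<k} - I)) (I' \<union> ({..<k} - I'))"
    using b1 b2 by (rule bij_betw_combine) auto
  moreover have "I \<union> ({..<k} - I) = {..<k}" "I' \<union> ({..<k} - I') = {..<k}" by (auto simp: I_def I'_def)
  ultimately have \<pi>: "bij_betw \<pi> {..<k} {..<k}" by simp
  have s\<pi>: "s' (\<pi> i) = s i" if i: "i < k" for i
  proof (cases "i \<in> I")
    case True
    then have "\<pi> i \<in> I'" using b1 by (auto simp: bij_betw_def)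
    then show ?thesis using True by (simp add: I_def I'_def)
  next
    case False
    then have "\<pi> i \<in> {..<k} - I'" using b2 i by (auto simp: bij_betw_def)
    then show ?thesis using False i sz[OF i] sz'[of "\<pi> i"] by (auto simp: I_def I'_def)
  qed
  have "\<exists>\<phi>. bij_betw \<phi> {v\<in>V. c v = i} {v\<in>V'. c' v = \<pi> i}" if "i < k" for i
    using s\<pi>[OF that] V by (intro finite_same_card_bij) (auto simp: s_def s'_def)
  then obtain \<phi> where \<phi>: "\<And>i. i < k \<Longrightarrow> bij_betw (\<phi> i) {v\<in>V. c v = i} {v\<in>V'. c' v = \<pi> i}" by metis
  define f where "f v = \<phi> (c v) v" for v
  have ck: "c v < k" if "v \<in> V" for v using bal(1) that by (auto simp: balanced_def)
  have fv: "f v \<in> V'" "c' (f v) = \<pi> (c v)" if "v \<in> V" for v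
    using \<phi>[OF ck[OF that]] that by (auto simp: f_def bij_betw_def)
  have \<pi>_inj: "\<pi> i = \<pi> j \<longleftrightarrow> i = j" if "i < k" "j < k" for i j
    using \<pi> that by (auto simp: bij_betw_def inj_on_def)
  have "inj_on f V"
  proof (rule inj_onI)
    fix u v assume uv: "u \<in> V" "v \<in> V" "f u = f v"
    then have "c u = c v" using fv \<pi>_inj ck by metis
    then show "u = v" using uv \<phi>[OF ck[OF uv(1)]] by (auto simp: f_def bij_betw_def inj_on_def)
  qed
  moreover have "f ` V = V'"
  proof -
    have "f ` V \<subseteq> V'" using fv by auto
    moreover have "card (f ` V) = card V'" using \<open>inj_on f V\<close> V(3) by (simp add: card_image)
    ultimately show ?thesis using V(2) by (simp add: card_subset_eq)
  qed
  ultimately have "bij_betw f V V'" by (simp add: bij_betw_def)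
  then show ?thesis
    by (rule isomorphic_complete_partite[OF _ V(1)]) (use fv \<pi>_inj ck in metis)
qed


text \<open>Both parts are equalised at once because the estimate \<open>n\<^sub>1 n\<^sub>2 + d\<^sup>2 / (4 p)\<close> for the old product,
  with \<open>d = n\<^sub>1 - n\<^sub>2\<close>, is too weak to be beaten by moving a single vertex when \<open>d\<close> is large.\<close>

lemma rebalanced_product:
  fixes n1 n2 :: nat and p X1 X2 Y1 Y2 :: real
  assumes n: "n2 + 2 \<le> n1" and p: "p \<ge> 2" and X: "X1 \<ge> 0" "X2 \<ge> 0" and Y: "Y1 \<ge> 0" "Y2 \<ge> 0" "Y1 + Y2 > 0"
    and X1: "X1 \<le> real n1 * (Y1 / real n1) powr (1 / p)"
    and X2: "X2 \<le> real n2 * (Y2 / real n2) powr (1 / p)"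
  defines "N \<equiv> n1 + n2"
  shows "X1 * X2 < real (N div 2) * real (N - N div 2) * (((Y1 + Y2) / real N) powr (1 / p))\<^sup>2"
proof -
  define t where "t = ((Y1 + Y2) / real N) powr (1 / p)"
  define s where "s = N div 2"
  have N: "N \<ge> 2" using n by (simp add: N_def)
  have t: "t > 0" using Y N by (simp add: t_def)
  have "N = 2 * s \<or> N = 2 * s + 1" by (auto simp: s_def)
  \<comment> \<open>The term \<open>- 1\<close> is the loss for odd \<open>N\<close>, whose two
    halves multiply to \<open>(N^2 - 1) / 4\<close>.\<close>
  then have sN: "4 * (real s * real (N - s)) \<ge> (real N)\<^sup>2 - 1"
    by (auto simp: power2_eq_square algebra_simps)
  show ?thesis
  proof (cases "n2 = 0")
    case True
    then have "X2 = 0" using X2 X by simp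
    moreover have "real s * real (N - s) > 0" using N by (auto simp: s_def)
    ultimately show ?thesis using t by (simp add: s_def t_def)
  next
    case False
    define a where "a = real n1 * real n2"
    define d where "d = real n1 - real n2"
    have a: "a > 0" using False n by (simp add: a_def)
    have d: "d \<ge> 2" using n by (simp add: d_def)
    \<comment> \<open>The number \<open>1 + u\<close> is the factor by which \<open>N^2 / 4\<close>
      exceeds the product of the old sizes.\<close>
    define u where "u = d\<^sup>2 / (4 * a)"
    have u: "u \<ge> 0" using a by (simp add: u_def)
    have N2: "(real N)\<^sup>2 = 4 * a + d\<^sup>2" by (simp add: N_def a_def d_def power2_eq_square algebra_simps)
    then have Nu: "(real N)\<^sup>2 / (4 * a) = 1 + u" using a by (simp add: u_def field_simps)
    have "X1 * X2 \<le> (real n1 * (Y1 / real n1) powr (1 / p)) * (real n2 * (Y2 / real n2) powr (1 / p))"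
      by (rule mult_mono[OF X1 X2]) (use X in auto)
    also have "... = a * ((Y1 * Y2) / a) powr (1 / p)"
      using Y by (simp add: a_def powr_mult powr_divide)
    also have "... \<le> a * (((Y1 + Y2) / real N)\<^sup>2 * (1 + u)) powr (1 / p)"
    proof (intro mult_left_mono powr_mono2)
      have "4 * (Y1 * Y2) \<le> (Y1 + Y2)\<^sup>2"
        using sum_squares_bound[of Y1 Y2] by (simp add: power2_eq_square algebra_simps)
      then have "(Y1 * Y2) / a \<le> (Y1 + Y2)\<^sup>2 / (4 * a)" using a by (simp add: field_simps)
      also have "... = ((Y1 + Y2) / real N)\<^sup>2 * ((real N)\<^sup>2 / (4 * a))" using N by (simp add: power_divide)
      finally show "(Y1 * Y2) / a \<le> ((Y1 + Y2) / real N)\<^sup>2 * (1 + u)" by (simp only: Nu)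
    qed (use p a Y in auto)
    also have "... = a * (t\<^sup>2 * (1 + u) powr (1 / p))"
    proof -
      have "((Y1 + Y2) / real N)\<^sup>2 powr (1 / p) = t\<^sup>2"
        using Y by (simp add: t_def powr_powr powr_mult power2_eq_square powr_divide)
      then show ?thesis using u by (simp add: powr_mult)
    qed
    also have "... \<le> a * (t\<^sup>2 * (1 + 1 / p * u))"
      using p u a by (intro mult_left_mono bernoulli_powr_le) auto
    also have "... = t\<^sup>2 * (a + d\<^sup>2 / (4 * p))" using a by (simp add: u_def field_simps)
    also have "... < t\<^sup>2 * (real s * real (N - s))"
    proof (rule mult_strict_left_mono)
      \<comment> \<open>A difference of at least 2 makes the surplus \<open>d^2 / 2\<close> larger
        than the parity loss 1; a difference of 1 would not suffice.\<close>
      have "d\<^sup>2 \<ge> 2\<^sup>2" using d by (intro power_mono) auto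
      have "d\<^sup>2 / (4 * p) \<le> d\<^sup>2 / 8" using p by (intro divide_left_mono) auto
      moreover have "4 * (a + w) \<le> 4 * a + q / 2" if "w \<le> q / 8" for w q using that by simp
      ultimately have "4 * (a + d\<^sup>2 / (4 * p)) \<le> 4 * a + d\<^sup>2 / 2" by blast
      also have "... < 4 * a + d\<^sup>2 - 1" using \<open>d\<^sup>2 \<ge> 2\<^sup>2\<close> by simp
      also have "... \<le> 4 * (real s * real (N - s))" using sN N2 by simp
      finally show "a + d\<^sup>2 / (4 * p) < real s * real (N - s)" by simp
    qed (use t in simp)
    finally show ?thesis by (simp add: s_def t_def mult.commute mult.left_commute)
  qed
qed

text \<open>Raising a zero entry to a small \<open>t\<close> gains a term linear in \<open>t\<close>
  and costs only order \<open>t powr p\<close>, hence at most order \<open>t^2\<close>.\<close>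

lemma maximizer_pos:
  assumes H: "r_graph r H" and r: "r \<ge> 1" and p: "p \<ge> real r" "p \<ge> 2"
    and x: "\<And>v. x v \<ge> 0" "(\<Sum>v\<in>verts H. x v powr p) = 1" "poly_form r H x = spectral_radius r p H"
    and v: "v \<in> verts H" and D: "link_form r H x v > 0"
  shows "x v > 0"
proof (rule ccontr)
  assume "\<not> x v > 0"
  then have xv: "x v = 0" using x(1)[of v] by simp
  define lam where "lam = spectral_radius r p H"
  define D' where "D' = link_form r H x v"
  have finV: "finite (verts H)" using H by (simp add: r_graph_def)
  have lam0: "lam \<ge> 0" unfolding lam_def x(3)[symmetric] poly_form_def
    by (intro mult_nonneg_nonneg sum_nonneg prod_nonneg) (use x(1) in auto)
  have key: "p * D' \<le> lam * t" if t: "0 < t" "t \<le> 1" for t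
  proof -
    have "(\<Sum>u\<in>verts H. (x(v := t)) u powr p) = t powr p + (\<Sum>u\<in>verts H - {v}. x u powr p)"
      using finV v by (simp add: sum.remove)
    also have "... = 1 + t powr p" using x(2) finV v xv p by (simp add: sum.remove)
    finally have S: "(\<Sum>u\<in>verts H. (x(v := t)) u powr p) = 1 + t powr p" .
    have "lam + real r * t * D' = poly_form r H (x(v := t))"
      using poly_form_update[OF H r, of x v t] xv x(3) by (simp add: lam_def D'_def)
    also have "... \<le> lam * (1 + t powr p) powr (real r / p)"
      unfolding lam_def S[symmetric]
      by (rule poly_form_le_spectral_radius[OF H _ _ r]) (use v p x(1) t in auto)
    also have "... \<le> lam * (1 + real r / p * t powr p)"
      using p lam0 by (intro mult_left_mono bernoulli_powr_le) (auto intro: order_trans[of _ 0])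
    finally have "real r * (t * (p * D')) \<le> real r * (lam * t powr p)"
      using p by (simp add: field_simps)
    then have "t * (p * D') \<le> lam * t powr p" using r by simp
    also have "... \<le> lam * t powr 2" using t p lam0 by (intro mult_left_mono powr_mono') auto
    also have "t powr 2 = t * t" using t by (simp add: power2_eq_square)
    finally have "t * (p * D') \<le> t * (lam * t)" by (simp add: mult_ac)
    then show ?thesis using t by simp
  qed
  have "lam > 0" using key[of 1] D p lam0 by (cases "lam = 0") (auto simp: D'_def mult_le_0_iff)
  have pD: "p * D' > 0" using D p by (simp add: D'_def)
  \<comment> \<open>Chosen so that \<open>lam * t\<close> is at most half of \<open>p * D'\<close>,
    which contradicts \<open>key\<close>.\<close>
  define t where "t = min 1 (p * D' / (2 * lam))"
  have t: "0 < t" "t \<le> 1" using pD \<open>lam > 0\<close> by (auto simp: t_def)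
  have "lam * t \<le> lam * (p * D' / (2 * lam))" using \<open>lam > 0\<close> by (intro mult_left_mono) (auto simp: t_def)
  also have "... = p * D' / 2" using \<open>lam > 0\<close> by simp
  finally show False using key[OF t] pD by simp
qed

text \<open>The two parts are recoloured into halves, and \<open>x\<close> is replaced on their
  union by its constant p-mean, which preserves the p-norm. In the expansion by the number of
  vertices in the two parts, the linear term does not decrease by the power mean inequality, and the
  product term increases strictly. Strictness of the whole needs positive weight of
  \<open>(r - 2)\<close>-cliques outside both parts and a nonzero vector on them.\<close>

lemma rebalance_increases:
  fixes c :: "'a \<Rightarrow> nat"
  assumes V: "finite V" and r: "r \<ge> 2" and p: "p \<ge> real r" and ij: "i \<noteq> j"
    and sz: "card {v\<in>V. c v = j} + 2 \<le> card {v\<in>V. c v = i}"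
    and pos: "spectral_radius r p (complete_partite r V c) > 0"
  obtains c' where "c' ` V \<subseteq> c ` V \<union> {i, j}"
    "spectral_radius r p (complete_partite r V c) < spectral_radius r p (complete_partite r V c')"
proof -
  let ?K = "complete_partite r V c"
  define A where "A = {v\<in>V. c v = i}"
  define B where "B = {v\<in>V. c v = j}"
  define R where "R = V - (A \<union> B)"
  define G where "G = (\<lambda>u v. c u \<noteq> c v)"
  have p2: "p \<ge> 2" using p r by linarith
  have finAB: "finite A" "finite B" using V by (auto simp: A_def B_def)
  have AB: "A \<inter> B = {}" "A \<union> B \<subseteq> V" using ij by (auto simp: A_def B_def)
  have nA: "card B + 2 \<le> card A" using sz by (simp add: A_def B_def)
  then obtain v0 where v0: "v0 \<in> A" by fastforce
  then have ne: "V \<noteq> {}" "A \<noteq> {}" using AB by auto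
  have K: "r_graph r ?K" using V by (rule r_graph_complete_partite)
  obtain x where x: "\<And>v. x v \<ge> 0" "(\<Sum>v\<in>V. x v powr p) = 1" "poly_form r ?K x = spectral_radius r p ?K"
    using spectral_radius_nonneg_maximizer[OF K, of p] ne p2 by auto
  have "clique_weight G V x r > 0"
    using pos unfolding x(3)[symmetric] poly_form_complete_partite[OF V] G_def
    by (simp add: zero_less_mult_iff)
  then obtain Q where Q: "Q \<in> cliques G V r" "(\<Prod>v\<in>Q. x v) > 0"
    unfolding clique_weight_def by (meson not_le sum_nonpos)
  have finQ: "finite Q" using V Q(1) by (rule finite_clique)
  have xQ: "x v > 0" if "v \<in> Q" for v
  proof -
    have "x v \<noteq> 0" using Q(2) prod_zero[OF finQ, of x] that by force
    then show ?thesis using x(1)[of v] by simp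
  qed
  have Qsub: "S \<in> cliques G Y (card S)" if "S \<subseteq> Q" "S \<subseteq> Y" for S Y
    using that Q(1) pairwise_subset[of G Q S] by (simp add: cliques_def)
  have finR: "finite R" using V by (simp add: R_def)
  have CWpos: "clique_weight G R x s > 0" if "S \<subseteq> Q" "S \<subseteq> R" "card S = s" for S s
  proof -
    have "0 < (\<Prod>v\<in>S. x v)" by (rule prod_pos) (use that xQ in auto)
    also have "... \<le> clique_weight G R x s"
      unfolding clique_weight_def
      by (rule member_le_sum) (use Qsub[OF that(1,2)] that finR in \<open>auto intro: finite_cliques clique_prod_nonneg[OF x(1)]\<close>)
    finally show ?thesis .
  qed
  \<comment> \<open>An edge of positive weight uses at most one vertex of each of the two parts, so
    at least \<open>r - 2\<close> of its vertices lie outside both.\<close>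
  have Qi: "card (Q \<inter> A) \<le> 1" "card (Q \<inter> B) \<le> 1"
    using Q(1) finQ by (auto simp: cliques_def pairwise_def G_def A_def B_def card_le_Suc0_iff_eq)
  have QR: "card (Q \<inter> R) \<ge> r - 2"
  proof -
    have "Q = (Q \<inter> A) \<union> (Q \<inter> B) \<union> (Q \<inter> R)" using Q(1) by (auto simp: R_def cliques_def)
    then have "card Q \<le> card (Q \<inter> A) + card (Q \<inter> B) + card (Q \<inter> R)"
      by (metis card_Un_le add_right_mono order_trans)
    then show ?thesis using Qi Q(1) by (simp add: cliques_def)
  qed
  then obtain S2 where "S2 \<subseteq> Q \<inter> R" "card S2 = r - 2" by (meson obtain_subset_with_card_n)
  then have C2: "clique_weight G R x (r - 2) > 0" using CWpos[of S2] by auto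
  define Y1 where "Y1 = (\<Sum>v\<in>A. x v powr p)"
  define Y2 where "Y2 = (\<Sum>v\<in>B. x v powr p)"
  have Y0: "Y1 \<ge> 0" "Y2 \<ge> 0" by (simp_all add: Y1_def Y2_def sum_nonneg)
  \<comment> \<open>If \<open>x\<close> vanished on both parts, the positive edge \<open>Q\<close>
    would avoid them. Exchanging one of its vertices for \<open>v0\<close> gives an edge on which
    all other entries are positive, so \<open>v0\<close> has a positive link and \<open>x v0\<close>
    could not be 0 in a maximizer.\<close>
  have Ypos: "Y1 + Y2 > 0"
  proof (rule ccontr)
    assume "\<not> Y1 + Y2 > 0"
    then have "Y1 = 0" "Y2 = 0" using Y0 by auto
    then have x0: "x v = 0" if "v \<in> A \<union> B" for v
      using that finAB by (auto simp: Y1_def Y2_def sum_nonneg_eq_0_iff)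
    have QR: "Q \<subseteq> R" using xQ x0 Q(1) by (fastforce simp: R_def cliques_def)
    obtain b where b: "b \<in> Q" using Q(1) r finQ by (fastforce simp: cliques_def)
    let ?e = "insert v0 (Q - {b})"
    have v0Q: "v0 \<notin> Q" using v0 QR by (auto simp: R_def)
    have "?e \<in> cliques G V r"
    proof -
      have "card ?e = r" using v0Q finQ b Q(1) r by (simp add: cliques_def)
      have "?e \<subseteq> V" using v0 Q(1) by (auto simp: A_def cliques_def)
      have "\<forall>u\<in>Q. c u \<noteq> c v0" using QR v0 by (auto simp: R_def A_def)
      then have "\<forall>u\<in>Q - {b}. G v0 u \<and> G u v0" unfolding G_def by (metis DiffD1)
      moreover have "pairwise G (Q - {b})" using Q(1) pairwise_subset[of G Q] by (auto simp: cliques_def)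
      ultimately have "pairwise G ?e" by (simp add: pairwise_insert)
      then have "card ?e = r \<and> ?e \<subseteq> V \<and> pairwise G ?e" using \<open>card ?e = r\<close> \<open>?e \<subseteq> V\<close> by blast
      then show ?thesis by (simp add: cliques_def)
    qed
    then have "?e \<in> {e\<in>edges ?K. v0 \<in> e}" by (simp add: edges_complete_partite[OF V] G_def)
    then have "(\<Prod>u\<in>?e - {v0}. x u) \<le> (\<Sum>e\<in>{e\<in>edges ?K. v0 \<in> e}. \<Prod>u\<in>e - {v0}. x u)"
      by (rule member_le_sum) (use finite_edges[OF K] x(1) in \<open>auto intro: prod_nonneg\<close>)
    moreover have "(\<Prod>u\<in>?e - {v0}. x u) > 0" by (rule prod_pos) (use xQ in auto)
    ultimately have "link_form r ?K x v0 > 0" by (simp add: link_form_def)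
    then have "x v0 > 0"
      by (intro maximizer_pos[OF K _ p p2 x(1)]) (use r x v0 AB in auto)
    then show False using x0 v0 by simp
  qed
  define N where "N = card A + card B"
  have cAB: "card (A \<union> B) = N" using finAB AB by (simp add: N_def card_Un_disjoint)
  obtain S where S: "S \<subseteq> A \<union> B" "card S = N div 2" "finite S"
    using obtain_subset_with_card_n[of "N div 2" "A \<union> B"] cAB by auto
  define t where "t = ((Y1 + Y2) / real N) powr (1 / p)"
  have t0: "t \<ge> 0" by (simp add: t_def)
  have N2: "N \<ge> 2" using nA by (simp add: N_def)
  define c' where "c' v = (if v \<in> S then i else if v \<in> A \<union> B then j else c v)" for v
  define x' where "x' v = (if v \<in> A \<union> B then t else x v)" for v
  let ?K' = "complete_partite r V c'"
  let ?G' = "\<lambda>u v. c' u \<noteq> c' v"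
  have A': "{v\<in>V. c' v = i} = S"
    using S(1) AB(2) ij by (auto simp: c'_def A_def B_def)
  have B': "{v\<in>V. c' v = j} = A \<union> B - S"
    using S(1) AB(2) ij by (auto simp: c'_def A_def B_def)
  have R': "V - (S \<union> (A \<union> B - S)) = R" using S(1) by (auto simp: R_def)
  have CW: "clique_weight ?G' R x' s = clique_weight G R x s" for s
    by (rule clique_weight_cong) (use S(1) in \<open>auto simp: c'_def x'_def R_def G_def\<close>)
  have K': "r_graph r ?K'" using V by (rule r_graph_complete_partite)
  let ?P = "clique_weight G R x"
  have "clique_weight G V x r = ?P r + (sum x A + sum x B) * ?P (r - 1) + sum x A * sum x B * ?P (r - 2)"
    using clique_weight_split_two_parts[OF V ij r, of c x] unfolding G_def A_def B_def R_def .
  also have "... < ?P r + (real N * t) * ?P (r - 1) +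
      (real (N div 2) * real (N - N div 2) * t\<^sup>2) * ?P (r - 2)"
  proof (rule add_le_less_mono)
    have "sum x A + sum x B = sum x (A \<union> B)" using finAB AB by (simp add: sum.union_disjoint)
    also have "... \<le> real (card (A \<union> B)) * ((\<Sum>v\<in>A \<union> B. x v powr p) / real (card (A \<union> B))) powr (1 / p)"
      by (rule power_mean) (use finAB ne p2 x(1) in auto)
    also have "(\<Sum>v\<in>A \<union> B. x v powr p) = Y1 + Y2"
      using finAB AB by (simp add: sum.union_disjoint Y1_def Y2_def)
    finally have "sum x A + sum x B \<le> real N * t" by (simp add: cAB t_def)
    then show "?P r + (sum x A + sum x B) * ?P (r - 1) \<le> ?P r + (real N * t) * ?P (r - 1)"
      by (intro add_left_mono mult_right_mono clique_weight_nonneg x(1))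
    have "sum x A \<le> real (card A) * (Y1 / real (card A)) powr (1 / p)"
      unfolding Y1_def by (rule power_mean) (use finAB ne p2 x(1) in auto)
    moreover have "sum x B \<le> real (card B) * (Y2 / real (card B)) powr (1 / p)"
    proof (cases "B = {}")
      case False
      then show ?thesis unfolding Y2_def by (intro power_mean) (use finAB p2 x(1) in auto)
    qed simp
    ultimately have "sum x A * sum x B < real (N div 2) * real (N - N div 2) * t\<^sup>2"
      unfolding t_def N_def by (intro rebalanced_product nA p2 Y0 Ypos sum_nonneg x(1))
    then show "sum x A * sum x B * ?P (r - 2) < (real (N div 2) * real (N - N div 2) * t\<^sup>2) * ?P (r - 2)"
      by (rule mult_strict_right_mono[OF _ C2])
  qed
  also have "... = clique_weight ?G' V x' r"
  proof -
    have sS: "sum x' S = real (N div 2) * t"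
      using S by (simp add: x'_def subset_iff cong: sum.cong)
    have "sum x' (A \<union> B - S) = (\<Sum>v\<in>A \<union> B - S. t)" by (rule sum.cong) (auto simp: x'_def)
    then have sS': "sum x' (A \<union> B - S) = real (N - N div 2) * t"
      using S by (simp add: card_Diff_subset cAB)
    have "real (N div 2) + real (N - N div 2) = real N" by (simp flip: of_nat_add)
    then have "real (N div 2) * t + real (N - N div 2) * t = real N * t" by (metis distrib_right)
    then show ?thesis
      using clique_weight_split_two_parts[OF V ij r, of c' x'] unfolding A' B' R' CW sS sS'
      by (simp add: power2_eq_square mult_ac)
  qed
  finally have "poly_form r ?K x < poly_form r ?K' x'"
    by (simp add: poly_form_complete_partite[OF V] G_def)
  also have "... \<le> spectral_radius r p ?K' * (\<Sum>v\<in>verts ?K'. x' v powr p) powr (real r / p)"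
    by (rule poly_form_le_spectral_radius[OF K']) (use ne p2 r x(1) t0 in \<open>auto simp: x'_def\<close>)
  also have "(\<Sum>v\<in>verts ?K'. x' v powr p) = 1"
  proof -
    have VR: "V = (A \<union> B) \<union> R" "(A \<union> B) \<inter> R = {}" using AB by (auto simp: R_def)
    have tp: "t powr p = (Y1 + Y2) / real N" using p2 Ypos by (simp add: t_def powr_powr)
    have "(\<Sum>v\<in>V. x' v powr p) = (\<Sum>v\<in>A \<union> B. x' v powr p) + (\<Sum>v\<in>R. x' v powr p)"
      using VR finAB finR by (metis sum.union_disjoint finite_Un)
    also have "(\<Sum>v\<in>A \<union> B. x' v powr p) = (\<Sum>v\<in>A \<union> B. t powr p)" by (rule sum.cong) (auto simp: x'_def)
    also have "... = Y1 + Y2" using N2 by (simp add: cAB tp)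
    also have "... = (\<Sum>v\<in>A \<union> B. x v powr p)"
      using finAB AB by (simp add: sum.union_disjoint Y1_def Y2_def)
    also have "(\<Sum>v\<in>R. x' v powr p) = (\<Sum>v\<in>R. x v powr p)"
      by (rule sum.cong) (auto simp: x'_def R_def)
    also have "(\<Sum>v\<in>A \<union> B. x v powr p) + (\<Sum>v\<in>R. x v powr p) = (\<Sum>v\<in>V. x v powr p)"
      using VR finAB finR by (metis sum.union_disjoint finite_Un)
    finally show ?thesis using x(2) by simp
  qed
  finally have "spectral_radius r p ?K < spectral_radius r p ?K'" using x(3) by simp
  moreover have "c' ` V \<subseteq> c ` V \<union> {i, j}" by (auto simp: c'_def)
  ultimately show ?thesis using that by blast
qed

text \<open>Averaging over parts whose sizes differ by at most one shows that each has more than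
  \<open>n / k - 1\<close> elements or exactly that many. The all-ones vector then supplies both
  positivity of the spectral radius for \<open>n > k\<close> and the lower bound against which
  \<open>H\<close> is measured.\<close>

lemma turan_poly_form_lower:
  assumes k: "k \<ge> r" "r \<ge> 1" and n: "n \<ge> k"
  shows "fact r * real (k choose r) * (real n / real k - 1) ^ r \<le> poly_form r (turan r n k) (\<lambda>_. 1)"
proof -
  have part: "real n / real k - 1 \<le> (\<Sum>v\<in>{v\<in>{..<n}. v mod k = j}. 1)" if j: "j < k" for j
  proof -
    have "(\<Sum>i<k. card {v\<in>{..<n}. v mod k = i}) = n"
      using sum_card_parts[of "{..<n}" "\<lambda>v. v mod k" k] k by (simp add: image_subset_iff)
    then have "n \<le> (\<Sum>i<k. card {v\<in>{..<n}. v mod k = j} + 1)"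
      by (metis (no_types, lifting) turan_parts_balanced j lessThan_iff sum_mono)
    then have "n \<le> k * (card {v\<in>{..<n}. v mod k = j} + 1)" by simp
    then have "real n \<le> real (k * (card {v\<in>{..<n}. v mod k = j} + 1))" by (rule of_nat_mono)
    then have "real n \<le> real k * (real (card {v\<in>{..<n}. v mod k = j}) + 1)"
      by (simp only: of_nat_mult of_nat_add of_nat_1)
    then show ?thesis using k by (simp add: field_simps)
  qed
  have "real (card {..<k} choose r) * (real n / real k - 1) ^ r \<le>
      clique_weight (\<lambda>u v. u mod k \<noteq> v mod k) {..<n} (\<lambda>_. 1) r"
    by (rule multipartite_weight_lower[where J = "{..<k}"]) (use k n part in \<open>auto simp: field_simps\<close>)
  then show ?thesis
    unfolding turan_def by (simp add: poly_form_complete_partite)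
qed

lemma r_graph_turan: "r_graph r (turan r n k)"
  unfolding turan_def by (rule r_graph_complete_partite) simp

lemma verts_turan [simp]: "verts (turan r n k) = {..<n}"
  by (simp add: turan_def)

lemma balanced_turan: "k > 0 \<Longrightarrow> balanced k {..<n} (\<lambda>v. v mod k)"
  unfolding balanced_def using turan_parts_balanced by auto

text \<open>Restricted to \<open>V\<close> there are finitely many colourings, so the set
  \<open>F\<close> of spectral radii has a maximum. Any colouring attaining it is balanced, since
  otherwise rebalancing would improve it; positivity comes from the Turan graph, which occurs in
  \<open>F\<close> through a pulled back colouring.\<close>

lemma complete_partite_le_turan:
  fixes c :: "'a \<Rightarrow> nat"
  assumes V: "finite V" "card V = n" and r: "r \<ge> 2" "k \<ge> r" and p: "p \<ge> real r" and n: "n > k"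
    and c: "c ` V \<subseteq> {..<k}"
  shows "spectral_radius r p (complete_partite r V c) \<le> spectral_radius r p (turan r n k)"
    and "spectral_radius r p (complete_partite r V c) = spectral_radius r p (turan r n k) \<Longrightarrow>
         isomorphic (complete_partite r V c) (turan r n k)"
proof -
  define sr where "sr d = spectral_radius r p (complete_partite r V d)" for d :: "'a \<Rightarrow> nat"
  let ?T = "turan r n k"
  have p1: "p \<ge> 1" using p r by linarith
  have k0: "k > 0" using r by simp
  have Vne: "V \<noteq> {}" using V n by auto
  have "0 < fact r * real (k choose r) * (real n / real k - 1) ^ r"
    using n r by (auto intro!: mult_pos_pos zero_less_power simp: zero_less_binomial)
  also have "... \<le> poly_form r ?T (\<lambda>_. 1)" using turan_poly_form_lower[of r k n] r n by simp
  also have "... \<le> spectral_radius r p ?T * (\<Sum>v\<in>verts ?T. 1 powr p) powr (real r / p)"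
    using n p1 r by (intro poly_form_le_spectral_radius r_graph_turan) auto
  finally have T0: "spectral_radius r p ?T > 0" by (simp add: zero_less_mult_iff)
  have iso_eq: "sr d = spectral_radius r p ?T" if "isomorphic (complete_partite r V d) ?T" for d
    unfolding sr_def
    by (rule spectral_radius_isomorphic[OF that r_graph_complete_partite[OF V(1)] r_graph_turan])
      (use Vne p1 in auto)
  have bal_iso: "isomorphic (complete_partite r V d) ?T" if "balanced k V d" for d
    unfolding turan_def
    by (rule isomorphic_balanced[OF V(1) _ _ k0 that balanced_turan[OF k0]]) (use V in auto)
  have sr_restrict: "sr (restrict d V) = sr d" for d
    unfolding sr_def by (metis complete_partite_cong restrict_apply')
  define F where "F = sr ` (V \<rightarrow>\<^sub>E {..<k})"
  have finF: "finite F" unfolding F_def using V(1) by (intro finite_imageI finite_PiE) auto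
  have in_F: "sr d \<in> F" if "d ` V \<subseteq> {..<k}" for d
  proof -
    have "restrict d V \<in> V \<rightarrow>\<^sub>E {..<k}" using that by auto
    then show ?thesis unfolding F_def by (metis image_eqI sr_restrict)
  qed
  have max_bal: "isomorphic (complete_partite r V d) ?T"
    if d: "d ` V \<subseteq> {..<k}" "sr d = Max F" "sr d > 0" for d
  proof (rule bal_iso, unfold balanced_def, intro conjI allI impI d(1), rule ccontr)
    fix i j assume ij: "i < k" "j < k" and "\<not> card {v\<in>V. d v = i} \<le> card {v\<in>V. d v = j} + 1"
    then have sz: "card {v\<in>V. d v = j} + 2 \<le> card {v\<in>V. d v = i}" "i \<noteq> j" by auto
    obtain d' where d': "d' ` V \<subseteq> d ` V \<union> {i, j}" "sr d < sr d'"
      using rebalance_increases[OF V(1) r(1) p sz(2,1)] d(3) unfolding sr_def by blast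
    have "d' ` V \<subseteq> {..<k}" using d'(1) d(1) ij by auto
    then show False using Max_ge[OF finF in_F] d'(2) d(2) by fastforce
  qed
  obtain g where g: "bij_betw g V {..<n}"
    using finite_same_card_bij[OF V(1), of "{..<n}"] V(2) by auto
  define c0 where "c0 v = g v mod k" for v
  have c0: "c0 ` V \<subseteq> {..<k}" using k0 by (auto simp: c0_def)
  have "isomorphic (complete_partite r V c0) ?T"
    unfolding turan_def by (rule isomorphic_complete_partite[OF g V(1)]) (simp add: c0_def)
  then have sr0: "sr c0 = spectral_radius r p ?T" by (rule iso_eq)
  then have "Max F \<ge> spectral_radius r p ?T" using Max_ge[OF finF in_F[OF c0]] by simp
  moreover have "F \<noteq> {}" using in_F[OF c0] by auto
  then have "Max F \<in> sr ` (V \<rightarrow>\<^sub>E {..<k})" using Max_in[OF finF] unfolding F_def by blast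
  then obtain d where d: "sr d = Max F" "d \<in> V \<rightarrow>\<^sub>E {..<k}" by (metis imageE)
  ultimately have "isomorphic (complete_partite r V d) ?T"
    using T0 by (intro max_bal) auto
  then have maxF: "Max F = spectral_radius r p ?T" using iso_eq d(1) by simp
  show "sr c \<le> spectral_radius r p ?T" using Max_ge[OF finF in_F[OF c]] maxF by simp
  show "isomorphic (complete_partite r V c) ?T" if "sr c = spectral_radius r p ?T"
    using that maxF T0 c by (intro max_bal) auto
qed


section \<open>The partition of a dense graph of good pairs\<close>

text \<open>Union bound: a set meeting \<open>X\<close> arises at least once by adding a vertex of
  \<open>X\<close> to a set with one element less.\<close>

lemma sum_sets_meeting_le:
  assumes V: "finite V" "X \<subseteq> V" and z: "\<And>v. v \<in> V \<Longrightarrow> z v \<ge> (0::real)"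
  defines "G \<equiv> \<lambda>_ _. True"
  shows "(\<Sum>B\<in>{B\<in>cliques G V (Suc s). B \<inter> X \<noteq> {}}. \<Prod>v\<in>B. z v) \<le> sum z X * clique_weight G V z s"
proof -
  let ?C = "cliques G V (Suc s)"
  have finX: "finite X" using V finite_subset by blast
  have symG: "symp G" by (simp add: G_def symp_def)
  have "(\<Sum>B\<in>{B\<in>?C. B \<inter> X \<noteq> {}}. \<Prod>v\<in>B. z v) \<le> (\<Sum>B\<in>?C. \<Sum>a\<in>B. if a \<in> X then \<Prod>v\<in>B. z v else 0)"
  proof -
    have "(\<Prod>v\<in>B. z v) \<le> (\<Sum>a\<in>B. if a \<in> X then \<Prod>v\<in>B. z v else 0)" if B: "B \<in> ?C" "B \<inter> X \<noteq> {}" for B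
    proof -
      obtain a where a: "a \<in> B" "a \<in> X" using B(2) by blast
      have "(if a \<in> X then \<Prod>v\<in>B. z v else 0) \<le> (\<Sum>a\<in>B. if a \<in> X then \<Prod>v\<in>B. z v else 0)"
        using clique_prod_nonneg[OF z B(1)] finite_clique[OF V(1) B(1)]
        by (intro member_le_sum a(1)) auto
      then show ?thesis using a by simp
    qed
    then have "(\<Sum>B\<in>{B\<in>?C. B \<inter> X \<noteq> {}}. \<Prod>v\<in>B. z v) \<le>
        (\<Sum>B\<in>{B\<in>?C. B \<inter> X \<noteq> {}}. \<Sum>a\<in>B. if a \<in> X then \<Prod>v\<in>B. z v else 0)"
      by (intro sum_mono) auto
    also have "... \<le> (\<Sum>B\<in>?C. \<Sum>a\<in>B. if a \<in> X then \<Prod>v\<in>B. z v else 0)"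
      by (rule sum_mono2) (use finite_cliques[OF V(1)] clique_prod_nonneg[OF z] in \<open>auto intro!: sum_nonneg\<close>)
    finally show ?thesis .
  qed
  also have "... = (\<Sum>B\<in>?C. \<Sum>a\<in>B. if a \<in> X then (\<Prod>v\<in>B - {a}. z v) * z a else 0)"
  proof (intro sum.cong refl)
    fix B a assume "B \<in> ?C" "a \<in> B"
    then have "(\<Prod>v\<in>B. z v) = (\<Prod>v\<in>B - {a}. z v) * z a"
      using finite_clique[OF V(1)] by (simp add: prod.remove mult.commute)
    then show "(if a \<in> X then \<Prod>v\<in>B. z v else 0) = (if a \<in> X then (\<Prod>v\<in>B - {a}. z v) * z a else 0)" by simp
  qed
  also have "... = (\<Sum>B\<in>cliques G V s. \<Sum>a\<in>common_nbrs G V B. if a \<in> X then (\<Prod>v\<in>B. z v) * z a else 0)"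
    by (rule sum_clique_extensions[OF V(1) symG])
  also have "... \<le> (\<Sum>B\<in>cliques G V s. (\<Prod>v\<in>B. z v) * sum z X)"
  proof (rule sum_mono)
    fix B assume B: "B \<in> cliques G V s"
    have "(\<Sum>a\<in>common_nbrs G V B. if a \<in> X then (\<Prod>v\<in>B. z v) * z a else 0) =
        (\<Sum>a\<in>common_nbrs G V B \<inter> X. (\<Prod>v\<in>B. z v) * z a)"
      using finite_common_nbrs[OF V(1)] by (simp add: sum.inter_restrict)
    also have "... \<le> (\<Sum>a\<in>X. (\<Prod>v\<in>B. z v) * z a)"
      by (rule sum_mono2[OF finX]) (use clique_prod_nonneg[OF z B] z V(2) in auto)
    finally show "(\<Sum>a\<in>common_nbrs G V B. if a \<in> X then (\<Prod>v\<in>B. z v) * z a else 0) \<le> (\<Prod>v\<in>B. z v) * sum z X"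
      by (simp add: sum_distrib_left)
  qed
  also have "... = sum z X * clique_weight G V z s"
    unfolding clique_weight_def sum_distrib_right[symmetric] by (rule mult.commute)
  finally show ?thesis .
qed

lemma le_base_of_le_power:
  fixes y t :: real
  assumes "s \<ge> 1" "y \<ge> 0" "t \<ge> 0" "1 - t \<le> y ^ s"
  shows "1 - t \<le> y"
proof (cases "y \<le> 1")
  case True
  then have "y ^ s \<le> y ^ 1" using assms by (intro power_decreasing) auto
  then show ?thesis using assms by simp
qed (use assms in simp)

text \<open>Here \<open>m\<close> is \<open>n / k\<close> and \<open>e\<close> is an absolute error of size \<open>\<epsilon> n\<close>. The vertices of \<open>W\<close> are typical in the
  graph of good pairs and yield the partition; those of \<open>U\<close> only have large weighted degree in \<open>H\<close>.\<close>

locale dense_good_graph =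
  fixes r k M :: nat and H :: "'a hypergraph" and z :: "'a \<Rightarrow> real" and W U :: "'a set" and Z e m :: real
  assumes r: "r \<ge> 2" and kr: "k \<ge> r" and H: "r_graph r H"
    and free: "free_of (expanded_clique r (Suc k)) H"
    and M: "Suc k + r * (Suc k)\<^sup>2 \<le> M"
    and z0: "\<And>v. z v \<ge> 0" and zZ: "\<And>v. v \<in> verts H \<Longrightarrow> z v \<le> Z"
    and m: "real (card (verts H)) = real k * m"
    and sumV: "sum z (verts H) \<le> real k * m"
    and WU: "W \<subseteq> U" "U \<subseteq> verts H"
    and sumW: "sum z W \<ge> real k * m - e"
    and nonnbr: "\<And>v. v \<in> W \<Longrightarrow> sum z {u\<in>W. \<not> good_pair M (edges H) v u} \<le> m + e"
    and e: "e > 0" "real r * Z \<le> e" "32 * (real k)\<^sup>2 * e \<le> m"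
    and link: "\<And>v. v \<in> U \<Longrightarrow> link_form r H z v \<ge>
       fact (r - 1) * real ((k - 1) choose (r - 1)) * m ^ (r - 1) * (1 - 1 / (16 * real k)) +
       fact (r - 1) * real (card (bad_link M H v)) * Z ^ (r - 1) +
       real (r - 1) * ((real k * (2 * real k + 2) + real k + 2) * e) * (real k * m) ^ (r - 2)"
begin

abbreviation "gp \<equiv> good_pair M (edges H)"
abbreviation "V \<equiv> verts H"

lemma finV: "finite V" using H by (simp add: r_graph_def)
lemma finU: "finite U" using WU finV finite_subset by blast
lemma finW: "finite W" using WU finU finite_subset by blast
lemma WV: "W \<subseteq> V" using WU by blast
lemma k2: "k \<ge> 2" using r kr by simp
lemma gp_sym: "gp u v \<longleftrightarrow> gp v u" using symp_good_pair[of M "edges H"] by (auto simp: symp_def)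
lemma gp_irrefl: "\<not> gp u u" by (simp add: good_pair_def)

lemma no_clique:
  assumes "K \<subseteq> V" "pairwise gp K" shows "card K \<noteq> Suc k"
  using good_pair_clique_free[OF r H free _ M] assms k2 by (auto simp: cliques_def)

lemma sum_mono_set: "\<lbrakk>A \<subseteq> B; finite B\<rbrakk> \<Longrightarrow> sum z A \<le> sum z B"
  by (rule sum_mono2) (use z0 in auto)

lemma sum_Un_le: "\<lbrakk>finite A; finite B\<rbrakk> \<Longrightarrow> sum z (A \<union> B) \<le> sum z A + sum z B"
  by (simp add: sum_Un sum_nonneg z0)

lemma sum_Diff_ge: "\<lbrakk>finite A; finite B\<rbrakk> \<Longrightarrow> sum z A - sum z B \<le> sum z (A - B)"
proof -
  assume "finite A" "finite B"
  then have "sum z A \<le> sum z ((A - B) \<union> B)" by (intro sum_mono_set) auto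
  also have "... \<le> sum z (A - B) + sum z B" using \<open>finite A\<close> \<open>finite B\<close> by (intro sum_Un_le) auto
  finally show ?thesis by simp
qed

text \<open>The products \<open>k * e\<close> and \<open>k * (k * e)\<close> act as atoms in the
  later comparisons, which thereby become linear.\<close>

lemma e_bounds: "real k * e \<le> m / 64" "e \<le> m / 128" "real k * (real k * e) \<le> m / 32" "m > 0"
proof -
  have k: "real k \<ge> 2" using k2 by simp
  show c: "real k * (real k * e) \<le> m / 32" using e(3) by (simp add: power2_eq_square)
  have "2 * (real k * e) \<le> real k * (real k * e)" using k e by (intro mult_right_mono) auto
  then show a: "real k * e \<le> m / 64" using c by linarith
  have "2 * e \<le> real k * e" using k e by (intro mult_right_mono) auto
  then show "e \<le> m / 128" using a by linarith
  then show "m > 0" using e(1) by linarith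
qed

lemma sum_UN_le:
  assumes "finite I" "\<And>i. i \<in> I \<Longrightarrow> finite (S i)" "\<And>i. i \<in> I \<Longrightarrow> sum z (S i) \<le> b"
  shows "sum z (\<Union>i\<in>I. S i) \<le> real (card I) * b"
  using assms
proof (induction I rule: finite_induct)
  case (insert i I)
  have "sum z (\<Union>j\<in>insert i I. S j) \<le> sum z (S i) + sum z (\<Union>j\<in>I. S j)"
    using insert by (simp add: sum_Un_le)
  also have "... \<le> b + real (card I) * b" using insert by (intro add_mono) auto
  finally show ?case using insert by (simp add: algebra_simps)
qed simp

text \<open>Greedy choice: fewer than \<open>k\<close> non-neighbourhoods, each of weight at most
  \<open>m + e\<close>, cannot cover \<open>W\<close>, whose weight is at least
  \<open>k * m - e\<close>.\<close>

lemma exists_clique: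
  "\<exists>f. \<forall>i<k. f i \<in> W \<and> (\<forall>j<k. i \<noteq> j \<longrightarrow> gp (f i) (f j))"
proof -
  have "\<exists>f. \<forall>i<j. f i \<in> W \<and> (\<forall>i'<j. i \<noteq> i' \<longrightarrow> gp (f i) (f i'))" if "j \<le> k" for j
    using that
  proof (induction j)
    case (Suc j)
    then have "j \<le> k" by simp
    from Suc.IH[OF this] obtain f where "\<forall>i<j. f i \<in> W \<and> (\<forall>i'<j. i \<noteq> i' \<longrightarrow> gp (f i) (f i'))" by (rule exE)
    then have f: "f i \<in> W" "i' < j \<Longrightarrow> i \<noteq> i' \<Longrightarrow> gp (f i) (f i')" if "i < j" for i i' using that by blast+
    let ?X = "\<Union>i\<in>{..<j}. {u\<in>W. \<not> gp (f i) u}"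
    have "sum z ?X \<le> real (card {..<j}) * (m + e)"
      by (rule sum_UN_le) (use finW f nonnbr in auto)
    also have "... \<le> (real k - 1) * (m + e)"
      using Suc.prems e e_bounds by (intro mult_right_mono) auto
    also have "... < real k * m - e"
      using e_bounds by (simp add: algebra_simps)
    also have "... \<le> sum z W" by (rule sumW)
    finally have lt: "sum z ?X < sum z W" .
    have "\<not> W \<subseteq> ?X"
    proof
      assume "W \<subseteq> ?X"
      then have "sum z W \<le> sum z ?X" using finW by (intro sum_mono_set) auto
      then show False using lt by simp
    qed
    then obtain u where u: "u \<in> W" "u \<notin> ?X" by blast
    have gu: "gp (f i) u" "gp u (f i)" if "i < j" for i using u that gp_sym by auto
    show ?case
      by (rule exI[of _ "f(j := u)"]) (use f u(1) gu in \<open>simp add: less_Suc_eq\<close>)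
  qed simp
  then show ?thesis by blast
qed

definition f where "f = (SOME f. \<forall>i<k. f i \<in> W \<and> (\<forall>j<k. i \<noteq> j \<longrightarrow> gp (f i) (f j)))"

lemma fW: "i < k \<Longrightarrow> f i \<in> W" and f_gp: "i < k \<Longrightarrow> j < k \<Longrightarrow> i \<noteq> j \<Longrightarrow> gp (f i) (f j)"
  using someI_ex[OF exists_clique] unfolding f_def by blast+

lemma f_inj: "inj_on f {..<k}"
  using f_gp gp_irrefl by (intro inj_onI) (metis lessThan_iff)

text \<open>These are the vertices that could replace \<open>f i\<close> in the clique. Nothing is
  required about \<open>f i\<close> itself; clique-freeness forces it to be a non-neighbour.\<close>

definition A where "A i = {u\<in>W. \<forall>j<k. j \<noteq> i \<longrightarrow> gp (f j) u}"

lemma AW: "A i \<subseteq> W" by (auto simp: A_def)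
lemma AV: "A i \<subseteq> V" using AW WV by blast
lemma finA: "finite (A i)" using AW finW finite_subset by blast

lemma not_all_f: "u \<in> V \<Longrightarrow> \<exists>j<k. \<not> gp (f j) u"
proof (rule ccontr)
  assume u: "u \<in> V" and "\<not> ?thesis"
  then have g: "gp (f j) u" if "j < k" for j using that by blast
  let ?K = "insert u (f ` {..<k})"
  have "u \<notin> f ` {..<k}" using g gp_irrefl by auto
  then have "card ?K = Suc k" by (simp add: card_image[OF f_inj])
  moreover have "pairwise gp (f ` {..<k})" using f_gp by (auto simp: pairwise_def)
  then have "pairwise gp ?K" using g gp_sym by (auto simp: pairwise_insert)
  moreover have "?K \<subseteq> V" using u fW WV by auto
  ultimately show False using no_clique by blast
qed

lemma A_not_f: "i < k \<Longrightarrow> u \<in> A i \<Longrightarrow> \<not> gp (f i) u"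
  using not_all_f[of u] AV by (auto simp: A_def)

lemma A_disj: "\<lbrakk>i < k; j < k; i \<noteq> j\<rbrakk> \<Longrightarrow> A i \<inter> A j = {}"
  using A_not_f by (auto simp: A_def)

text \<open>Two adjacent vertices of \<open>A i\<close> together with the \<open>k - 1\<close>
  vertices \<open>f j\<close>, \<open>j \<noteq> i\<close>, would form a clique of size
  \<open>k + 1\<close>.\<close>

lemma A_indep: "\<lbrakk>i < k; u \<in> A i; v \<in> A i\<rbrakk> \<Longrightarrow> \<not> gp u v"
proof
  assume i: "i < k" and uv: "u \<in> A i" "v \<in> A i" "gp u v"
  let ?F = "f ` ({..<k} - {i})"
  let ?K = "insert u (insert v ?F)"
  have g: "gp (f j) u" "gp (f j) v" if "j < k" "j \<noteq> i" for j using that uv by (auto simp: A_def)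
  have ne: "u \<noteq> v" using uv gp_irrefl by auto
  have uF: "u \<notin> ?F" and vF: "v \<notin> ?F" using g gp_irrefl by auto
  have "card ?F = k - 1" using i by (subst card_image) (auto intro: inj_on_subset[OF f_inj])
  then have "card ?K = Suc k" using ne uF vF i by simp
  moreover have "pairwise gp ?F" using f_gp by (auto simp: pairwise_def)
  then have "pairwise gp ?K" using g gp_sym uv by (auto simp: pairwise_insert)
  moreover have "?K \<subseteq> V" using uv AV fW WV by auto
  ultimately show False using no_clique by blast
qed

lemma A_upper: "i < k \<Longrightarrow> sum z (A i) \<le> m + e"
proof -
  assume i: "i < k"
  have "sum z (A i) \<le> sum z {u\<in>W. \<not> gp (f i) u}"
    by (rule sum_mono_set) (use A_not_f[OF i] AW finW in auto)
  then show ?thesis using nonnbr[OF fW[OF i]] by simp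
qed

definition AA where "AA = (\<Union>i<k. A i)"

lemma AAW: "AA \<subseteq> W" using AW by (auto simp: AA_def)
lemma finAA: "finite AA" using AAW finW finite_subset by blast
lemma sum_AA: "sum z AA = (\<Sum>i<k. sum z (A i))"
  unfolding AA_def by (rule sum.UNION_disjoint) (use finA A_disj in auto)

text \<open>Every vertex of \<open>W\<close> misses at least one \<open>f i\<close>, and outside
  \<open>AA\<close> at least two. Counting non-neighbours of all \<open>f i\<close> thus gives at
  least \<open>sum z W + sum z (W - AA)\<close>, against an upper bound of
  \<open>k * (m + e)\<close>.\<close>

lemma rest_small: "sum z (W - AA) \<le> (real k + 1) * e"
proof -
  have two: "(\<Sum>i<k. if gp (f i) u then 0 else 1) \<ge> (if u \<in> AA then 1 else (2::real))" if u: "u \<in> W" for u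
  proof -
    obtain j where j: "j < k" "\<not> gp (f j) u" using not_all_f u WV by blast
    have split: "(\<Sum>i<k. if gp (f i) u then 0 else 1) =
        1 + (\<Sum>i\<in>{..<k} - {j}. if gp (f i) u then 0 else (1::real))"
      using j by (simp add: sum.remove)
    show ?thesis
    proof (cases "u \<in> AA")
      case True
      have "(\<Sum>i\<in>{..<k} - {j}. if gp (f i) u then 0 else (1::real)) \<ge> 0" by (rule sum_nonneg) auto
      then show ?thesis unfolding split using True by simp
    next
      case False
      then have "u \<notin> A j" using j by (auto simp: AA_def)
      then obtain j' where j': "j' < k" "j' \<noteq> j" "\<not> gp (f j') u" using u by (auto simp: A_def)
      have "(if gp (f j') u then 0 else 1) \<le> (\<Sum>i\<in>{..<k} - {j}. if gp (f i) u then 0 else (1::real))"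
        by (rule member_le_sum) (use j' in auto)
      then show ?thesis unfolding split using False j' by simp
    qed
  qed
  have "sum z W + sum z (W - AA) = (\<Sum>u\<in>W. z u * (if u \<in> AA then 1 else 2))"
  proof -
    have "(\<Sum>u\<in>W. z u * (if u \<in> AA then 1 else 2)) = (\<Sum>u\<in>W. z u + (if u \<in> W - AA then z u else 0))"
      by (rule sum.cong) auto
    also have "... = sum z W + (\<Sum>u\<in>W. if u \<in> W - AA then z u else 0)" by (rule sum.distrib)
    also have "(\<Sum>u\<in>W. if u \<in> W - AA then z u else 0) = sum z (W \<inter> (W - AA))"
      by (rule sum.inter_restrict[OF finW, symmetric])
    also have "W \<inter> (W - AA) = W - AA" by auto
    finally show ?thesis by simp
  qed
  also have "... \<le> (\<Sum>u\<in>W. z u * (\<Sum>i<k. if gp (f i) u then 0 else 1))"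
    by (intro sum_mono mult_left_mono two z0)
  also have "... = (\<Sum>i<k. \<Sum>u\<in>W. z u * (if gp (f i) u then 0 else 1))"
    unfolding sum_distrib_left by (rule sum.swap)
  also have "... = (\<Sum>i<k. sum z {u\<in>W. \<not> gp (f i) u})"
  proof (rule sum.cong[OF refl])
    fix i
    have "(\<Sum>u\<in>W. z u * (if gp (f i) u then 0 else 1)) = (\<Sum>u\<in>W. if \<not> gp (f i) u then z u else 0)"
      by (rule sum.cong) auto
    then show "(\<Sum>u\<in>W. z u * (if gp (f i) u then 0 else 1)) = sum z {u\<in>W. \<not> gp (f i) u}"
      using sum.inter_filter[OF finW, of z "\<lambda>u. \<not> gp (f i) u"] by simp
  qed
  also have "... \<le> (\<Sum>i<k. m + e)" by (rule sum_mono) (use nonnbr fW in auto)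
  finally show ?thesis using sumW by (simp add: algebra_simps)
qed

lemma A_lower: "i < k \<Longrightarrow> sum z (A i) \<ge> m - (2 * real k + 1) * e"
proof -
  assume i: "i < k"
  have "sum z W - sum z (W - AA) \<le> sum z (W - (W - AA))" using finW by (intro sum_Diff_ge) auto
  also have "... \<le> sum z AA" using finAA by (intro sum_mono_set) auto
  also have "... = sum z (A i) + (\<Sum>j\<in>{..<k} - {i}. sum z (A j))" unfolding sum_AA using i by (simp add: sum.remove)
  also have "(\<Sum>j\<in>{..<k} - {i}. sum z (A j)) \<le> (\<Sum>j\<in>{..<k} - {i}. m + e)"
    by (rule sum_mono) (use A_upper in auto)
  also have "... = (real k - 1) * (m + e)" using i by (simp add: of_nat_diff)
  finally show ?thesis using sumW rest_small by (simp add: algebra_simps)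
qed

text \<open>The independent set \<open>A i\<close> already uses up nearly all of the weight
  \<open>m + e\<close> allowed for non-neighbours of \<open>u\<close>.\<close>

lemma A_nonnbr:
  assumes "i < k" "u \<in> A i"
  shows "sum z ({w\<in>W. \<not> gp u w} - A i) \<le> (2 * real k + 2) * e"
proof -
  have sub: "A i \<subseteq> {w\<in>W. \<not> gp u w}" using A_indep assms AW[of i] by auto
  have "sum z ({w\<in>W. \<not> gp u w} - A i) = sum z {w\<in>W. \<not> gp u w} - sum z (A i)"
    by (rule sum_diff) (use finW sub in auto)
  also have "... \<le> (m + e) - (m - (2 * real k + 1) * e)"
    using nonnbr[of u] assms AW A_lower[OF assms(1)] by (intro diff_mono) auto
  finally show ?thesis by (simp add: algebra_simps)
qed

text \<open>Greedy transversal: every chosen vertex rules out at most \<open>(2 * k + 2) * e\<close>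
  outside its own class, and fewer than \<open>k + 1\<close> choices cannot exhaust a set above the
  threshold.\<close>

lemma pick_clique:
  assumes "J \<subseteq> {..<k}" "\<And>j. j \<in> J \<Longrightarrow> S j \<subseteq> A j"
    "\<And>j. j \<in> J \<Longrightarrow> sum z (S j) > real k * (2 * real k + 2) * e"
  shows "\<exists>g. \<forall>j\<in>J. g j \<in> S j \<and> (\<forall>j'\<in>J. j \<noteq> j' \<longrightarrow> gp (g j) (g j'))"
proof -
  have "finite J" using assms(1) finite_subset by blast
  then show ?thesis using assms
  proof (induction J rule: finite_induct)
    case (insert j0 J)
    have "\<exists>g. \<forall>j\<in>J. g j \<in> S j \<and> (\<forall>j'\<in>J. j \<noteq> j' \<longrightarrow> gp (g j) (g j'))"
      by (rule insert.IH) (use insert.prems in auto)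
    then obtain g where "\<forall>j\<in>J. g j \<in> S j \<and> (\<forall>j'\<in>J. j \<noteq> j' \<longrightarrow> gp (g j) (g j'))" by (rule exE)
    then have g: "g j \<in> S j" "j' \<in> J \<Longrightarrow> j \<noteq> j' \<Longrightarrow> gp (g j) (g j')" if "j \<in> J" for j j' using that by blast+
    have jk: "j < k" if "j \<in> insert j0 J" for j using insert.prems(1) that by auto
    have gA: "g j \<in> A j" if "j \<in> J" for j using g(1)[OF that] insert.prems(2)[of j] that by auto
    let ?X = "\<Union>j\<in>J. {w\<in>W. \<not> gp (g j) w} - A j"
    have "sum z ?X \<le> real (card J) * ((2 * real k + 2) * e)"
      by (rule sum_UN_le) (use insert.hyps finW A_nonnbr gA jk in auto)
    also have "... \<le> real k * ((2 * real k + 2) * e)"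
      using card_mono[of "{..<k}" J] insert.prems(1) e by (intro mult_right_mono) auto
    also have "... < sum z (S j0)" using insert.prems(3)[of j0] by (simp add: mult.assoc)
    finally have lt: "sum z ?X < sum z (S j0)" .
    have "\<not> S j0 \<subseteq> ?X"
    proof
      assume "S j0 \<subseteq> ?X"
      then have "sum z (S j0) \<le> sum z ?X" using finW insert.hyps by (intro sum_mono_set) auto
      then show False using lt by simp
    qed
    then obtain u where u: "u \<in> S j0" "u \<notin> ?X" by blast
    have uA: "u \<in> A j0" using u insert.prems(2)[of j0] by auto
    have gu: "gp (g j) u" "gp u (g j)" if j: "j \<in> J" for j
    proof -
      have "j \<noteq> j0" using insert.hyps j by auto
      then have "u \<notin> A j" using uA A_disj[of j0 j] jk j by auto
      then show "gp (g j) u" using u(2) j uA AW by auto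
      then show "gp u (g j)" using gp_sym by blast
    qed
    have jne: "j \<noteq> j0" if "j \<in> J" for j using that insert.hyps by auto
    show ?case
      by (rule exI[of _ "g(j0 := u)"]) (use g u(1) gu jne in auto)
  qed simp
qed

text \<open>A transversal clique in the common neighbourhood, avoiding \<open>ed\<close>, completes
  \<open>a\<close> and \<open>b\<close> to a core of \<open>k + 1\<close> vertices in which all
  pairs except possibly \<open>{a, b}\<close> are good; the edge \<open>ed\<close> serves this pair.
  The extra \<open>e\<close> in the threshold pays for deleting the vertices of \<open>ed\<close>
  from the classes.\<close>

lemma no_edge:
  assumes ab: "a \<noteq> b" "ed \<in> edges H" "a \<in> ed" "b \<in> ed" and i: "i < k"
    and big: "\<And>j. j < k \<Longrightarrow> j \<noteq> i \<Longrightarrow> sum z {u\<in>A j. gp a u \<and> gp b u} > real k * (2 * real k + 2) * e + e"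
  shows False
proof -
  have edV: "ed \<subseteq> V" "card ed = r" using H ab(2) by (auto simp: r_graph_def)
  have fed: "finite ed" using edV finV finite_subset by blast
  have "sum z ed \<le> (\<Sum>v\<in>ed. Z)" by (rule sum_mono) (use zZ edV in auto)
  then have sed: "sum z ed \<le> e" using e(2) edV by simp
  define S where "S j = {u\<in>A j. gp a u \<and> gp b u} - ed" for j
  let ?J = "{..<k} - {i}"
  have "\<exists>g. \<forall>j\<in>?J. g j \<in> S j \<and> (\<forall>j'\<in>?J. j \<noteq> j' \<longrightarrow> gp (g j) (g j'))"
  proof (rule pick_clique)
    fix j assume j: "j \<in> ?J"
    show "S j \<subseteq> A j" by (auto simp: S_def)
    have "sum z {u\<in>A j. gp a u \<and> gp b u} - sum z ed \<le> sum z (S j)"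
      unfolding S_def using finA[of j] fed by (intro sum_Diff_ge) auto
    then show "sum z (S j) > real k * (2 * real k + 2) * e" using big[of j] j sed by auto
  qed auto
  then obtain g where "\<forall>j\<in>?J. g j \<in> S j \<and> (\<forall>j'\<in>?J. j \<noteq> j' \<longrightarrow> gp (g j) (g j'))" by (rule exE)
  then have g: "g j \<in> S j" "j' \<in> ?J \<Longrightarrow> j \<noteq> j' \<Longrightarrow> gp (g j) (g j')" if "j \<in> ?J" for j j' using that by blast+
  have g_inj: "inj_on g ?J" using g(2) gp_irrefl by (intro inj_onI) metis
  let ?F = "g ` ?J"
  let ?K = "insert a (insert b ?F)"
  have Fed: "?F \<inter> ed = {}" using g(1) by (auto simp: S_def)
  have gab: "gp a u" "gp b u" "gp u a" "gp u b" if "u \<in> ?F" for u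
    using that g(1) gp_sym by (auto simp: S_def)
  have FV: "?F \<subseteq> V"
  proof
    fix u assume "u \<in> ?F"
    then obtain j where "j \<in> ?J" "u = g j" by blast
    then show "u \<in> V" using g(1)[of j] AV[of j] by (auto simp: S_def)
  qed
  have KV: "?K \<subseteq> V" using FV edV ab by auto
  have "card ?F = k - 1" using i card_image[OF g_inj] by simp
  moreover have "a \<notin> ?F" "b \<notin> ?F" using Fed ab by auto
  ultimately have cK: "card ?K = Suc k" using ab(1) i by simp
  have "\<not> free_of (expanded_clique r (Suc k)) H"
  proof (rule expanded_clique_of_good_pairs[OF r H KV cK _ _ ab(1) ab(2) _ _ M])
    show "ed \<inter> ?K = {a, b}" using Fed ab by auto
    fix u v assume uv: "u \<in> ?K" "v \<in> ?K" "u \<noteq> v" "{u, v} \<noteq> {a, b}"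
    have FF: "gp u v" if "u \<in> ?F" "v \<in> ?F" using that uv(3) g(2) by auto
    show "gp u v" using uv FF gab by blast
  qed auto
  then show False using free by simp
qed

text \<open>Both vertices see almost everything outside their own class, so they have many common
  neighbours in each other class. This excludes edges whether or not the pair is good, which is
  stronger than \<open>A_indep\<close>.\<close>

lemma A_edge:
  assumes "i < k" "a \<in> A i" "b \<in> A i" "a \<noteq> b" "ed \<in> edges H" "a \<in> ed" "b \<in> ed"
  shows False
proof (rule no_edge[OF assms(4-7,1)])
  fix j assume j: "j < k" "j \<noteq> i"
  have d: "A i \<inter> A j = {}" using A_disj assms(1) j by auto
  let ?Na = "{w\<in>W. \<not> gp a w} - A i" and ?Nb = "{w\<in>W. \<not> gp b w} - A i"
  have "sum z (A j) - (sum z ?Na + sum z ?Nb) \<le> sum z (A j) - sum z (?Na \<union> ?Nb)"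
    using finW by (intro diff_left_mono sum_Un_le) auto
  also have "... \<le> sum z (A j - (?Na \<union> ?Nb))" using finA finW by (intro sum_Diff_ge) auto
  also have "... \<le> sum z {u\<in>A j. gp a u \<and> gp b u}"
    by (rule sum_mono_set) (use d AW finA[of j] in auto)
  finally have "sum z {u\<in>A j. gp a u \<and> gp b u} \<ge> m - (2 * real k + 1) * e - 2 * ((2 * real k + 2) * e)"
    using A_lower[OF j(1)] A_nonnbr[OF assms(1,2)] A_nonnbr[OF assms(1,3)] by simp
  moreover have "m - (2 * real k + 1) * e - 2 * ((2 * real k + 2) * e) > real k * (2 * real k + 2) * e + e"
    using e_bounds by (simp add: algebra_simps)
  ultimately show "sum z {u\<in>A j. gp a u \<and> gp b u} > real k * (2 * real k + 2) * e + e" by linarith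
qed

text \<open>Otherwise a transversal clique of all \<open>k\<close> classes inside the neighbourhood
  of \<open>v\<close> would extend by \<open>v\<close>.\<close>

lemma missing_part:
  assumes "v \<in> V"
  shows "\<exists>i<k. sum z {u\<in>A i. gp v u} \<le> real k * (2 * real k + 2) * e"
proof (rule ccontr)
  assume "\<not> ?thesis"
  then have "\<exists>g. \<forall>j\<in>{..<k}. g j \<in> {u\<in>A j. gp v u} \<and> (\<forall>j'\<in>{..<k}. j \<noteq> j' \<longrightarrow> gp (g j) (g j'))"
    by (intro pick_clique) (auto simp: not_le)
  then obtain g where "\<forall>j\<in>{..<k}. g j \<in> {u\<in>A j. gp v u} \<and> (\<forall>j'\<in>{..<k}. j \<noteq> j' \<longrightarrow> gp (g j) (g j'))" by (rule exE)
  then have g: "g j \<in> A j" "gp v (g j)" "j' < k \<Longrightarrow> j \<noteq> j' \<Longrightarrow> gp (g j) (g j')" if "j < k" for j j' using that by blast+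
  let ?K = "insert v (g ` {..<k})"
  have "inj_on g {..<k}" using g(3) gp_irrefl by (intro inj_onI) (metis lessThan_iff)
  then have "card (g ` {..<k}) = k" by (simp add: card_image)
  moreover have "v \<notin> g ` {..<k}" using g(2) gp_irrefl by auto
  ultimately have "card ?K = Suc k" by simp
  moreover have "pairwise gp (g ` {..<k})" using g(3) by (auto simp: pairwise_def)
  then have "pairwise gp ?K" using g(2) gp_sym by (auto simp: pairwise_insert)
  moreover have "?K \<subseteq> V" using assms g(1) AV by auto
  ultimately show False using no_clique by blast
qed

definition col where "col v = (SOME i. i < k \<and> sum z {u\<in>A i. gp v u} \<le> real k * (2 * real k + 2) * e)"

lemma col: "v \<in> V \<Longrightarrow> col v < k" "v \<in> V \<Longrightarrow> sum z {u\<in>A (col v). gp v u} \<le> real k * (2 * real k + 2) * e"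
  using someI_ex[OF missing_part] unfolding col_def by blast+

lemma outside_small: "sum z (V - AA) \<le> (real k + 2) * e"
proof -
  have "V - AA \<subseteq> (V - W) \<union> (W - AA)" by auto
  then have "sum z (V - AA) \<le> sum z (V - W) + sum z (W - AA)"
    using finV finW by (intro order_trans[OF sum_mono_set sum_Un_le]) auto
  moreover have "sum z (V - W) = sum z V - sum z W" using finV WV by (rule sum_diff)
  ultimately show ?thesis using sumV sumW rest_small by (simp add: algebra_simps)
qed

text \<open>Edges at \<open>v\<close> are of three kinds: those with a bad pair at \<open>v\<close>,
  those meeting the light set \<open>X\<close>, and the rest. An edge of the last kind has its other
  vertices in \<open>Y\<close> and, by \<open>A_edge\<close>, at most one in each of the
  \<open>k - 1\<close> classes other than that of \<open>v\<close>, so the clique bound applies even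
  though pairs inside the edge may be bad.\<close>

lemma link_upper:
  assumes v: "v \<in> V"
  defines "Y \<equiv> {u\<in>AA - A (col v). gp v u}"
  shows "link_form r H z v \<le>
       fact (r - 1) * real ((k - 1) choose (r - 1)) * (sum z Y / real (k - 1)) ^ (r - 1) +
       fact (r - 1) * real (card (bad_link M H v)) * Z ^ (r - 1) +
       real (r - 1) * ((real k * (2 * real k + 2) + real k + 2) * e) * (real k * m) ^ (r - 2)"
proof -
  define X where "X = (V - AA) \<union> {u\<in>A (col v). gp v u}"
  define E1 where "E1 = bad_link M H v"
  define E2 where "E2 = {ed\<in>edges H - E1. v \<in> ed \<and> (ed - {v}) \<inter> X \<noteq> {}}"
  define E3 where "E3 = {ed\<in>edges H - E1. v \<in> ed \<and> (ed - {v}) \<inter> X = {}}"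
  let ?w = "\<lambda>ed. \<Prod>u\<in>ed - {v}. z u"
  let ?G = "\<lambda>(_::'a) (_::'a). True"
  have fE: "finite (edges H)" using H by (rule finite_edges)
  have ed: "ed \<subseteq> V" "card ed = r" "finite ed" if "ed \<in> edges H" for ed
    using H that finite_subset[OF _ finV] by (auto simp: r_graph_def)
  have w0: "?w ed \<ge> 0" for ed by (rule prod_nonneg) (use z0 in auto)
  have r1: "r - 1 = Suc (r - 2)" using r by simp
  have "{ed\<in>edges H. v \<in> ed} = E1 \<union> (E2 \<union> E3)"
    by (auto simp: E1_def E2_def E3_def bad_link_def)
  moreover have "finite E1" "finite E2" "finite E3"
    using fE by (auto simp: E1_def E2_def E3_def bad_link_def)
  moreover have "E1 \<inter> (E2 \<union> E3) = {}" "E2 \<inter> E3 = {}" by (auto simp: E2_def E3_def)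
  ultimately have split: "(\<Sum>ed\<in>{ed\<in>edges H. v \<in> ed}. ?w ed) = sum ?w E1 + (sum ?w E2 + sum ?w E3)"
    by (simp add: sum.union_disjoint)
  have "sum ?w E1 \<le> (\<Sum>ed\<in>E1. Z ^ (r - 1))"
  proof (rule sum_mono)
    fix d assume "d \<in> E1"
    then have d: "d \<in> edges H" "v \<in> d" by (auto simp: E1_def bad_link_def)
    have "?w d \<le> (\<Prod>u\<in>d - {v}. Z)" by (rule prod_mono) (use z0 zZ ed(1)[OF d(1)] in auto)
    also have "... = Z ^ (r - 1)" using ed[OF d(1)] d(2) by simp
    finally show "?w d \<le> Z ^ (r - 1)" .
  qed
  then have b1: "sum ?w E1 \<le> real (card (bad_link M H v)) * Z ^ (r - 1)" by (simp add: E1_def)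
  have XV: "X \<subseteq> V" using AV by (auto simp: X_def)
  have mem_all: "d - {v} \<in> cliques ?G V (r - 1)" if "d \<in> edges H" "v \<in> d" for d
    using ed[OF that(1)] that by (auto simp: cliques_def pairwise_def)
  have inj: "inj_on (\<lambda>d. d - {v}) E2" by (rule inj_onI) (auto simp: E2_def)
  have "sum ?w E2 = (\<Sum>B\<in>(\<lambda>d. d - {v}) ` E2. \<Prod>u\<in>B. z u)" using inj by (simp add: sum.reindex)
  also have "... \<le> (\<Sum>B\<in>{B\<in>cliques ?G V (r - 1). B \<inter> X \<noteq> {}}. \<Prod>u\<in>B. z u)"
  proof (rule sum_mono2)
    show "finite {B\<in>cliques ?G V (r - 1). B \<inter> X \<noteq> {}}" using finite_cliques[OF finV, of ?G "r - 1"] by simp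
    show "(\<lambda>d. d - {v}) ` E2 \<subseteq> {B\<in>cliques ?G V (r - 1). B \<inter> X \<noteq> {}}"
      using mem_all by (auto simp: E2_def)
  qed (use z0 in \<open>auto intro: prod_nonneg\<close>)
  also have "... \<le> sum z X * clique_weight ?G V z (r - 2)"
    unfolding r1 by (rule sum_sets_meeting_le[OF finV XV z0])
  finally have b2: "fact (r - 1) * sum ?w E2 \<le> fact (r - 1) * (sum z X * clique_weight ?G V z (r - 2))"
    by (intro mult_left_mono) auto
  have sX: "sum z X \<le> (real k * (2 * real k + 2) + real k + 2) * e"
  proof -
    have "sum z X \<le> sum z (V - AA) + sum z {u\<in>A (col v). gp v u}"
      unfolding X_def using finV finA by (intro sum_Un_le) auto
    then show ?thesis using outside_small col(2)[OF v] by (simp add: algebra_simps)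
  qed
  have n0: "0 \<le> real k * m" using e_bounds by simp
  have "fact (r - 2) * clique_weight ?G V z (r - 2) \<le> sum z V ^ (r - 2)"
    by (rule fact_clique_weight_le[OF finV _ z0]) (simp add: symp_def)
  also have "... \<le> (real k * m) ^ (r - 2)" using sumV by (intro power_mono sum_nonneg z0)
  finally have cw: "fact (r - 2) * clique_weight ?G V z (r - 2) \<le> (real k * m) ^ (r - 2)" .
  have "fact (r - 1) * (sum z X * clique_weight ?G V z (r - 2)) =
      real (r - 1) * (sum z X * (fact (r - 2) * clique_weight ?G V z (r - 2)))"
    unfolding r1 by (simp add: algebra_simps)
  also have "... \<le> real (r - 1) * (((real k * (2 * real k + 2) + real k + 2) * e) * (real k * m) ^ (r - 2))"
  proof (intro mult_left_mono mult_mono sX cw)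
    show "0 \<le> fact (r - 2) * clique_weight ?G V z (r - 2)" by (simp add: clique_weight_nonneg z0)
  qed (use e in auto)
  finally have b2': "fact (r - 1) * sum ?w E2 \<le>
      real (r - 1) * ((real k * (2 * real k + 2) + real k + 2) * e) * (real k * m) ^ (r - 2)"
    using order_trans[OF b2] by (simp only: mult.assoc)
  \<comment> \<open>The class index of a vertex, meaningful only on \<open>AA\<close>; only vertices
    of \<open>Y\<close>, which lie in \<open>AA\<close>, are ever compared.\<close>
  define part where "part u = (SOME i. i < k \<and> u \<in> A i)" for u
  have part: "part u < k \<and> u \<in> A (part u)" if "u \<in> AA" for u
    unfolding part_def by (rule someI_ex) (use that in \<open>auto simp: AA_def\<close>)
  let ?P = "\<lambda>u w. part u \<noteq> part w"
  have YA: "Y \<subseteq> AA" "finite Y" using finAA by (auto simp: Y_def)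
  have partY: "part ` Y \<subseteq> {..<k} - {col v}"
  proof
    fix i assume "i \<in> part ` Y"
    then obtain u where "u \<in> Y" "i = part u" by blast
    then show "i \<in> {..<k} - {col v}" using part[of u] by (auto simp: Y_def)
  qed
  have free_Y: "cliques ?P Y (Suc (k - 1)) = {}"
  proof (rule ccontr)
    assume "\<not> ?thesis"
    then obtain B where B: "B \<subseteq> Y" "card B = Suc (k - 1)" "pairwise ?P B" by (auto simp: cliques_def)
    have "inj_on part B" using B(3) by (auto simp: pairwise_def inj_on_def)
    then have "card B = card (part ` B)" by (simp add: card_image)
    also have "... \<le> card ({..<k} - {col v})" using B(1) partY by (intro card_mono) auto
    also have "... = k - 1" using col(1)[OF v] by simp
    finally show False using B(2) by simp
  qed
  have "sum ?w E3 \<le> clique_weight ?P Y z (r - 1)"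
  proof (rule link_sum_le_clique_weight[OF YA(2) z0])
    fix d assume "d \<in> E3"
    then have d: "d \<in> edges H" "v \<in> d" "(d - {v}) \<inter> X = {}" "d \<notin> bad_link M H v"
      by (auto simp: E3_def E1_def)
    have gv: "gp v u" if "u \<in> d - {v}" for u using d that by (auto simp: bad_link_def)
    have dY: "d - {v} \<subseteq> Y"
    proof
      fix u assume u: "u \<in> d - {v}"
      then have "u \<in> V" "u \<notin> X" using ed(1)[OF d(1)] d(3) by auto
      then show "u \<in> Y" using gv[OF u] by (auto simp: X_def Y_def)
    qed
    moreover have "pairwise ?P (d - {v})"
    proof (rule pairwiseI)
      fix a b assume ab: "a \<in> d - {v}" "b \<in> d - {v}" "a \<noteq> b"
      then have "a \<in> AA" "b \<in> AA" using dY YA by auto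
      then show "part a \<noteq> part b" using part[of a] part[of b] A_edge[of "part a" a b d] ab d(1) by auto
    qed
    moreover have "card (d - {v}) = r - 1" using ed[OF d(1)] d(2) by simp
    ultimately show "v \<in> d \<and> d - {v} \<in> cliques ?P Y (r - 1)" using d(2) by (simp add: cliques_def)
  qed
  also have "... \<le> real ((k - 1) choose (r - 1)) * (sum z Y / real (k - 1)) ^ (r - 1)"
    by (rule clique_weight_bound[OF YA(2) _ z0 free_Y]) (use k2 kr r in \<open>auto simp: symp_def\<close>)
  finally have b3: "sum ?w E3 \<le> real ((k - 1) choose (r - 1)) * (sum z Y / real (k - 1)) ^ (r - 1)" .
  have "link_form r H z v = fact (r - 1) * sum ?w E1 + (fact (r - 1) * sum ?w E2 + fact (r - 1) * sum ?w E3)"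
    unfolding link_form_def split by (simp add: distrib_left)
  also have "... \<le> fact (r - 1) * (real (card (bad_link M H v)) * Z ^ (r - 1)) +
      (real (r - 1) * ((real k * (2 * real k + 2) + real k + 2) * e) * (real k * m) ^ (r - 2) +
       fact (r - 1) * (real ((k - 1) choose (r - 1)) * (sum z Y / real (k - 1)) ^ (r - 1)))"
    by (intro add_mono b2' mult_left_mono b1 b3) auto
  finally show ?thesis by (simp add: mult.assoc)
qed

text \<open>Comparing the assumed lower bound on the link with \<open>link_upper\<close> cancels
  both error terms and leaves \<open>sum z Y\<close> close to \<open>(k - 1) * m\<close>. As each of
  the other \<open>k - 2\<close> classes absorbs at most \<open>m + e\<close>, class
  \<open>j\<close> must be almost completely adjacent to \<open>v\<close>.\<close>

lemma U_nbrs: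
  assumes v: "v \<in> U" and j: "j < k" "j \<noteq> col v"
  shows "sum z {u\<in>A j. gp v u} \<ge> m - m / 16 - real k * e"
proof -
  define Y where "Y = {u\<in>AA - A (col v). gp v u}"
  define C where "C = fact (r - 1) * real ((k - 1) choose (r - 1))"
  \<comment> \<open>The good degree of \<open>v\<close> into the other classes, relative to its
    ideal value.\<close>
  define y where "y = sum z Y / (real (k - 1) * m)"
  have vV: "v \<in> V" using v WU by auto
  have C: "C > 0" using r kr by (simp add: C_def zero_less_binomial)
  have k1: "real (k - 1) = real k - 1" "real k - 1 \<ge> 1" using k2 by auto
  have m0: "m > 0" using e_bounds by simp
  have y0: "y \<ge> 0" using m0 by (simp add: y_def sum_nonneg z0)
  have "C * m ^ (r - 1) * (1 - 1 / (16 * real k)) \<le> C * (sum z Y / real (k - 1)) ^ (r - 1)"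
    using order_trans[OF link[OF v] link_upper[OF vV]] unfolding C_def Y_def by simp
  also have "sum z Y / real (k - 1) = m * y" using m0 by (simp add: y_def)
  also have "C * (m * y) ^ (r - 1) = C * m ^ (r - 1) * y ^ (r - 1)" by (simp add: power_mult_distrib)
  finally have "1 - 1 / (16 * real k) \<le> y ^ (r - 1)" using C m0 by (simp add: mult_le_cancel_left_pos)
  then have "1 - 1 / (16 * real k) \<le> y" using y0 r by (intro le_base_of_le_power[of "r - 1" y]) auto
  then have "(1 - 1 / (16 * real k)) * (real (k - 1) * m) \<le> sum z Y"
    using m0 k1 by (simp add: y_def pos_le_divide_eq)
  moreover have "(real k - 1) * m - m / 16 \<le> (1 - 1 / (16 * real k)) * (real (k - 1) * m)"
  proof -
    have "(real k - 1) / (16 * real k) \<le> 1 / 16" using k1 by (simp add: field_simps)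
    then have "(real k - 1) / (16 * real k) * m \<le> 1 / 16 * m" using m0 by (intro mult_right_mono) auto
    moreover have "(1 - 1 / (16 * real k)) * (a * m) = a * m - a / (16 * real k) * m" for a
      by (simp add: left_diff_distrib)
    ultimately show ?thesis unfolding k1(1) by simp
  qed
  ultimately have Y: "(real k - 1) * m - m / 16 \<le> sum z Y" by linarith
  have "Y \<subseteq> {u\<in>A j. gp v u} \<union> (\<Union>i\<in>{..<k} - {j, col v}. A i)"
    by (auto simp: Y_def AA_def)
  then have "sum z Y \<le> sum z {u\<in>A j. gp v u} + sum z (\<Union>i\<in>{..<k} - {j, col v}. A i)"
    using finA by (intro order_trans[OF sum_mono_set sum_Un_le]) auto
  also have "sum z (\<Union>i\<in>{..<k} - {j, col v}. A i) \<le> real (card ({..<k} - {j, col v})) * (m + e)"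
    by (rule sum_UN_le) (use finA A_upper in auto)
  also have "card ({..<k} - {j, col v}) = k - 2" using j col(1)[OF vV] by (simp add: card_Diff_subset)
  finally have "sum z Y \<le> sum z {u\<in>A j. gp v u} + (real k - 2) * (m + e)" using k2 by (simp add: of_nat_diff)
  then show ?thesis using Y e by (simp add: algebra_simps)
qed

text \<open>Two vertices of the same colour each see about 15/16 of every other class, so by
  inclusion-exclusion they share well over half of it, and \<open>no_edge\<close> applies.\<close>

lemma U_edge:
  assumes "u \<in> U" "v \<in> U" "u \<noteq> v" "ed \<in> edges H" "u \<in> ed" "v \<in> ed"
  shows "col u \<noteq> col v"
proof
  assume eq: "col u = col v"
  have i: "col u < k" using col(1) assms(1) WU by auto
  show False
  proof (rule no_edge[OF assms(3-6) i])
    fix j assume j: "j < k" "j \<noteq> col u"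
    let ?Nu = "{w\<in>A j. gp u w}" and ?Nv = "{w\<in>A j. gp v w}"
    have fin: "finite ?Nu" "finite ?Nv" using finA[of j] by auto
    have "sum z ?Nu + sum z ?Nv = sum z (?Nu \<union> ?Nv) + sum z (?Nu \<inter> ?Nv)"
      using fin by (simp add: sum_Un)
    moreover have "sum z (?Nu \<union> ?Nv) \<le> sum z (A j)" using finA by (intro sum_mono_set) auto
    moreover have "?Nu \<inter> ?Nv = {w\<in>A j. gp u w \<and> gp v w}" by auto
    ultimately have "sum z {w\<in>A j. gp u w \<and> gp v w} \<ge> 2 * (m - m / 16 - real k * e) - (m + e)"
      using U_nbrs[OF assms(1) j] U_nbrs[OF assms(2) j(1)] j(2) eq A_upper[OF j(1)] by auto
    moreover have "2 * (m - m / 16 - real k * e) - (m + e) > real k * (2 * real k + 2) * e + e"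
      using e_bounds by (simp add: algebra_simps)
    ultimately show "sum z {w\<in>A j. gp u w \<and> gp v w} > real k * (2 * real k + 2) * e + e" by linarith
  qed
qed

text \<open>A vertex of \<open>A j\<close> sees almost all of every other class, so only its own
  class can be the one it misses. This transfers the lower bounds for the \<open>A j\<close> to the
  colour classes.\<close>

lemma col_A:
  assumes "j < k" "v \<in> A j"
  shows "col v = j"
proof (rule ccontr)
  assume ne: "col v \<noteq> j"
  have vV: "v \<in> V" using assms AV by auto
  have i: "col v < k" using col(1)[OF vV] .
  have "sum z (A (col v)) - sum z ({w\<in>W. \<not> gp v w} - A j) \<le> sum z (A (col v) - ({w\<in>W. \<not> gp v w} - A j))"
    using finA finW by (intro sum_Diff_ge) auto
  also have "... \<le> sum z {u\<in>A (col v). gp v u}"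
    by (rule sum_mono_set) (use A_disj[OF i assms(1) ne] AW finA[of "col v"] in auto)
  finally have "m - (2 * real k + 1) * e - (2 * real k + 2) * e \<le> real k * (2 * real k + 2) * e"
    using A_lower[OF i] A_nonnbr[OF assms] col(2)[OF vV] by simp
  moreover have "m - (2 * real k + 1) * e - (2 * real k + 2) * e > real k * (2 * real k + 2) * e"
    using e_bounds by (simp add: algebra_simps)
  ultimately show False by simp
qed

text \<open>Colours exist on all of \<open>V\<close>, but outside \<open>U\<close> no link bound
  controls them; hence properness is claimed only for the trace of an edge on
  \<open>U\<close>.\<close>

lemma partition:
  "\<exists>c. c ` V \<subseteq> {..<k} \<and> (\<forall>ed\<in>edges H. inj_on c (ed \<inter> U)) \<and>
     (\<forall>j<k. m - (2 * real k + 1) * e \<le> sum z {v\<in>U. c v = j})"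
proof (intro exI[of _ col] conjI ballI allI impI)
  show "col ` V \<subseteq> {..<k}" using col(1) by auto
  show "inj_on col (ed \<inter> U)" if "ed \<in> edges H" for ed
    using U_edge that by (intro inj_onI) blast
  fix j assume j: "j < k"
  have "sum z (A j) \<le> sum z {v\<in>U. col v = j}"
    by (rule sum_mono_set) (use col_A[OF j] AW WU finU in auto)
  then show "m - (2 * real k + 1) * e \<le> sum z {v\<in>U. col v = j}" using A_lower[OF j] by simp
qed

end


section \<open>Near-extremal \<open>r\<close>-graphs\<close>

text \<open>The vector \<open>z\<close> is a maximizer of \<open>H\<close> rescaled so that its entries average about 1. The constants
  are chosen in the order \<open>\<delta>\<close>, \<open>\<epsilon>\<close>, \<open>\<eta>\<close>, \<open>n\<close>.\<close>

locale near_extremal =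
  fixes r k M :: nat and H :: "'a hypergraph" and z :: "'a \<Rightarrow> real" and p \<alpha> Z \<delta> \<epsilon> \<eta> C1 C2 n :: real
  assumes r: "r \<ge> 2" and kr: "k \<ge> r" and p: "p \<ge> real r" and H: "r_graph r H"
    and free: "free_of (expanded_clique r (Suc k)) H"
    and M: "Suc k + r * (Suc k)\<^sup>2 \<le> M"
    and n: "n = real (card (verts H))" "n > real k"
    and z0: "\<And>v. z v \<ge> 0" and zp: "(\<Sum>v\<in>verts H. z v powr p) = n"
    and max: "\<And>y. (\<And>v. y v \<ge> 0) \<Longrightarrow>
      poly_form r H y \<le> poly_form r H z * ((\<Sum>v\<in>verts H. y v powr p) / n) powr (real r / p)"
    and maxT: "\<And>y (c :: 'a \<Rightarrow> nat). (\<And>v. y v \<ge> 0) \<Longrightarrow> c ` verts H \<subseteq> {..<k} \<Longrightarrow>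
      poly_form r (complete_partite r (verts H) c) y \<le>
        poly_form r H z * ((\<Sum>v\<in>verts H. y v powr p) / n) powr (real r / p)"
    and lower: "\<alpha> * (n - real k) ^ r \<le> poly_form r H z"
    and \<alpha>: "\<alpha> = fact r * real (k choose r) / real k ^ r"
    and Z: "Z = Max {1, 2 / \<alpha>}"
    and C1: "C1 = fact r * real M * Z ^ r / \<alpha>" and C2: "C2 = real k * real r + C1"
    and \<delta>: "0 < \<delta>" "\<delta> < 1" "(p - 1) * \<delta> \<le> 1 / (64 * real k)"
    and \<epsilon>: "0 < \<epsilon>" "32 * real k ^ 3 * \<epsilon> \<le> 1"
      "real (r - 1) * (real k * (2 * real k + 2) + real k + 2) * \<epsilon> / \<alpha> \<le> 1 / (64 * real k)"
      "real (r - 1) * ((2 * real k + 1) * real k * \<epsilon>) \<le> \<delta> / 4"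
    and \<eta>: "0 < \<eta>" "\<eta> \<le> \<delta>" "(p - 1) * \<eta> + fact (r - 1) * \<eta> * Z ^ (r - 1) / \<alpha> \<le> \<epsilon> / 2"
    and n_large: "real k * real r \<le> n / 2" "real k * real r \<le> \<epsilon> / 2 * n" "real k * real r \<le> n / (64 * real k)"
      "fact (r - 1) * real M * Z ^ (r - 1) / \<alpha> \<le> n / (64 * real k)" "real r * Z \<le> \<epsilon> * n"
      "C2 + Z * (2 * C2 / \<eta>\<^sup>2 + real r * real M / \<eta>) \<le> \<epsilon> * n" "C1 \<le> \<delta> / 8 * n"
begin

abbreviation "V \<equiv> verts H"
abbreviation "gp \<equiv> good_pair M (edges H)"
abbreviation "\<Lambda> \<equiv> poly_form r H z"
abbreviation "D \<equiv> link_form r H z"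
definition "\<kappa> = real k * real r / n"

lemma finV: "finite V" using H by (simp add: r_graph_def)
lemma fE: "finite (edges H)" using H by (rule finite_edges)
lemma ed: "ed \<in> edges H \<Longrightarrow> ed \<subseteq> V \<and> card ed = r \<and> finite ed"
  using H finite_subset[OF _ finV] by (auto simp: r_graph_def)
lemma k2: "k \<ge> 2" using r kr by simp
lemma p2: "p \<ge> 2" using p r by linarith
lemma n0: "n > 0" using n k2 by linarith
lemma Vne: "V \<noteq> {}" using n0 n by auto
lemma \<alpha>0: "\<alpha> > 0" using \<alpha> k2 kr by (simp add: zero_less_binomial)
lemma Z1: "Z \<ge> 1" "Z \<ge> 2 / \<alpha>" using Z by auto
lemma symp_gp: "symp gp" by (rule symp_good_pair)
lemma gp_free: "cliques gp V (Suc k) = {}" using good_pair_clique_free[OF r H free _ M] k2 by simp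

text \<open>Up to normalization, \<open>\<alpha> * n ^ r\<close> is the form of an exactly balanced
  partition at the all-ones vector; the identity shows that a vertex then has link
  \<open>\<alpha> * n ^ (r - 1)\<close>.\<close>

lemma \<alpha>_link: "fact (r - 1) * real ((k - 1) choose (r - 1)) = \<alpha> * real k ^ (r - 1)"
proof -
  have "r * (k choose r) = k * ((k - 1) choose (r - 1))" using r by (intro times_binomial_minus1_eq) simp
  then have "real r * real (k choose r) = real k * real ((k - 1) choose (r - 1))" by (metis of_nat_mult)
  moreover have "fact r = real r * fact (r - 1)" using r fact_reduce[of r] by simp
  ultimately have "fact r * real (k choose r) = fact (r - 1) * (real k * real ((k - 1) choose (r - 1)))" by simp
  then have "\<alpha> * real k ^ r = fact (r - 1) * (real k * real ((k - 1) choose (r - 1)))" using k2 \<alpha> by simp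
  moreover have "real k ^ r = real k * real k ^ (r - 1)" using r by (simp add: power_eq_if)
  ultimately show ?thesis using k2 by simp
qed

lemma \<kappa>: "0 \<le> \<kappa>" "\<kappa> \<le> 1 / 2" "\<kappa> \<le> \<epsilon> / 2" "\<kappa> \<le> 1 / (64 * real k)"
  using n_large n0 k2 by (auto simp: \<kappa>_def field_simps)

lemma \<Lambda>_lower: "\<alpha> * n ^ r * (1 - \<kappa>) \<le> \<Lambda>"
proof -
  have "1 + real r * (- (real k / n)) \<le> (1 + - (real k / n)) ^ r"
    by (rule Bernoulli_inequality) (use n0 n in \<open>simp add: field_simps\<close>)
  then have "1 - \<kappa> \<le> (1 - real k / n) ^ r" by (simp add: \<kappa>_def mult.commute)
  then have "\<alpha> * n ^ r * (1 - \<kappa>) \<le> \<alpha> * n ^ r * (1 - real k / n) ^ r"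
    using \<alpha>0 n0 by (intro mult_left_mono) auto
  also have "... = \<alpha> * (n * (1 - real k / n)) ^ r" by (simp add: power_mult_distrib)
  also have "n * (1 - real k / n) = n - real k" using n0 by (simp add: field_simps)
  finally show ?thesis using lower by simp
qed

lemma \<Lambda>0: "\<Lambda> > 0"
proof -
  have "\<alpha> * n ^ r * (1 - \<kappa>) > 0" using \<alpha>0 n0 \<kappa> by (intro mult_pos_pos) auto
  then show ?thesis using \<Lambda>_lower by linarith
qed

lemma sum_z_le: "sum z V \<le> n"
  using power_mean[OF finV Vne, of p z] p2 z0 n0 unfolding zp n(1)[symmetric] by simp

lemma eigen: "v \<in> V \<Longrightarrow> z v > 0 \<Longrightarrow> D v = \<Lambda> / n * z v powr (p - 1)"
  using eigenvector_equation[OF H _ p _ z0 zp n0 max] r p2 \<Lambda>0 by simp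

lemma D_upper: "D v \<le> n ^ (r - 1)"
proof -
  let ?G = "\<lambda>(_::'a) (_::'a). True"
  have "(\<Sum>e\<in>{e\<in>edges H. v \<in> e}. \<Prod>u\<in>e - {v}. z u) \<le> clique_weight ?G V z (r - 1)"
  proof (rule link_sum_le_clique_weight[OF finV z0])
    fix e assume "e \<in> {e\<in>edges H. v \<in> e}"
    then show "v \<in> e \<and> e - {v} \<in> cliques ?G V (r - 1)" using ed[of e] by (auto simp: cliques_def pairwise_def)
  qed
  then have "D v \<le> fact (r - 1) * clique_weight ?G V z (r - 1)"
    unfolding link_form_def by (rule mult_left_mono) simp
  also have "... \<le> sum z V ^ (r - 1)"
    by (rule fact_clique_weight_le[OF finV _ z0]) (simp add: symp_def)
  also have "... \<le> n ^ (r - 1)" by (intro power_mono sum_z_le sum_nonneg z0)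
  finally show ?thesis .
qed

lemma nr: "n ^ r = n * n ^ (r - 1)" using r by (simp add: power_eq_if)

text \<open>For an entry above 1 the eigenvector equation compares a link of at most
  \<open>n ^ (r - 1)\<close> with at least
  \<open>\<alpha> / 2 * n ^ (r - 1) * z v powr (p - 1)\<close>. As \<open>p - 1 \<ge> 1\<close>,
  this bounds the entry by \<open>2 / \<alpha>\<close>, which is the origin of
  \<open>Z\<close>.\<close>

lemma z_le: "v \<in> V \<Longrightarrow> z v \<le> Z"
proof (cases "z v \<le> 1")
  case True
  then show ?thesis using Z1 by linarith
next
  case False
  assume v: "v \<in> V"
  have "\<alpha> / 2 * n ^ r \<le> \<alpha> * n ^ r * (1 - \<kappa>)"
  proof -
    have "\<alpha> * n ^ r * (1 / 2) \<le> \<alpha> * n ^ r * (1 - \<kappa>)"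
      using \<alpha>0 n0 \<kappa>(2) by (intro mult_left_mono) auto
    then show ?thesis by simp
  qed
  then have "\<alpha> / 2 * n ^ (r - 1) \<le> \<Lambda> / n" using \<Lambda>_lower n0 unfolding nr by (simp add: pos_le_divide_eq mult_ac)
  then have "\<alpha> / 2 * n ^ (r - 1) * z v powr (p - 1) \<le> \<Lambda> / n * z v powr (p - 1)" by (rule mult_right_mono) simp
  also have "... = D v" using eigen[OF v] False by simp
  also have "... \<le> n ^ (r - 1)" by (rule D_upper)
  finally have "n ^ (r - 1) * (\<alpha> / 2 * z v powr (p - 1)) \<le> n ^ (r - 1) * 1" by (simp add: mult_ac)
  then have "\<alpha> / 2 * z v powr (p - 1) \<le> 1" using n0 by simp
  then have "z v powr (p - 1) \<le> 2 / \<alpha>" using \<alpha>0 by (simp add: field_simps)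
  moreover have "z v powr 1 \<le> z v powr (p - 1)" using False p2 by (intro powr_mono) auto
  ultimately show ?thesis using Z1 z0[of v] by simp
qed

lemma prod_le_Z: "B \<subseteq> V \<Longrightarrow> (\<Prod>u\<in>B. z u) \<le> Z ^ card B"
proof -
  assume "B \<subseteq> V"
  then have "(\<Prod>u\<in>B. z u) \<le> (\<Prod>u\<in>B. Z)" using z0 z_le by (intro prod_mono) auto
  then show ?thesis by simp
qed

lemma card_bad: "real (card (bad_edges M H)) \<le> real M * n ^ (r - 1)"
proof -
  have "real (card (bad_edges M H) * card V) \<le> real (M * card V ^ r)"
    using card_bad_edges[OF H Vne] by (rule of_nat_mono)
  then have "n * real (card (bad_edges M H)) \<le> n * (real M * n ^ (r - 1))"
    by (simp add: n(1)[symmetric] nr mult_ac)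
  then show ?thesis using n0 by simp
qed

text \<open>Edges without bad pairs are cliques of good pairs and obey the Moon-Moser bound. Each
  bad edge contributes at most \<open>Z ^ r\<close>, and \<open>C1\<close> collects this error
  relative to \<open>\<alpha>\<close>.\<close>

lemma \<Lambda>_upper: "\<Lambda> \<le> \<alpha> * (sum z V ^ r + C1 * n ^ (r - 1))"
proof -
  let ?B = "bad_edges M H"
  have B: "?B \<subseteq> edges H" by (auto simp: bad_edges_def)
  have "(\<Sum>e\<in>edges H. \<Prod>v\<in>e. z v) = (\<Sum>e\<in>edges H - ?B. \<Prod>v\<in>e. z v) + (\<Sum>e\<in>?B. \<Prod>v\<in>e. z v)"
    by (rule sum.subset_diff[OF B fE])
  moreover have "(\<Sum>e\<in>?B. \<Prod>v\<in>e. z v) \<le> real (card ?B) * Z ^ r"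
  proof -
    have "(\<Sum>e\<in>?B. \<Prod>v\<in>e. z v) \<le> (\<Sum>e\<in>?B. Z ^ r)"
    proof (rule sum_mono)
      fix e assume "e \<in> ?B"
      then show "(\<Prod>v\<in>e. z v) \<le> Z ^ r" using B prod_le_Z[of e] ed[of e] by auto
    qed
    then show ?thesis by simp
  qed
  moreover have "real (card ?B) * Z ^ r \<le> real M * n ^ (r - 1) * Z ^ r"
    using Z1 by (intro mult_right_mono card_bad) auto
  moreover have "(\<Sum>e\<in>edges H - ?B. \<Prod>v\<in>e. z v) \<le> clique_weight gp V z r"
    unfolding clique_weight_def
  proof (rule sum_mono2)
    show "finite (cliques gp V r)" using finV by (rule finite_cliques)
    show "edges H - ?B \<subseteq> cliques gp V r" using ed by (auto simp: bad_edges_def cliques_def)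
  qed (use z0 in \<open>auto intro: prod_nonneg\<close>)
  moreover have "clique_weight gp V z r \<le> real (k choose r) * (sum z V / real k) ^ r"
    by (rule clique_weight_bound[OF finV symp_gp z0 gp_free]) (use k2 kr in auto)
  ultimately have "(\<Sum>e\<in>edges H. \<Prod>v\<in>e. z v) \<le>
      real (k choose r) * (sum z V / real k) ^ r + real M * n ^ (r - 1) * Z ^ r" by linarith
  then have "\<Lambda> \<le> fact r * (real (k choose r) * (sum z V / real k) ^ r + real M * n ^ (r - 1) * Z ^ r)"
    unfolding poly_form_def by (rule mult_left_mono) simp
  also have "... = \<alpha> * sum z V ^ r + \<alpha> * C1 * n ^ (r - 1)"
  proof -
    have "\<alpha> * C1 = fact r * real M * Z ^ r" using \<alpha>0 C1 by simp
    moreover have "fact r * (real (k choose r) * (sum z V / real k) ^ r) = \<alpha> * sum z V ^ r"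
      by (simp add: \<alpha> power_divide)
    ultimately show ?thesis by (simp add: distrib_left mult_ac)
  qed
  finally show ?thesis by (simp add: distrib_left mult.assoc)
qed

lemma C1_0: "C1 \<ge> 0" using C1 \<alpha>0 Z1 by simp

lemma \<Lambda>_upper': "\<Lambda> / n \<le> \<alpha> * n ^ (r - 1) * (1 + \<delta> / 8)"
proof -
  have "\<Lambda> \<le> \<alpha> * (n ^ r + (\<delta> / 8 * n) * n ^ (r - 1))"
    using \<alpha>0 n0 n_large(7)
    by (intro order_trans[OF \<Lambda>_upper] mult_left_mono add_mono power_mono sum_z_le sum_nonneg z0 mult_right_mono) auto
  also have "... = n * (\<alpha> * n ^ (r - 1) * (1 + \<delta> / 8))" unfolding nr by (simp add: algebra_simps)
  finally show ?thesis using n0 by (simp add: pos_divide_le_eq mult.commute)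
qed

text \<open>Lower and upper bound on \<open>\<Lambda>\<close> differ by a relative error of order
  \<open>1 / n\<close>. Hence the deficit of the sum is bounded by a constant: \<open>k * r\<close>
  from the size of the Turan parts and \<open>C1\<close> from the bad edges.\<close>

lemma sum_z_ge: "sum z V \<ge> n - C2"
proof -
  define y where "y = sum z V / n"
  have y: "0 \<le> y" "y \<le> 1" using n0 sum_z_le by (auto simp: y_def sum_nonneg z0)
  have sy: "sum z V = n * y" using n0 by (simp add: y_def)
  have "\<alpha> * n ^ r * (1 - \<kappa>) \<le> \<alpha> * ((n * y) ^ r + C1 * n ^ (r - 1))"
    using \<Lambda>_lower \<Lambda>_upper unfolding sy by linarith
  also have "... = \<alpha> * n ^ r * (y ^ r + C1 / n)"
    using n0 by (simp add: power_mult_distrib nr field_simps)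
  finally have "1 - \<kappa> \<le> y ^ r + C1 / n" using \<alpha>0 n0 by (simp add: mult_le_cancel_left_pos)
  moreover have "y ^ r \<le> y ^ 1" using y r by (intro power_decreasing) auto
  ultimately have "1 - \<kappa> - C1 / n \<le> y" by simp
  then have "n * (1 - \<kappa> - C1 / n) \<le> n * y" using n0 by simp
  moreover have "n * (1 - \<kappa> - C1 / n) = n - C2" using n0 by (simp add: \<kappa>_def C2 field_simps)
  ultimately show ?thesis using sy by simp
qed

text \<open>Summing the quadratic Bernoulli inequality over \<open>V\<close>, where the p-th powers
  total exactly \<open>n\<close>, leaves the deficit \<open>n - sum z V\<close> as the bound for the
  quadratic part.\<close>

lemma sum_dev: "(\<Sum>v\<in>V. (z v - 1)\<^sup>2) \<le> 2 * C2"
proof -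
  have "(\<Sum>v\<in>V. 1 + p * (z v - 1) + p / 2 * (z v - 1)\<^sup>2) \<le> (\<Sum>v\<in>V. z v powr p)"
    by (intro sum_mono powr_ge_quadratic p2 z0)
  also have "(\<Sum>v\<in>V. 1 + p * (z v - 1) + p / 2 * (z v - 1)\<^sup>2) =
      n + p * (sum z V - n) + p / 2 * (\<Sum>v\<in>V. (z v - 1)\<^sup>2)"
  proof -
    have "(\<Sum>v\<in>V. 1 + p * (z v - 1) + p / 2 * (z v - 1)\<^sup>2) =
        (\<Sum>v\<in>V. 1) + p * (\<Sum>v\<in>V. z v - 1) + p / 2 * (\<Sum>v\<in>V. (z v - 1)\<^sup>2)"
      by (simp only: sum.distrib sum_distrib_left)
    then show ?thesis by (simp add: sum_subtractf n(1))
  qed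
  finally have "p / 2 * (\<Sum>v\<in>V. (z v - 1)\<^sup>2) \<le> p / 2 * (2 * (n - sum z V))"
    unfolding zp by (simp add: algebra_simps)
  then have "(\<Sum>v\<in>V. (z v - 1)\<^sup>2) \<le> 2 * (n - sum z V)" using p2 by simp
  then show ?thesis using sum_z_ge by simp
qed

text \<open>Unlike \<open>bad_link\<close>, this also counts edges at \<open>v\<close> whose bad
  pair lies elsewhere, so it is small only for most vertices.\<close>

definition "bdeg v = real (card {e\<in>bad_edges M H. v \<in> e})"
definition "W = {v\<in>V. z v \<ge> 1 - \<eta> \<and> bdeg v \<le> \<eta> * n ^ (r - 1)}"
text \<open>Weight is the only criterion, so that every vertex outside is certain to have weight
  below \<open>1 - \<delta>\<close>.\<close>

definition "U = {v\<in>V. z v \<ge> 1 - \<delta>}"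

lemma WU: "W \<subseteq> U" "U \<subseteq> V" using \<eta> by (auto simp: W_def U_def)

text \<open>Chebyshev estimate from the bounded sum of squared deviations.\<close>

lemma card_low: "real (card {v\<in>V. z v < 1 - \<eta>}) \<le> 2 * C2 / \<eta>\<^sup>2"
proof -
  let ?L = "{v\<in>V. z v < 1 - \<eta>}"
  have "real (card ?L) * \<eta>\<^sup>2 = (\<Sum>v\<in>?L. \<eta>\<^sup>2)" by simp
  also have "... \<le> (\<Sum>v\<in>?L. (z v - 1)\<^sup>2)"
  proof (rule sum_mono)
    fix v assume "v \<in> ?L"
    then have "\<eta> \<le> 1 - z v" by simp
    then have "\<eta>\<^sup>2 \<le> (1 - z v)\<^sup>2" using \<eta> by (intro power_mono) auto
    then show "\<eta>\<^sup>2 \<le> (z v - 1)\<^sup>2" by (simp add: power2_commute)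
  qed
  also have "... \<le> (\<Sum>v\<in>V. (z v - 1)\<^sup>2)" using finV by (intro sum_mono2) auto
  also have "... \<le> 2 * C2" by (rule sum_dev)
  finally show ?thesis using \<eta> by (simp add: pos_le_divide_eq)
qed

text \<open>Markov estimate: the bad degrees sum to \<open>r\<close> times the number of bad
  edges.\<close>

lemma card_high_bdeg: "real (card {v\<in>V. bdeg v > \<eta> * n ^ (r - 1)}) \<le> real r * real M / \<eta>"
proof -
  let ?L = "{v\<in>V. bdeg v > \<eta> * n ^ (r - 1)}"
  let ?B = "bad_edges M H"
  have fB: "finite ?B" using fE by (simp add: bad_edges_def)
  have "real (card ?L) * (\<eta> * n ^ (r - 1)) = (\<Sum>v\<in>?L. \<eta> * n ^ (r - 1))" by simp
  also have "... \<le> (\<Sum>v\<in>?L. bdeg v)" by (rule sum_mono) auto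
  also have "... \<le> (\<Sum>v\<in>V. bdeg v)" using finV by (intro sum_mono2) (auto simp: bdeg_def)
  also have "... = (\<Sum>v\<in>V. \<Sum>e\<in>?B. if v \<in> e then 1 else 0)"
    by (rule sum.cong) (simp_all add: bdeg_def sum.inter_filter[OF fB, symmetric])
  also have "... = (\<Sum>e\<in>?B. \<Sum>v\<in>V. if v \<in> e then 1 else 0)" by (rule sum.swap)
  also have "... = (\<Sum>e\<in>?B. real r)"
  proof (rule sum.cong[OF refl])
    fix e assume "e \<in> ?B"
    then have e: "e \<subseteq> V" "card e = r" using ed by (auto simp: bad_edges_def)
    have "(\<Sum>v\<in>V. if v \<in> e then 1 else 0) = real (card {v\<in>V. v \<in> e})"
      by (simp add: sum.inter_filter[OF finV, symmetric])
    also have "{v\<in>V. v \<in> e} = e" using e by auto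
    finally show "(\<Sum>v\<in>V. if v \<in> e then 1 else 0) = real r" using e by simp
  qed
  also have "... = real r * real (card ?B)" by simp
  also have "... \<le> real r * (real M * n ^ (r - 1))" by (intro mult_left_mono card_bad) auto
  finally have "n ^ (r - 1) * (real (card ?L) * \<eta>) \<le> n ^ (r - 1) * (real r * real M)" by (simp add: mult_ac)
  then have "real (card ?L) * \<eta> \<le> real r * real M" using n0 by simp
  then show ?thesis using \<eta> by (simp add: pos_le_divide_eq)
qed

lemma sum_W: "sum z W \<ge> n - \<epsilon> * n"
proof -
  let ?L1 = "{v\<in>V. z v < 1 - \<eta>}" and ?L2 = "{v\<in>V. bdeg v > \<eta> * n ^ (r - 1)}"
  have WV: "W \<subseteq> V" using WU by blast
  have VW: "V - W = ?L1 \<union> ?L2" by (auto simp: W_def)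
  have "card (V - W) \<le> card ?L1 + card ?L2" unfolding VW by (rule card_Un_le)
  then have "real (card (V - W)) \<le> real (card ?L1 + card ?L2)" by (rule of_nat_mono)
  also have "... = real (card ?L1) + real (card ?L2)" by (rule of_nat_add)
  also have "... \<le> 2 * C2 / \<eta>\<^sup>2 + real r * real M / \<eta>" by (intro add_mono card_low card_high_bdeg)
  finally have cVW: "real (card (V - W)) \<le> 2 * C2 / \<eta>\<^sup>2 + real r * real M / \<eta>" .
  have "sum z (V - W) \<le> (\<Sum>v\<in>V - W. Z)" by (rule sum_mono) (use z_le in auto)
  also have "... = Z * real (card (V - W))" by simp
  also have "... \<le> Z * (2 * C2 / \<eta>\<^sup>2 + real r * real M / \<eta>)"
    using Z1(1) by (intro mult_left_mono[OF cVW]) simp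
  finally have "sum z (V - W) \<le> Z * (2 * C2 / \<eta>\<^sup>2 + real r * real M / \<eta>)" .
  moreover have "sum z (V - W) = sum z V - sum z W" using finV WV by (rule sum_diff)
  ultimately show ?thesis using sum_z_ge n_large(6) by linarith
qed

text \<open>The eigenvector equation converts weight close to 1 into a link close to
  \<open>\<alpha> * n ^ (r - 1)\<close>.\<close>

lemma D_lower:
  assumes v: "v \<in> V" "z v \<ge> 1 - t" and t: "0 < t" "t < 1"
  shows "\<alpha> * n ^ (r - 1) * (1 - \<kappa> - (p - 1) * t) \<le> D v"
proof -
  have "1 + (p - 1) * ((1 - t) - 1) \<le> (1 - t) powr (p - 1)"
    by (rule bernoulli_powr_ge) (use p2 t in auto)
  also have "... \<le> z v powr (p - 1)" using v t p2 by (intro powr_mono2) auto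
  finally have b: "1 - (p - 1) * t \<le> z v powr (p - 1)" by (simp add: algebra_simps)
  have c: "\<alpha> * n ^ (r - 1) * (1 - \<kappa>) \<le> \<Lambda> / n"
    using \<Lambda>_lower n0 unfolding nr by (simp add: pos_le_divide_eq mult_ac)
  have "(1 - \<kappa>) * (1 - s) = 1 - \<kappa> - s + \<kappa> * s" for s by (simp add: algebra_simps)
  moreover have "\<kappa> * ((p - 1) * t) \<ge> 0" using \<kappa> t p2 by simp
  ultimately have "1 - \<kappa> - (p - 1) * t \<le> (1 - \<kappa>) * (1 - (p - 1) * t)" by simp
  also have "... \<le> (1 - \<kappa>) * z v powr (p - 1)" using \<kappa> b by (intro mult_left_mono) auto
  finally have "\<alpha> * n ^ (r - 1) * (1 - \<kappa> - (p - 1) * t) \<le> \<alpha> * n ^ (r - 1) * ((1 - \<kappa>) * z v powr (p - 1))"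
    using \<alpha>0 n0 by (intro mult_left_mono) auto
  also have "... = (\<alpha> * n ^ (r - 1) * (1 - \<kappa>)) * z v powr (p - 1)" by simp
  also have "... \<le> \<Lambda> / n * z v powr (p - 1)" using c by (rule mult_right_mono) simp
  also have "... = D v" using eigen[OF v(1)] v(2) t by simp
  finally show ?thesis .
qed

lemma km: "n = real k * (n / real k)" using k2 by simp

text \<open>Few bad edges at \<open>v\<close> means that its link consists mostly of cliques inside
  its good neighbourhood \<open>N\<close>. As \<open>N\<close> contains no \<open>k\<close>-clique,
  the clique bound with \<open>k - 1\<close> in place of \<open>k\<close> shows that a nearly full
  link forces \<open>N\<close> to have almost the weight \<open>(k - 1) * n / k\<close>.\<close>

lemma W_nonnbr:
  assumes v: "v \<in> W"
  shows "sum z {u\<in>W. \<not> gp v u} \<le> n / real k + \<epsilon> * n"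
proof -
  define N where "N = {u\<in>V. gp v u}"
  define E1 where "E1 = {e\<in>bad_edges M H. v \<in> e}"
  define E2 where "E2 = {e\<in>edges H - bad_edges M H. v \<in> e}"
  define y where "y = sum z N / (real (k - 1) * (n / real k))"
  let ?w = "\<lambda>e. \<Prod>u\<in>e - {v}. z u"
  have vV: "v \<in> V" and vW: "z v \<ge> 1 - \<eta>" "bdeg v \<le> \<eta> * n ^ (r - 1)" using v by (auto simp: W_def)
  have finN: "finite N" using finV by (simp add: N_def)
  have k1: "real (k - 1) = real k - 1" "real k - 1 \<ge> 1" using k2 by auto
  have mpos: "n / real k > 0" using n0 k2 by simp
  have "sum ?w E1 \<le> (\<Sum>e\<in>E1. Z ^ (r - 1))"
  proof (rule sum_mono)
    fix e assume "e \<in> E1"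
    then have e: "e \<in> edges H" "v \<in> e" by (auto simp: E1_def bad_edges_def)
    then show "?w e \<le> Z ^ (r - 1)" using prod_le_Z[of "e - {v}"] ed[OF e(1)] by auto
  qed
  also have "... = bdeg v * Z ^ (r - 1)" by (simp add: E1_def bdeg_def)
  also have "... \<le> \<eta> * n ^ (r - 1) * Z ^ (r - 1)" using vW(2) Z1 by (intro mult_right_mono) auto
  finally have b1: "sum ?w E1 \<le> \<eta> * n ^ (r - 1) * Z ^ (r - 1)" .
  have freeN: "cliques gp N (Suc (k - 1)) = {}"
  proof (rule ccontr)
    assume "\<not> ?thesis"
    then obtain B where B: "B \<in> cliques gp N (Suc (k - 1))" by blast
    then have B': "B \<in> cliques gp V k" using k2 by (auto simp: cliques_def N_def)
    have "gp v u" if "u \<in> B" for u using B that by (auto simp: cliques_def N_def)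
    then have "\<forall>u\<in>B. gp u v" using sympD[OF symp_gp] by blast
    moreover from this have "v \<notin> B" by (auto simp: good_pair_def)
    ultimately have "v \<in> common_nbrs gp V B" using vV by (simp add: common_nbrs_def)
    then have "insert v B \<in> cliques gp V (Suc k)" by (rule clique_in_common_nbrs[OF finV symp_gp B'])
    then show False using gp_free by simp
  qed
  have "sum ?w E2 \<le> clique_weight gp N z (r - 1)"
  proof (rule link_sum_le_clique_weight[OF finN z0])
    fix e assume "e \<in> E2"
    then have e: "e \<in> edges H" "v \<in> e" "pairwise gp e" by (auto simp: E2_def bad_edges_def)
    have "e - {v} \<subseteq> N" using e ed[OF e(1)] by (auto simp: N_def pairwise_def)
    moreover have "pairwise gp (e - {v})" using e(3) by (rule pairwise_subset) auto
    moreover have "card (e - {v}) = r - 1" using e ed[OF e(1)] by simp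
    ultimately show "v \<in> e \<and> e - {v} \<in> cliques gp N (r - 1)" using e by (simp add: cliques_def)
  qed
  also have "... \<le> real ((k - 1) choose (r - 1)) * (sum z N / real (k - 1)) ^ (r - 1)"
    by (rule clique_weight_bound[OF finN symp_gp z0 freeN]) (use k2 kr in auto)
  finally have b2: "sum ?w E2 \<le> real ((k - 1) choose (r - 1)) * (sum z N / real (k - 1)) ^ (r - 1)" .
  have "{e\<in>edges H. v \<in> e} = E1 \<union> E2" "E1 \<inter> E2 = {}" "finite E1" "finite E2"
    using fE by (auto simp: E1_def E2_def bad_edges_def)
  then have "D v = fact (r - 1) * sum ?w E1 + fact (r - 1) * sum ?w E2"
    unfolding link_form_def by (simp add: sum.union_disjoint distrib_left)
  also have "... \<le> fact (r - 1) * (\<eta> * n ^ (r - 1) * Z ^ (r - 1)) +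
      fact (r - 1) * (real ((k - 1) choose (r - 1)) * (sum z N / real (k - 1)) ^ (r - 1))"
    by (intro add_mono mult_left_mono b1 b2) auto
  also have "fact (r - 1) * (real ((k - 1) choose (r - 1)) * (sum z N / real (k - 1)) ^ (r - 1)) =
      \<alpha> * n ^ (r - 1) * y ^ (r - 1)"
  proof -
    have "sum z N / real (k - 1) = n / real k * y" using n0 k2 by (simp add: y_def)
    then have "fact (r - 1) * (real ((k - 1) choose (r - 1)) * (sum z N / real (k - 1)) ^ (r - 1)) =
        \<alpha> * real k ^ (r - 1) * (n / real k * y) ^ (r - 1)"
      by (simp only: mult.assoc[symmetric] \<alpha>_link)
    also have "... = \<alpha> * (real k * (n / real k) * y) ^ (r - 1)" by (simp add: power_mult_distrib power_divide)
    also have "... = \<alpha> * n ^ (r - 1) * y ^ (r - 1)" using k2 by (simp add: power_mult_distrib)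
    finally show ?thesis .
  qed
  also have "fact (r - 1) * (\<eta> * n ^ (r - 1) * Z ^ (r - 1)) =
      \<alpha> * n ^ (r - 1) * (fact (r - 1) * \<eta> * Z ^ (r - 1) / \<alpha>)" using \<alpha>0 by simp
  finally have "D v \<le> \<alpha> * n ^ (r - 1) * (fact (r - 1) * \<eta> * Z ^ (r - 1) / \<alpha> + y ^ (r - 1))"
    by (simp add: distrib_left)
  moreover have "\<alpha> * n ^ (r - 1) * (1 - \<kappa> - (p - 1) * \<eta>) \<le> D v"
    using \<eta> \<delta> by (intro D_lower vV vW) auto
  ultimately have "\<alpha> * n ^ (r - 1) * (1 - \<kappa> - (p - 1) * \<eta>) \<le>
      \<alpha> * n ^ (r - 1) * (fact (r - 1) * \<eta> * Z ^ (r - 1) / \<alpha> + y ^ (r - 1))" by linarith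
  then have "1 - \<kappa> - (p - 1) * \<eta> \<le> fact (r - 1) * \<eta> * Z ^ (r - 1) / \<alpha> + y ^ (r - 1)"
    using \<alpha>0 n0 by (simp only: mult_le_cancel_left_pos mult_pos_pos zero_less_power)
  then have yr: "1 - \<epsilon> \<le> y ^ (r - 1)" using \<kappa>(3) \<eta>(3) by linarith
  have y0: "y \<ge> 0" using n0 by (simp add: y_def sum_nonneg z0)
  have "1 - \<epsilon> \<le> y" using yr y0 r \<epsilon>(1) by (intro le_base_of_le_power[of "r - 1" y]) auto
  moreover have "real (k - 1) * (n / real k) > 0" using mpos k1 by (intro mult_pos_pos) auto
  ultimately have N: "(1 - \<epsilon>) * ((real k - 1) * (n / real k)) \<le> sum z N"
    unfolding y_def k1(1)[symmetric] by (simp only: pos_le_divide_eq)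
  have "sum z {u\<in>W. \<not> gp v u} \<le> sum z (V - N)"
    by (rule sum_mono2) (use finV WU z0 in \<open>auto simp: N_def\<close>)
  also have "... = sum z V - sum z N" by (rule sum_diff) (use finV in \<open>auto simp: N_def\<close>)
  also have "... \<le> n - (1 - \<epsilon>) * ((real k - 1) * (n / real k))" using N sum_z_le by linarith
  also have "... = n / real k + \<epsilon> * (n - n / real k)" using k2 by (simp add: field_simps)
  also have "... \<le> n / real k + \<epsilon> * n" using \<epsilon>(1) mpos by (intro add_left_mono mult_left_mono) auto
  finally show ?thesis .
qed

text \<open>The two error terms have order \<open>n ^ (r - 2)\<close> and
  \<open>\<epsilon> * n ^ (r - 1)\<close>, so a slack of relative size \<open>1 / (16 * k)\<close>
  in the main term absorbs them together with the losses of \<open>D_lower\<close>.\<close>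

lemma U_link:
  assumes v: "v \<in> U"
  shows "link_form r H z v \<ge>
       fact (r - 1) * real ((k - 1) choose (r - 1)) * (n / real k) ^ (r - 1) * (1 - 1 / (16 * real k)) +
       fact (r - 1) * real (card (bad_link M H v)) * Z ^ (r - 1) +
       real (r - 1) * ((real k * (2 * real k + 2) + real k + 2) * (\<epsilon> * n)) * (real k * (n / real k)) ^ (r - 2)"
proof -
  have vV: "v \<in> V" "z v \<ge> 1 - \<delta>" using v by (auto simp: U_def)
  have n1: "n ^ (r - 1) = n * n ^ (r - 2)" using r by (simp add: power_eq_if numeral_2_eq_2)
  have a: "fact (r - 1) * real ((k - 1) choose (r - 1)) * (n / real k) ^ (r - 1) = \<alpha> * n ^ (r - 1)"
    unfolding \<alpha>_link using k2 by (simp add: power_divide)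
  define t1 where "t1 = fact (r - 1) * real M * Z ^ (r - 1) / \<alpha> / n"
  define t2 where "t2 = real (r - 1) * (real k * (2 * real k + 2) + real k + 2) * \<epsilon> / \<alpha>"
  have "t1 \<le> n / (64 * real k) / n"
    unfolding t1_def using n_large(4) n0 by (intro divide_right_mono) auto
  then have t1: "t1 \<le> 1 / (64 * real k)" using n0 by simp
  have t2: "t2 \<le> 1 / (64 * real k)" using \<epsilon>(3) by (simp add: t2_def)
  have "real (card (bad_link M H v) * card V ^ 2) \<le> real (M * card V ^ r)"
    using card_bad_link[OF H vV(1)] by (rule of_nat_mono)
  then have "(n * n) * real (card (bad_link M H v)) \<le> (n * n) * (real M * n ^ (r - 2))"
    unfolding of_nat_mult of_nat_power n(1)[symmetric] nr n1 by (simp add: power2_eq_square mult_ac)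
  then have "real (card (bad_link M H v)) \<le> real M * n ^ (r - 2)" using n0 by simp
  then have "fact (r - 1) * real (card (bad_link M H v)) * Z ^ (r - 1) \<le> fact (r - 1) * (real M * n ^ (r - 2)) * Z ^ (r - 1)"
    using Z1 by (intro mult_right_mono mult_left_mono) auto
  also have "... = \<alpha> * n ^ (r - 1) * t1" unfolding n1 t1_def using \<alpha>0 n0 by simp
  finally have b: "fact (r - 1) * real (card (bad_link M H v)) * Z ^ (r - 1) \<le> \<alpha> * n ^ (r - 1) * t1" .
  have c: "real (r - 1) * ((real k * (2 * real k + 2) + real k + 2) * (\<epsilon> * n)) * (real k * (n / real k)) ^ (r - 2) =
      \<alpha> * n ^ (r - 1) * t2"
    unfolding km[symmetric] n1 t2_def using \<alpha>0 by simp
  have "\<alpha> * n ^ (r - 1) * (1 - 1 / (16 * real k)) + \<alpha> * n ^ (r - 1) * t1 + \<alpha> * n ^ (r - 1) * t2 =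
      \<alpha> * n ^ (r - 1) * (1 - 1 / (16 * real k) + t1 + t2)" by (simp add: distrib_left)
  also have "... \<le> \<alpha> * n ^ (r - 1) * (1 - \<kappa> - (p - 1) * \<delta>)"
  proof (intro mult_left_mono)
    \<comment> \<open>The slack is split evenly between \<open>t1\<close>, \<open>t2\<close>,
      \<open>\<kappa>\<close> and \<open>(p - 1) * \<delta>\<close>.\<close>
    have "1 / (16 * real k) = 4 * (1 / (64 * real k))" by simp
    then show "1 - 1 / (16 * real k) + t1 + t2 \<le> 1 - \<kappa> - (p - 1) * \<delta>"
      using t1 t2 \<kappa>(4) \<delta>(3) by linarith
  qed (use \<alpha>0 n0 in auto)
  also have "... \<le> D v" using \<delta> by (intro D_lower vV) auto
  finally show ?thesis using b unfolding a c by linarith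
qed

lemma dense: "dense_good_graph r k M H z W U Z (\<epsilon> * n) (n / real k)"
proof
  show "real (card V) = real k * (n / real k)" using km n(1) by simp
  show "sum z V \<le> real k * (n / real k)" using sum_z_le km by simp
  show "real k * (n / real k) - \<epsilon> * n \<le> sum z W" using sum_W km by simp
  show "0 < \<epsilon> * n" using \<epsilon>(1) n0 by simp
  show "32 * (real k)\<^sup>2 * (\<epsilon> * n) \<le> n / real k"
  proof -
    have "32 * real k ^ 3 * \<epsilon> * n \<le> 1 * n" using \<epsilon>(2) n0 by (intro mult_right_mono) auto
    then show ?thesis using k2 by (simp add: pos_le_divide_eq power2_eq_square power3_eq_cube mult_ac)
  qed
qed (use r kr H free M z0 z_le WU W_nonnbr n_large(5) U_link in auto)

text \<open>Let \<open>q\<close> be the p-th power sum of \<open>l\<close> light vertices. By the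
  eigenvector equation they contribute at most \<open>r * \<Lambda> / n * q\<close>, and by
  concavity giving them weight 1 costs at most \<open>r * \<Lambda> / n * (l - q) / p\<close>. As
  \<open>q \<le> l * (1 - \<delta>)\<close> and \<open>p \<ge> 2\<close>, both together are at most
  \<open>1 - \<delta> / 2\<close> times \<open>r * l * \<Lambda> / n\<close>, which is less than
  \<open>r * l\<close> links of nearly full size.\<close>

lemma U_eq_V_and_partition:
  "U = V \<and> (\<exists>c :: 'a \<Rightarrow> nat. c ` V \<subseteq> {..<k} \<and> (\<forall>e\<in>edges H. inj_on c e))"
proof -
  define a where "a = n / real k - (2 * real k + 1) * (\<epsilon> * n)"
  obtain c :: "'a \<Rightarrow> nat" where c: "c ` V \<subseteq> {..<k}" "\<And>e. e \<in> edges H \<Longrightarrow> inj_on c (e \<inter> U)"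
    "\<And>j. j < k \<Longrightarrow> a \<le> sum z {v\<in>U. c v = j}"
    using dense_good_graph.partition[OF dense] unfolding a_def by blast
  define L where "L = V - U"
  define l where "l = real (card L)"
  have finL: "finite L" and finU: "finite U" using finV WU finite_subset by (auto simp: L_def)
  have LU: "V = U \<union> L" "U \<inter> L = {}" using WU by (auto simp: L_def)
  have "L = {}"
  proof (rule ccontr)
    assume "L \<noteq> {}"
    then have l: "l > 0" using finL by (simp add: l_def card_gt_0_iff)
    \<comment> \<open>Attach the light vertices \<open>L\<close> to part 0 with weight 1: each then gains a full link \<open>Dp\<close>,
      which outweighs its contribution in \<open>H\<close> and the increase of the \<open>p\<close>-norm.\<close>
    define c' where "c' v = (if v \<in> U then c v else 0)" for v
    define z' where "z' v = (if v \<in> U then z v else 1)" for v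
    define Y where "Y = {v\<in>U. c v \<noteq> 0}"
    define A0 where "A0 = {v\<in>U. c v = 0}"
    let ?G = "\<lambda>u v. c u \<noteq> c v" and ?G' = "\<lambda>u v. c' u \<noteq> c' v"
    define Dp where "Dp = fact (r - 1) * clique_weight ?G Y z (r - 1)"
    define q where "q = (\<Sum>v\<in>L. z v powr p)"
    have finY: "finite Y" using finU by (simp add: Y_def)
    have r1: "r = Suc (r - 1)" using r by simp
    have YV: "V - {v\<in>V. c' v = 0} = Y" "U - A0 = Y" using LU by (auto simp: c'_def Y_def A0_def)
    have CWY: "clique_weight ?G' Y z' s = clique_weight ?G Y z s" for s
      by (rule clique_weight_cong) (auto simp: c'_def z'_def Y_def)
    have sum0: "sum z' {v\<in>V. c' v = 0} = sum z A0 + l"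
    proof -
      have "{v\<in>V. c' v = 0} = A0 \<union> L" "A0 \<inter> L = {}" using LU by (auto simp: c'_def A0_def)
      moreover have "finite A0" using finU by (simp add: A0_def)
      ultimately have "sum z' {v\<in>V. c' v = 0} = sum z' A0 + sum z' L" using finL by (simp add: sum.union_disjoint)
      also have "sum z' A0 = sum z A0" by (rule sum.cong) (auto simp: z'_def A0_def)
      also have "sum z' L = (\<Sum>v\<in>L. 1)" by (rule sum.cong) (auto simp: z'_def L_def)
      finally show ?thesis by (simp add: l_def)
    qed
    have "clique_weight ?G' V z' r = clique_weight ?G Y z r + (sum z A0 + l) * clique_weight ?G Y z (r - 1)"
      using clique_weight_split_part[OF finV, of c' z' "r - 1" 0] unfolding r1[symmetric] YV CWY sum0 .
    moreover have "clique_weight ?G U z r = clique_weight ?G Y z r + sum z A0 * clique_weight ?G Y z (r - 1)"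
      using clique_weight_split_part[OF finU, of c z "r - 1" 0] unfolding r1[symmetric] A0_def[symmetric] YV .
    ultimately have CW': "clique_weight ?G' V z' r = clique_weight ?G U z r + l * clique_weight ?G Y z (r - 1)"
      by (simp add: distrib_right)
    have zD: "z v * D v = \<Lambda> / n * z v powr p" if "v \<in> V" for v
    proof (cases "z v = 0")
      case False
      then have "z v > 0" using z0[of v] by simp
      then have "z v powr p = z v * z v powr (p - 1)" by (simp add: powr_diff)
      then show ?thesis using eigen[OF that \<open>z v > 0\<close>] by simp
    qed simp
    \<comment> \<open>An edge leaving \<open>U\<close> is charged to every light vertex it contains;
      the overcount is harmless in an upper bound.\<close>
    have "(\<Sum>e\<in>{e\<in>edges H. \<not> e \<subseteq> U}. \<Prod>u\<in>e. z u) \<le> (\<Sum>v\<in>L. \<Sum>e\<in>{e\<in>edges H. v \<in> e}. \<Prod>u\<in>e. z u)"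
    proof -
      have pn: "(\<Prod>u\<in>e. z u) \<ge> 0" for e by (rule prod_nonneg) (use z0 in auto)
      have "(\<Sum>e\<in>{e\<in>edges H. \<not> e \<subseteq> U}. \<Prod>u\<in>e. z u) \<le>
          (\<Sum>e\<in>{e\<in>edges H. \<not> e \<subseteq> U}. \<Sum>v\<in>L. if v \<in> e then \<Prod>u\<in>e. z u else 0)"
      proof (rule sum_mono)
        fix e assume "e \<in> {e\<in>edges H. \<not> e \<subseteq> U}"
        then obtain v where v: "v \<in> e" "v \<in> L" using ed[of e] by (auto simp: L_def)
        have "(if v \<in> e then \<Prod>u\<in>e. z u else 0) \<le> (\<Sum>v\<in>L. if v \<in> e then \<Prod>u\<in>e. z u else 0)"
          by (rule member_le_sum[OF v(2)]) (use pn finL in auto)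
        then show "(\<Prod>u\<in>e. z u) \<le> (\<Sum>v\<in>L. if v \<in> e then \<Prod>u\<in>e. z u else 0)" using v by simp
      qed
      also have "... \<le> (\<Sum>e\<in>edges H. \<Sum>v\<in>L. if v \<in> e then \<Prod>u\<in>e. z u else 0)"
        by (rule sum_mono2) (use fE pn in \<open>auto intro!: sum_nonneg\<close>)
      also have "... = (\<Sum>v\<in>L. \<Sum>e\<in>edges H. if v \<in> e then \<Prod>u\<in>e. z u else 0)" by (rule sum.swap)
      also have "... = (\<Sum>v\<in>L. \<Sum>e\<in>{e\<in>edges H. v \<in> e}. \<Prod>u\<in>e. z u)"
        by (intro sum.cong refl sum.inter_filter[OF fE, symmetric])
      finally show ?thesis .
    qed
    then have "fact r * (\<Sum>e\<in>{e\<in>edges H. \<not> e \<subseteq> U}. \<Prod>u\<in>e. z u) \<le>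
        fact r * (\<Sum>v\<in>L. \<Sum>e\<in>{e\<in>edges H. v \<in> e}. \<Prod>u\<in>e. z u)" by (rule mult_left_mono) simp
    also have "... = (\<Sum>v\<in>L. real r * z v * D v)"
      unfolding sum_distrib_left[of "fact r" _ L] using r by (intro sum.cong refl sum_edges_at[OF H]) simp
    also have "... = (\<Sum>v\<in>L. real r * (\<Lambda> / n) * z v powr p)"
    proof (rule sum.cong[OF refl])
      fix v assume "v \<in> L"
      then have "z v * D v = \<Lambda> / n * z v powr p" by (intro zD) (simp add: L_def)
      then show "real r * z v * D v = real r * (\<Lambda> / n) * z v powr p" by (simp only: mult.assoc)
    qed
    also have "... = real r * (\<Lambda> / n) * q" unfolding q_def by (rule sum_distrib_left[symmetric])
    finally have lost: "fact r * (\<Sum>e\<in>{e\<in>edges H. \<not> e \<subseteq> U}. \<Prod>u\<in>e. z u) \<le> real r * (\<Lambda> / n) * q" .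
    have "(\<Sum>e\<in>edges H. \<Prod>u\<in>e. z u) = (\<Sum>e\<in>{e\<in>edges H. e \<subseteq> U}. \<Prod>u\<in>e. z u) +
        (\<Sum>e\<in>{e\<in>edges H. \<not> e \<subseteq> U}. \<Prod>u\<in>e. z u)"
      by (subst sum.union_disjoint[symmetric]) (use fE in \<open>auto intro!: sum.cong\<close>)
    moreover have "(\<Sum>e\<in>{e\<in>edges H. e \<subseteq> U}. \<Prod>u\<in>e. z u) \<le> clique_weight ?G U z r"
      unfolding clique_weight_def
    proof (rule sum_mono2)
      show "finite (cliques ?G U r)" using finU by (rule finite_cliques)
      show "{e\<in>edges H. e \<subseteq> U} \<subseteq> cliques ?G U r"
      proof
        fix e assume "e \<in> {e\<in>edges H. e \<subseteq> U}"
        then have e: "e \<in> edges H" "e \<subseteq> U" by auto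
        then have "inj_on c e" using c(2)[OF e(1)] by (simp add: Int_absorb2)
        then show "e \<in> cliques ?G U r" using e ed[OF e(1)] by (auto simp: cliques_def pairwise_def inj_on_def)
      qed
    qed (use z0 in \<open>auto intro: prod_nonneg\<close>)
    ultimately have "fact r * (\<Sum>e\<in>edges H. \<Prod>u\<in>e. z u) \<le>
        fact r * (clique_weight ?G U z r + (\<Sum>e\<in>{e\<in>edges H. \<not> e \<subseteq> U}. \<Prod>u\<in>e. z u))"
      by (intro mult_left_mono) auto
    then have kept: "\<Lambda> - real r * (\<Lambda> / n) * q \<le> fact r * clique_weight ?G U z r"
      using lost unfolding poly_form_def[symmetric] distrib_left by linarith
    have factr: "fact r = real r * fact (r - 1)" using r fact_reduce[of r] by simp
    have "\<Lambda> - real r * (\<Lambda> / n) * q + real r * (l * Dp) \<le> fact r * clique_weight ?G' V z' r"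
      unfolding CW' distrib_left Dp_def using kept factr by (simp add: mult_ac)
    also have "... = poly_form r (complete_partite r V c') z'" by (rule poly_form_complete_partite[OF finV, symmetric])
    \<comment> \<open>Here the assumption that \<open>H\<close> does at least as well as the Turan
      graph enters: it bounds the form of every \<open>k\<close>-coloured complete multipartite
      graph.\<close>
    also have "... \<le> \<Lambda> * ((\<Sum>v\<in>V. z' v powr p) / n) powr (real r / p)"
      by (rule maxT) (use z0 c(1) WU k2 in \<open>auto simp: z'_def c'_def\<close>)
    also have "(\<Sum>v\<in>V. z' v powr p) / n = 1 + (l - q) / n"
    proof -
      have "(\<Sum>v\<in>V. z' v powr p) = (\<Sum>v\<in>U. z' v powr p) + (\<Sum>v\<in>L. z' v powr p)"
        using LU finU finL by (metis sum.union_disjoint)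
      also have "(\<Sum>v\<in>L. z' v powr p) = (\<Sum>v\<in>L. 1)" by (rule sum.cong) (auto simp: z'_def L_def)
      also have "(\<Sum>v\<in>U. z' v powr p) = (\<Sum>v\<in>U. z v powr p)" by (rule sum.cong) (auto simp: z'_def)
      also have "... = n - q"
      proof -
        have "(\<Sum>v\<in>V. z v powr p) = (\<Sum>v\<in>U. z v powr p) + (\<Sum>v\<in>L. z v powr p)"
          using LU finU finL by (metis sum.union_disjoint)
        then show ?thesis using zp by (simp add: q_def)
      qed
      finally show ?thesis using n0 by (simp add: l_def field_simps)
    qed
    also have "\<Lambda> * (1 + (l - q) / n) powr (real r / p) \<le> \<Lambda> * (1 + real r / p * ((l - q) / n))"
    proof -
      have "q \<le> n" unfolding q_def zp[symmetric] using finV by (intro sum_mono2) (auto simp: L_def)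
      then have "(l - q) / n \<ge> -1" using l n0 by (simp add: field_simps)
      then show ?thesis using p p2 \<Lambda>0 by (intro mult_left_mono bernoulli_powr_le) auto
    qed
    finally have "real r * (l * Dp) \<le> real r * (\<Lambda> / n * (q + (l - q) / p))" by (simp add: algebra_simps)
    then have "l * Dp \<le> \<Lambda> / n * (q + (l - q) / p)" by (rule mult_left_le_imp_le) (use r in simp)
    have zlow: "z v powr p \<le> 1 - \<delta>" if "v \<in> L" for v
    proof -
      have zv: "z v < 1 - \<delta>" using that by (auto simp: L_def U_def)
      have "z v powr p \<le> z v powr 1" using z0[of v] zv \<delta> p2 by (intro powr_mono') auto
      then show ?thesis using zv z0[of v] by simp
    qed
    have "q \<le> (\<Sum>v\<in>L. 1 - \<delta>)" unfolding q_def by (rule sum_mono) (rule zlow)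
    then have q: "q \<le> l * (1 - \<delta>)" by (simp add: l_def)
    have "l * \<delta> > 0" using l \<delta> by simp
    then have "l - q \<ge> 0" using q by (simp add: algebra_simps)
    have "(l - q) / p \<le> (l - q) / 2" using p2 \<open>l - q \<ge> 0\<close> by (intro divide_left_mono) auto
    then have "q + (l - q) / p \<le> l * (1 - \<delta> / 2)" using q by (simp add: field_simps)
    then have "\<Lambda> / n * (q + (l - q) / p) \<le> \<Lambda> / n * (l * (1 - \<delta> / 2))"
      using \<Lambda>0 n0 by (intro mult_left_mono) auto
    also have "... \<le> (\<alpha> * n ^ (r - 1) * (1 + \<delta> / 8)) * (l * (1 - \<delta> / 2))"
      using \<Lambda>_upper' l \<delta> by (intro mult_right_mono) auto
    finally have "l * Dp \<le> l * (\<alpha> * n ^ (r - 1) * ((1 + \<delta> / 8) * (1 - \<delta> / 2)))"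
      using \<open>l * Dp \<le> \<Lambda> / n * (q + (l - q) / p)\<close> by (simp add: mult_ac)
    then have Dp_le: "Dp \<le> \<alpha> * n ^ (r - 1) * ((1 + \<delta> / 8) * (1 - \<delta> / 2))" using l by simp
    \<comment> \<open>The relative defect of the part weights; \<open>\<epsilon>\<close> was chosen
      so that \<open>r - 1\<close> factors \<open>1 - t\<close> lose at most
      \<open>\<delta> / 4\<close>.\<close>
    define t where "t = (2 * real k + 1) * real k * \<epsilon>"
    have t: "real (r - 1) * t \<le> \<delta> / 4" "t \<ge> 0" using \<epsilon> by (auto simp: t_def)
    have t1: "t \<le> 1"
    proof -
      have "1 * t \<le> real (r - 1) * t" using r t(2) by (intro mult_right_mono) auto
      then show ?thesis using t \<delta> by linarith
    qed
    have a: "a = n / real k * (1 - t)" using k2 by (simp add: a_def t_def field_simps)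
    have a0: "a \<ge> 0" unfolding a using t1 n0 by simp
    have "real (card ({..<k} - {0}) choose (r - 1)) * a ^ (r - 1) \<le> clique_weight ?G Y z (r - 1)"
    proof (rule multipartite_weight_lower)
      show "c ` Y \<subseteq> {..<k} - {0}" using c(1) WU by (auto simp: Y_def)
      show "r - 1 \<le> card ({..<k} - {0})" using kr k2 by simp
      fix j assume j: "j \<in> {..<k} - {0}"
      then have "{v\<in>Y. c v = j} = {v\<in>U. c v = j}" by (auto simp: Y_def)
      then show "a \<le> sum z {v\<in>Y. c v = j}" using c(3)[of j] j by simp
    qed (use finY z0 a0 in auto)
    moreover have "card ({..<k} - {0}) = k - 1" using k2 by simp
    ultimately have "fact (r - 1) * (real ((k - 1) choose (r - 1)) * a ^ (r - 1)) \<le> Dp"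
      unfolding Dp_def by (intro mult_left_mono) auto
    moreover have "fact (r - 1) * (real ((k - 1) choose (r - 1)) * a ^ (r - 1)) = \<alpha> * n ^ (r - 1) * (1 - t) ^ (r - 1)"
    proof -
      have "fact (r - 1) * (real ((k - 1) choose (r - 1)) * a ^ (r - 1)) = \<alpha> * real k ^ (r - 1) * a ^ (r - 1)"
        by (simp only: mult.assoc[symmetric] \<alpha>_link)
      also have "... = \<alpha> * n ^ (r - 1) * (1 - t) ^ (r - 1)"
        unfolding a using k2 by (simp add: power_mult_distrib power_divide)
      finally show ?thesis .
    qed
    ultimately have "\<alpha> * n ^ (r - 1) * (1 - t) ^ (r - 1) \<le> \<alpha> * n ^ (r - 1) * ((1 + \<delta> / 8) * (1 - \<delta> / 2))"
      using Dp_le by linarith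
    then have up: "(1 - t) ^ (r - 1) \<le> (1 + \<delta> / 8) * (1 - \<delta> / 2)"
      using \<alpha>0 n0 by (simp only: mult_le_cancel_left_pos mult_pos_pos zero_less_power)
    have "1 + real (r - 1) * (- t) \<le> (1 + - t) ^ (r - 1)" by (rule Bernoulli_inequality) (use t1 in simp)
    then have "1 - \<delta> / 4 \<le> (1 + \<delta> / 8) * (1 - \<delta> / 2)" using up t(1) by simp
    moreover have "(1 + \<delta> / 8) * (1 - \<delta> / 2) = 1 - \<delta> / 4 - \<delta> / 8 - \<delta> * \<delta> / 16" by (simp add: field_simps)
    moreover have "\<delta> * \<delta> > 0" using \<delta> by simp
    ultimately show False using \<delta>(1) by linarith
  qed
  then have UV: "U = V" using LU by simp
  moreover have "inj_on c e" if "e \<in> edges H" for e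
    using c(2)[OF that] ed[OF that] UV by (simp add: Int_absorb2)
  ultimately show ?thesis using c(1) by blast
qed

end


section \<open>From the colouring to the Turan graph\<close>

context near_extremal
begin

text \<open>The colouring makes \<open>H\<close> a subgraph of a complete \<open>k\<close>-partite
  \<open>?K\<close>. Since \<open>U = V\<close> and \<open>\<delta> < 1\<close>, all entries of
  \<open>z\<close> are positive, so a missing edge would make \<open>z\<close> strictly better on
  \<open>?K\<close> than \<open>\<Lambda>\<close>, although no such \<open>?K\<close> beats the
  Turan graph and hence \<open>H\<close>.\<close>

lemma isomorphic_turan:
  assumes N: "n = real N" and \<Lambda>: "\<Lambda> = spectral_radius r p H * n powr (real r / p)"
    and T: "spectral_radius r p (turan r N k) \<le> spectral_radius r p H"
  shows "isomorphic H (turan r N k)"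
proof -
  obtain c :: "'a \<Rightarrow> nat" where UV: "U = V" and c: "c ` V \<subseteq> {..<k}" "\<And>e. e \<in> edges H \<Longrightarrow> inj_on c e"
    using U_eq_V_and_partition by blast
  let ?K = "complete_partite r V c"
  have K: "r_graph r ?K" using finV by (rule r_graph_complete_partite)
  have cardV: "card V = N" using n(1) N by simp
  have Nk: "N > k" using n(2) N by simp
  have zpos: "z v > 0" if "v \<in> V" for v
  proof -
    have "v \<in> U" using that UV by simp
    then show ?thesis using \<delta>(2) by (simp add: U_def)
  qed
  have sub: "edges H \<subseteq> edges ?K"
    unfolding edges_complete_partite[OF finV] using c(2) ed
    by (force simp: cliques_def pairwise_def inj_on_def)
  have le_KT: "spectral_radius r p ?K \<le> spectral_radius r p (turan r N k)"
    by (rule complete_partite_le_turan(1)[OF finV cardV r kr p Nk c(1)])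
  have KZ: "poly_form r ?K z \<le> spectral_radius r p ?K * n powr (real r / p)"
    using poly_form_le_spectral_radius[OF K, of p z] Vne p2 r z0 zp by simp
  have npos: "n powr (real r / p) > 0" using n0 by simp
  have "poly_form r ?K z \<le> spectral_radius r p H * n powr (real r / p)"
    using KZ le_KT T npos by (meson mult_right_mono order_trans less_imp_le)
  then have KH: "poly_form r ?K z \<le> \<Lambda>" using \<Lambda> by simp
  have fK: "finite (edges ?K)" using K by (rule finite_edges)
  have eK: "e \<subseteq> V" if "e \<in> edges ?K" for e using K that by (auto simp: r_graph_def)
  have "edges H = edges ?K"
  proof (rule ccontr)
    assume "edges H \<noteq> edges ?K"
    then obtain e where e: "e \<in> edges ?K - edges H" using sub by blast
    have "(\<Sum>e\<in>edges H. \<Prod>v\<in>e. z v) < (\<Sum>e\<in>edges ?K. \<Prod>v\<in>e. z v)"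
    proof (rule sum_strict_mono2[OF fK sub e])
      show "(\<Prod>v\<in>e. z v) > 0" by (rule prod_pos) (use e eK zpos in auto)
    qed (use z0 in \<open>auto intro: prod_nonneg\<close>)
    then have "\<Lambda> < poly_form r ?K z" unfolding poly_form_def by simp
    then show False using KH by simp
  qed
  then have HK: "H = ?K" by (cases H) (simp add: complete_partite_def)
  have "spectral_radius r p ?K = spectral_radius r p (turan r N k)"
    using le_KT T HK by simp
  then have "isomorphic ?K (turan r N k)"
    by (rule complete_partite_le_turan(2)[OF finV cardV r kr p Nk c(1)])
  then show ?thesis using HK by simp
qed

end

section \<open>Choice of the constants and conclusion\<close>

lemma eventually_le_linear:
  fixes c d :: real
  assumes "d > 0"
  shows "eventually (\<lambda>n. c \<le> d * real n) sequentially"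
proof -
  have "c \<le> d * real n" if "n \<ge> nat \<lceil>c / d\<rceil>" for n
  proof -
    have "c / d \<le> real n" using that by (simp add: nat_le_iff ceiling_le_iff)
    then show ?thesis using assms by (simp add: pos_divide_le_eq mult.commute)
  qed
  then show ?thesis by (rule eventually_sequentiallyI)
qed

theorem theorem1p3:
  fixes k r :: nat and p :: real
  assumes "r \<ge> 2" and "k \<ge> r" and "p \<ge> real r"
  shows "\<exists>n0. \<forall>n>n0. \<forall>H :: nat hypergraph.
           r_graph r H \<and> card (verts H) = n \<and> free_of (expanded_clique r (k + 1)) H \<longrightarrow>
             spectral_radius r p H \<le> spectral_radius r p (turan r n k) \<and>
             (spectral_radius r p H = spectral_radius r p (turan r n k) \<longleftrightarrow>
                isomorphic H (turan r n k))"
proof -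
  have k2: "k \<ge> 2" and p2: "p \<ge> 2" using assms by linarith+
  define M where "M = Suc k + r * (Suc k)\<^sup>2"
  define \<alpha> where "\<alpha> = fact r * real (k choose r) / real k ^ r"
  define Z where "Z = Max {1, 2 / \<alpha>}"
  define C1 where "C1 = fact r * real M * Z ^ r / \<alpha>"
  define C2 where "C2 = real k * real r + C1"
  \<comment> \<open>The factor \<open>p\<close> in the denominator absorbs \<open>p - 1\<close> in
    the Bernoulli loss at vertices of \<open>U\<close>.\<close>
  define \<delta> where "\<delta> = 1 / (64 * real k * p)"
  define a1 where "a1 = real (r - 1) * (real k * (2 * real k + 2) + real k + 2)"
  define a2 where "a2 = real (r - 1) * ((2 * real k + 1) * real k)"
  \<comment> \<open>The three entries keep \<open>\<epsilon> * n\<close> small against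
    \<open>n / k\<close> in the partition argument, against its share of the slack in the link bound
    for \<open>U\<close>, and against \<open>\<delta>\<close> when light vertices are moved.\<close>
  define \<epsilon> where "\<epsilon> = Min {1 / (32 * real k ^ 3), \<alpha> / (64 * real k * a1), \<delta> / (4 * a2)}"
  \<comment> \<open>The loss at vertices of \<open>W\<close> is linear in \<open>\<eta>\<close> with
    coefficient \<open>b\<close>.\<close>
  define b where "b = p - 1 + fact (r - 1) * Z ^ (r - 1) / \<alpha>"
  define \<eta> where "\<eta> = min \<delta> (\<epsilon> / (2 * b))"
  have kpos: "real k > 0" using k2 by simp
  have \<alpha>0: "\<alpha> > 0" using assms k2 by (simp add: \<alpha>_def zero_less_binomial)
  have Z1: "Z \<ge> 1" by (simp add: Z_def)
  have \<delta>: "0 < \<delta>" "\<delta> < 1" "(p - 1) * \<delta> \<le> 1 / (64 * real k)"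
  proof -
    have kp: "real k * p \<ge> 1 * 1" using k2 p2 by (intro mult_mono) auto
    show "0 < \<delta>" using kpos p2 by (simp add: \<delta>_def)
    have "64 * real k * p > 1" unfolding mult.assoc using kp by linarith
    then show "\<delta> < 1" unfolding \<delta>_def by (subst divide_less_eq_1_pos) linarith+
    show "(p - 1) * \<delta> \<le> 1 / (64 * real k)" using kpos p2 by (simp add: \<delta>_def field_simps)
  qed
  have a: "a1 > 0" "a2 > 0" using assms(1) kpos by (auto simp: a1_def a2_def intro!: mult_pos_pos add_pos_pos)
  have \<epsilon>le: "\<epsilon> \<le> 1 / (32 * real k ^ 3)" "\<epsilon> \<le> \<alpha> / (64 * real k * a1)" "\<epsilon> \<le> \<delta> / (4 * a2)"
    by (auto simp: \<epsilon>_def)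
  have \<epsilon>: "0 < \<epsilon>" "32 * real k ^ 3 * \<epsilon> \<le> 1" "a1 * \<epsilon> / \<alpha> \<le> 1 / (64 * real k)" "a2 * \<epsilon> \<le> \<delta> / 4"
  proof -
    show "0 < \<epsilon>" using kpos \<alpha>0 a \<delta> by (simp add: \<epsilon>_def)
    show "32 * real k ^ 3 * \<epsilon> \<le> 1" using \<epsilon>le(1) kpos by (simp add: field_simps)
    show "a1 * \<epsilon> / \<alpha> \<le> 1 / (64 * real k)" using \<epsilon>le(2) kpos \<alpha>0 a by (simp add: field_simps)
    show "a2 * \<epsilon> \<le> \<delta> / 4" using \<epsilon>le(3) a by (simp add: field_simps)
  qed
  have b: "b > 0" using p2 \<alpha>0 Z1 by (simp add: b_def add_pos_nonneg)
  have \<eta>: "0 < \<eta>" "\<eta> \<le> \<delta>" "(p - 1) * \<eta> + fact (r - 1) * \<eta> * Z ^ (r - 1) / \<alpha> \<le> \<epsilon> / 2"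
  proof -
    show "0 < \<eta>" "\<eta> \<le> \<delta>" using \<delta> \<epsilon> b by (auto simp: \<eta>_def)
    have "b * \<eta> \<le> b * (\<epsilon> / (2 * b))" using b by (intro mult_left_mono) (auto simp: \<eta>_def)
    also have "... = \<epsilon> / 2" using b by simp
    moreover have "(p - 1) * \<eta> + fact (r - 1) * \<eta> * Z ^ (r - 1) / \<alpha> = b * \<eta>"
      using \<alpha>0 by (simp add: b_def field_simps)
    ultimately show "(p - 1) * \<eta> + fact (r - 1) * \<eta> * Z ^ (r - 1) / \<alpha> \<le> \<epsilon> / 2" by simp
  qed
  \<comment> \<open>Every requirement on \<open>n\<close> is brought into the form constant at most
    positive multiple of \<open>n\<close>; the first one ensures \<open>n > k\<close>.\<close>
  define large where "large n \<longleftrightarrow> real k + 1 \<le> 1 * real n \<and> real k * real r \<le> 1 / 2 * real n \<and>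
      real k * real r \<le> \<epsilon> / 2 * real n \<and>
      real k * real r \<le> 1 / (64 * real k) * real n \<and>
      fact (r - 1) * real M * Z ^ (r - 1) / \<alpha> \<le> 1 / (64 * real k) * real n \<and>
      real r * Z \<le> \<epsilon> * real n \<and>
      C2 + Z * (2 * C2 / \<eta>\<^sup>2 + real r * real M / \<eta>) \<le> \<epsilon> * real n \<and>
      C1 \<le> \<delta> / 8 * real n" for n :: nat
  have "eventually large sequentially"
    unfolding large_def[abs_def] using \<epsilon>(1) \<delta>(1) kpos
    by (intro eventually_conj eventually_le_linear) auto
  then obtain n0 where n0: "\<And>n. n \<ge> n0 \<Longrightarrow> large n"
    unfolding eventually_sequentially by blast
  show ?thesis
  proof (intro exI[of _ n0] allI impI)
    fix n and H :: "nat hypergraph"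
    assume "n > n0" and hyp: "r_graph r H \<and> card (verts H) = n \<and> free_of (expanded_clique r (k + 1)) H"
    then have H: "r_graph r H" and cardV: "card (verts H) = n"
      and free: "free_of (expanded_clique r (Suc k)) H" by auto
    have n: "real k + 1 \<le> real n" "real k * real r \<le> real n / 2" "real k * real r \<le> \<epsilon> / 2 * real n"
      "real k * real r \<le> real n / (64 * real k)"
      "fact (r - 1) * real M * Z ^ (r - 1) / \<alpha> \<le> real n / (64 * real k)" "real r * Z \<le> \<epsilon> * real n"
      "C2 + Z * (2 * C2 / \<eta>\<^sup>2 + real r * real M / \<eta>) \<le> \<epsilon> * real n" "C1 \<le> \<delta> / 8 * real n"
      using n0[of n] \<open>n > n0\<close> by (simp_all add: large_def)
    have nk: "n > k" using n(1) by simp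
    have npos: "real n > 0" using nk by simp
    have finV: "finite (verts H)" using H by (simp add: r_graph_def)
    have ne: "verts H \<noteq> {}" using cardV nk by auto
    let ?T = "turan r n k" and ?s = "real r / p"
    \<comment> \<open>This suffices for both claims: a radius above that of the Turan graph would
      give an isomorphism and hence equal radii.\<close>
    have key: "isomorphic H ?T" if le: "spectral_radius r p ?T \<le> spectral_radius r p H"
    proof -
      obtain x where x: "\<And>v. x v \<ge> 0" "(\<Sum>v\<in>verts H. x v powr p) = 1" "poly_form r H x = spectral_radius r p H"
        using spectral_radius_nonneg_maximizer[OF H ne, of p] p2 by auto
      \<comment> \<open>The p-th powers of the rescaled entries sum to \<open>n\<close>, so the
        ideal entry is 1 for every \<open>n\<close>.\<close>
      define z where "z v = real n powr (1 / p) * x v" for v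
      have z0: "z v \<ge> 0" for v using x(1) by (simp add: z_def)
      have "z v powr p = real n * x v powr p" for v
        using x(1) npos p2 by (simp add: z_def powr_mult powr_powr)
      then have zp: "(\<Sum>v\<in>verts H. z v powr p) = real n" using x(2) by (simp flip: sum_distrib_left)
      have "poly_form r H z = (real n powr (1 / p)) ^ r * poly_form r H x"
        unfolding z_def by (rule poly_form_scale[OF H])
      also have "(real n powr (1 / p)) ^ r = real n powr ?s"
        using npos by (simp add: powr_powr flip: powr_realpow)
      finally have \<Lambda>: "poly_form r H z = spectral_radius r p H * real n powr ?s" using x(3) by simp
      have scale: "spectral_radius r p H * S powr ?s = poly_form r H z * (S / real n) powr ?s" if "S \<ge> 0" for S
        using that npos by (simp add: \<Lambda> powr_divide)
      have S0: "(\<Sum>v\<in>verts H. y v powr p) \<ge> 0" for y by (simp add: sum_nonneg)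
      have "near_extremal r k M H z p \<alpha> Z \<delta> \<epsilon> \<eta> C1 C2 (real n)"
      proof
        show "poly_form r H y \<le> poly_form r H z * ((\<Sum>v\<in>verts H. y v powr p) / real n) powr ?s"
          if "\<And>v. y v \<ge> 0" for y
          unfolding scale[OF S0, symmetric]
          by (rule poly_form_le_spectral_radius[OF H ne]) (use p2 assms(1) that in auto)
        show "poly_form r (complete_partite r (verts H) c) y \<le>
            poly_form r H z * ((\<Sum>v\<in>verts H. y v powr p) / real n) powr ?s"
          if y: "\<And>v. y v \<ge> 0" and c: "c ` verts H \<subseteq> {..<k}" for y c
        proof -
          have "poly_form r (complete_partite r (verts H) c) y \<le>
              spectral_radius r p (complete_partite r (verts H) c) * (\<Sum>v\<in>verts H. y v powr p) powr ?s"
            using poly_form_le_spectral_radius[OF r_graph_complete_partite[OF finV, of r c], of p y] ne p2 assms(1) y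
            by simp
          also have "... \<le> spectral_radius r p H * (\<Sum>v\<in>verts H. y v powr p) powr ?s"
            using complete_partite_le_turan(1)[OF finV cardV assms nk c] le
            by (intro mult_right_mono) auto
          finally show ?thesis unfolding scale[OF S0] .
        qed
        show "\<alpha> * (real n - real k) ^ r \<le> poly_form r H z"
        proof -
          have "real n / real k - 1 = (real n - real k) / real k" using kpos by (simp add: diff_divide_distrib)
          then have "\<alpha> * (real n - real k) ^ r = fact r * real (k choose r) * (real n / real k - 1) ^ r"
            by (simp add: \<alpha>_def power_divide)
          also have "... \<le> poly_form r ?T (\<lambda>_. 1)" using assms nk by (intro turan_poly_form_lower) auto
          also have "... \<le> spectral_radius r p ?T * (\<Sum>v\<in>verts ?T. 1 powr p) powr ?s"
            by (rule poly_form_le_spectral_radius[OF r_graph_turan]) (use nk p2 assms(1) in auto)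
          also have "... = spectral_radius r p ?T * real n powr ?s" by simp
          also have "... \<le> poly_form r H z" unfolding \<Lambda> using le by (intro mult_right_mono) auto
          finally show ?thesis .
        qed
        show "Suc k + r * (Suc k)\<^sup>2 \<le> M" by (simp add: M_def)
        show "real n = real (card (verts H))" "real n > real k" using cardV nk by simp_all
        show "real (r - 1) * (real k * (2 * real k + 2) + real k + 2) * \<epsilon> / \<alpha> \<le> 1 / (64 * real k)"
          using \<epsilon>(3) by (simp only: a1_def)
        show "real (r - 1) * ((2 * real k + 1) * real k * \<epsilon>) \<le> \<delta> / 4"
          using \<epsilon>(4) by (simp only: a2_def mult.assoc)
      qed (rule assms H free z0 zp \<alpha>_def Z_def C1_def C2_def \<delta> \<epsilon>(1,2) \<eta> n(2-8))+
      then show ?thesis by (rule near_extremal.isomorphic_turan[OF _ refl \<Lambda> le])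
    qed
    have iso_eq: "spectral_radius r p H = spectral_radius r p ?T" if "isomorphic H ?T"
      by (rule spectral_radius_isomorphic[OF that H r_graph_turan ne]) (use p2 in simp)
    show "spectral_radius r p H \<le> spectral_radius r p ?T \<and>
        (spectral_radius r p H = spectral_radius r p ?T \<longleftrightarrow> isomorphic H ?T)"
      using key iso_eq by (cases "spectral_radius r p ?T \<le> spectral_radius r p H") auto
  qed
qed

end
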